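(* Let $\Omega\subset\mathbb{R}^n$ be a bounded domain with smooth boundary, $\Gamma\subset\partial\Omega$ a subboundary, $x_0\in\Gamma$, $T>0$, $\delta_0>0$, $M>0$, and $p\in C(\overline{\Omega})$ fixed, and let $\mathcal{H}$ be the admissible set of vector fields defined in the context. Let $a_1,\dots,a_n\in C^1(\overline\Omega)$ satisfy $$|\det(\nabla a_1(x),\dots,\nabla a_n(x))|\neq 0,\qquad x\in\overline{\Omega},$$ and let $M_0>0$ be a constant. Then there exist constants $C>0$, $\theta\in(0,1)$ and a subdomain $D\subset\Omega$ with $x_0\in\partial D\cap\partial\Omega\subset\Gamma$ such that $$\|H_1-H_2\|_{L^2(D)}\le C\left(\sum_{k=1}^n\|\partial_tu(H_1,a_k)-\partial_tu(H_2,a_k)\|_{L^2(\Gamma\times(0,T))}^{\theta}+\sum_{k=1}^n\|\partial_tu(H_1,a_k)-\partial_tu(H_2,a_k)\|_{L^2(\Gamma\times(0,T))}\right)$$ for all $H_1,H_2\in\mathcal{H}$ and all choices of solutions $u(H_j,a_k)$ satisfying $$\partial_tu(H_j,a_k)\in C^1(\overline\Omega\times[0,T]),\qquad \|\partial_t\nabla u(H_j,a_k)\|_{L^2(0,T;L^\infty(\Omega))}\le M_0,\qquad j=1,2,\ k=1,\dots,n.$$ Here (with $p$ and $a_1,\dots,a_n$ fixed) the constants $C$ and $\theta$ depend on $T,\Gamma,\mathcal{H}$ and $M_0$, while $D$ depends on $T,\Gamma,\mathcal{H}$, and is independent of the choice of $H_1,H_2$.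
   Context: A subboundary means a nonempty relatively open subset of $\partial\Omega$. $(x\cdot y)$ is the Euclidean scalar product, $|x|$ the Euclidean norm, $\nabla$ is the gradient in $x$ (a column vector), and $\nu(x)$ is the outward unit normal to $\partial\Omega$ at $x$. Admissible set: $$\mathcal{H}=\{H\in (C^1(\overline\Omega))^n:\ \|H\|_{(C^1(\overline\Omega))^n}\le M,\ (H(x_0)\cdot\nu(x_0))>\delta_0,\ |H(x)|>\delta_0\ \text{for } x\in\Omega\},$$ where for $H=(h_1,\dots,h_n)$ one may take $\|H\|_{(C^1(\overline\Omega))^n}=\max_{\overline\Omega}|H|+\max_{\overline\Omega}\big(\sum_{j,k}|\partial_kh_j|^2\big)^{1/2}$. For $H\in\mathcal{H}$ and $a\in C^1(\overline\Omega)$, $u(H,a)$ denotes one arbitrarily chosen solution $u\in C^1(\overline\Omega\times[0,T])$ of $$\partial_tu+(H(x)\cdot\nabla u)+p(x)u=0\ \text{ in }\Omega\times(0,T),\qquad u(x,0)=a(x),\ x\in\Omega.$$ No boundary condition is imposed, so there are in general many such solutions. *)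

theory Defs
  imports "HOL-Probability.Probability"
begin

section \<open>Differentiation\<close>

definition grad :: "(real^'n \<Rightarrow> real) \<Rightarrow> real^'n \<Rightarrow> real^'n" where
  "grad f x = (\<chi> i. frechet_derivative f (at x) (axis i 1))"

(* Partial derivative in the open set U, extended to the closure of U by its limit. *)
definition partial_closure ::
    "(real^'n) set \<Rightarrow> (real^'n \<Rightarrow> real) \<Rightarrow> 'n \<Rightarrow> real^'n \<Rightarrow> real" where
  "partial_closure U f i x = Lim (at x within U) (\<lambda>y. frechet_derivative f (at y) (axis i 1))"

definition grad_closure :: "(real^'n) set \<Rightarrow> (real^'n \<Rightarrow> real) \<Rightarrow> real^'n \<Rightarrow> real^'n" where
  "grad_closure U f x = (\<chi> i. partial_closure U f i x)"

(* C^1 up to the boundary, for open U: f is C^1 in U, and f and its derivative have continuous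
   extensions to the closure; the values of f on the closure are those of its extension. *)
definition C1_closure ::
    "'a::euclidean_space set \<Rightarrow> ('a \<Rightarrow> 'b::real_normed_vector) \<Rightarrow> bool" where
  "C1_closure U f \<longleftrightarrow> continuous_on (closure U) f \<and>
     (\<exists>f'::'a \<Rightarrow> ('a \<Rightarrow>\<^sub>L 'b). continuous_on (closure U) f' \<and>
        (\<forall>x\<in>U. (f has_derivative blinfun_apply (f' x)) (at x)))"

definition C1_norm :: "(real^'n) set \<Rightarrow> (real^'n \<Rightarrow> real^'n) \<Rightarrow> real" where
  "C1_norm U H = (SUP x\<in>closure U. norm (H x)) +
     (SUP x\<in>closure U. sqrt (\<Sum>j\<in>UNIV. \<Sum>k\<in>UNIV. (partial_closure U (\<lambda>y. H y $ j) k x)\<^sup>2))"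

(* For functions of (x, t); one-sided at t = 0 and t = T. *)
definition dt :: "real \<Rightarrow> ((real^'n) \<times> real \<Rightarrow> 'b::real_normed_vector) \<Rightarrow> (real^'n) \<times> real \<Rightarrow> 'b" where
  "dt T u = (\<lambda>(x, t). vector_derivative (\<lambda>s. u (x, s)) (at t within {0..T}))"

definition grad_x :: "((real^'n) \<times> real \<Rightarrow> real) \<Rightarrow> (real^'n) \<times> real \<Rightarrow> real^'n" where
  "grad_x u = (\<lambda>(x, t). grad (\<lambda>y. u (y, t)) x)"

primrec Ck_on ::
    "nat \<Rightarrow> 'a::euclidean_space set \<Rightarrow> ('a \<Rightarrow> 'b::real_normed_vector) \<Rightarrow> bool" where
  "Ck_on 0 U f \<longleftrightarrow> continuous_on U f"
| "Ck_on (Suc k) U f \<longleftrightarrow>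
     (\<exists>f'. (\<forall>x\<in>U. (f has_derivative f' x) (at x)) \<and> (\<forall>v. Ck_on k U (\<lambda>x. f' x v)))"

definition smooth_on :: "'a::euclidean_space set \<Rightarrow> ('a \<Rightarrow> 'b::real_normed_vector) \<Rightarrow> bool" where
  "smooth_on U f \<longleftrightarrow> (\<forall>k. Ck_on k U f)"


section \<open>Domains with smooth boundary\<close>

definition domain :: "'a::topological_space set \<Rightarrow> bool" where
  "domain \<Omega> \<longleftrightarrow> open \<Omega> \<and> connected \<Omega> \<and> \<Omega> \<noteq> {}"

definition local_defining_function ::
    "(real^'n) set \<Rightarrow> (real^'n) set \<Rightarrow> (real^'n \<Rightarrow> real) \<Rightarrow> bool" where
  "local_defining_function \<Omega> U \<rho> \<longleftrightarrow> open U \<and> smooth_on U \<rho> \<and>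
     (\<forall>y\<in>U. grad \<rho> y \<noteq> 0) \<and> \<Omega> \<inter> U = {y\<in>U. \<rho> y < 0}"

definition smooth_boundary :: "(real^'n) set \<Rightarrow> bool" where
  "smooth_boundary \<Omega> \<longleftrightarrow>
     (\<forall>x\<in>frontier \<Omega>. \<exists>U \<rho>. x \<in> U \<and> local_defining_function \<Omega> U \<rho>)"

(* The direction of the gradient does not depend on the choice of U and \<rho>. *)
definition outward_normal :: "(real^'n) set \<Rightarrow> real^'n \<Rightarrow> real^'n" where
  "outward_normal \<Omega> x =
     (THE v. \<exists>U \<rho>. x \<in> U \<and> local_defining_function \<Omega> U \<rho> \<and> v = sgn (grad \<rho> x))"

definition subboundary :: "'a::topological_space set \<Rightarrow> 'a set \<Rightarrow> bool" where
  "subboundary \<Omega> \<Gamma> \<longleftrightarrow> \<Gamma> \<noteq> {} \<and> openin (top_of_set (frontier \<Omega>)) \<Gamma>"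


section \<open>Surface measure\<close>

(* The empty set is singled out because 0 ^ 0 = 1. *)
definition hausdorff_gauge :: "nat \<Rightarrow> 'a::metric_space set \<Rightarrow> ennreal" where
  "hausdorff_gauge s E =
     (if E = {} then 0 else ennreal (unit_ball_vol (real s) * (diameter E / 2) ^ s))"

definition hausdorff_pre :: "nat \<Rightarrow> real \<Rightarrow> 'a::metric_space set \<Rightarrow> ennreal" where
  "hausdorff_pre s \<delta> A =
     (INF E\<in>{E. A \<subseteq> (\<Union>i::nat. E i) \<and> (\<forall>i. bounded (E i) \<and> diameter (E i) \<le> \<delta>)}.
        \<Sum>i. hausdorff_gauge s (E i))"

definition hausdorff_outer :: "nat \<Rightarrow> 'a::metric_space set \<Rightarrow> ennreal" where
  "hausdorff_outer s A = (SUP \<delta>\<in>{0<..}. hausdorff_pre s \<delta> A)"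

definition hausdorff_measure :: "nat \<Rightarrow> 'a::metric_space measure" where
  "hausdorff_measure s = measure_of UNIV (sets borel) (hausdorff_outer s)"

lemma hausdorff_gauge_empty [simp]: "hausdorff_gauge s {} = 0"
  by (simp add: hausdorff_gauge_def)

lemma hausdorff_pre_le:
  assumes "A \<subseteq> (\<Union>i::nat. E i)" "\<And>i. bounded (E i)" "\<And>i. diameter (E i) \<le> \<delta>"
  shows "hausdorff_pre s \<delta> A \<le> (\<Sum>i. hausdorff_gauge s (E i))"
  unfolding hausdorff_pre_def using assms by (intro INF_lower) auto

lemma hausdorff_pre_mono: "A \<subseteq> B \<Longrightarrow> hausdorff_pre s \<delta> A \<le> hausdorff_pre s \<delta> B"
  unfolding hausdorff_pre_def by (intro INF_superset_mono) auto

lemma hausdorff_pre_antimono: "\<delta> \<le> \<delta>' \<Longrightarrow> hausdorff_pre s \<delta>' A \<le> hausdorff_pre s \<delta> A"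
  unfolding hausdorff_pre_def by (intro INF_superset_mono) (auto intro: order_trans)

lemma hausdorff_outer_mono: "A \<subseteq> B \<Longrightarrow> hausdorff_outer s A \<le> hausdorff_outer s B"
  unfolding hausdorff_outer_def by (intro SUP_mono) (auto intro: hausdorff_pre_mono)

lemma hausdorff_outer_empty: "hausdorff_outer s {} = 0"
proof -
  have "hausdorff_pre s \<delta> {} = 0" if "\<delta> > 0" for \<delta>
    using hausdorff_pre_le[of "{}" "\<lambda>_. {}" \<delta> s] that by simp
  then show ?thesis
    unfolding hausdorff_outer_def by (intro antisym SUP_least) auto
qed

lemma hausdorff_pre_UN: "hausdorff_pre s \<delta> (\<Union>i::nat. A i) \<le> (\<Sum>i. hausdorff_pre s \<delta> (A i))"
proof (rule ennreal_le_epsilon)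
  fix e :: real assume "0 < e" "(\<Sum>n. hausdorff_pre s \<delta> (A n)) < top"
  then have *: "hausdorff_pre s \<delta> (A n) < hausdorff_pre s \<delta> (A n) + e * (1/2)^Suc n" for n
    by (auto simp add: less_top dest!: ennreal_suminf_lessD)
  have "\<exists>E. (A n \<subseteq> (\<Union>i::nat. E i) \<and> (\<forall>i. bounded (E i) \<and> diameter (E i) \<le> \<delta>)) \<and>
      (\<Sum>i. hausdorff_gauge s (E i)) \<le> hausdorff_pre s \<delta> (A n) + e * (1/2)^Suc n" for n
  proof -
    have "\<exists>E\<in>{E. A n \<subseteq> (\<Union>i::nat. E i) \<and> (\<forall>i. bounded (E i) \<and> diameter (E i) \<le> \<delta>)}.
      (\<Sum>i. hausdorff_gauge s (E i)) < hausdorff_pre s \<delta> (A n) + e * (1/2)^Suc n"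
      using *[of n] unfolding hausdorff_pre_def INF_less_iff .
    then show ?thesis
      by (auto intro: less_imp_le)
  qed
  then obtain B where B: "\<And>n. A n \<subseteq> (\<Union>i::nat. B n i)"
      "\<And>n i. bounded (B n i)" "\<And>n i. diameter (B n i) \<le> \<delta>"
      "\<And>n. (\<Sum>i. hausdorff_gauge s (B n i)) \<le> hausdorff_pre s \<delta> (A n) + e * (1/2)^Suc n"
    by metis
  define C where "C = case_prod B o prod_decode"
  have AC: "(\<Union>i. A i) \<subseteq> (\<Union>i. C i)"
    using B(1) by (auto simp add: C_def subset_eq) (metis prod.case prod_encode_inverse)
  have "hausdorff_pre s \<delta> (\<Union>i. A i) \<le> (\<Sum>i. hausdorff_gauge s (C i))"
    using AC B(2,3) by (intro hausdorff_pre_le) (auto simp: C_def split: prod.splits)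
  also have "\<dots> = (\<Sum>n. \<Sum>i. hausdorff_gauge s (B n i))"
    unfolding C_def comp_def by (intro suminf_ennreal_2dimen) auto
  also have "\<dots> \<le> (\<Sum>n. hausdorff_pre s \<delta> (A n) + e * (1/2) ^ Suc n)"
    by (intro suminf_le allI B(4)) auto
  also have "\<dots> = (\<Sum>n. hausdorff_pre s \<delta> (A n)) + (\<Sum>n. ennreal e * ennreal ((1/2) ^ Suc n))"
    using \<open>0 < e\<close> by (subst suminf_add[symmetric])
                     (auto simp del: ennreal_suminf_cmult simp add: ennreal_mult[symmetric])
  also have "\<dots> = (\<Sum>n. hausdorff_pre s \<delta> (A n)) + e"
    unfolding ennreal_suminf_cmult
    by (subst suminf_ennreal_eq[OF zero_le_power power_half_series]) auto
  finally show "hausdorff_pre s \<delta> (\<Union>i. A i) \<le> (\<Sum>n. hausdorff_pre s \<delta> (A n)) + e" .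
qed

lemma hausdorff_outer_UN: "hausdorff_outer s (\<Union>i::nat. A i) \<le> (\<Sum>i. hausdorff_outer s (A i))"
  unfolding hausdorff_outer_def[of s "\<Union>i. A i"]
proof (rule SUP_least)
  fix \<delta> :: real assume "\<delta> \<in> {0<..}"
  then have "(\<Sum>i. hausdorff_pre s \<delta> (A i)) \<le> (\<Sum>i. hausdorff_outer s (A i))"
    unfolding hausdorff_outer_def by (intro suminf_le SUP_upper) auto
  then show "hausdorff_pre s \<delta> (\<Union>i. A i) \<le> (\<Sum>i. hausdorff_outer s (A i))"
    using hausdorff_pre_UN order_trans by blast
qed

lemma outer_measure_space_hausdorff: "outer_measure_space (Pow UNIV) (hausdorff_outer s)"
  by (auto simp: outer_measure_space_def positive_def increasing_def countably_subadditive_def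
      intro: hausdorff_outer_empty hausdorff_outer_mono hausdorff_outer_UN)

lemma hausdorff_outer_Un: "hausdorff_outer s (A \<union> B) \<le> hausdorff_outer s A + hausdorff_outer s B"
proof -
  have "hausdorff_outer s (\<Union>i. binaryset A B i) \<le> (\<Sum>i. hausdorff_outer s (binaryset A B i))"
    by (rule hausdorff_outer_UN)
  also have "\<dots> = hausdorff_outer s A + hausdorff_outer s B"
    by (rule suminf_binaryset_eq) (rule hausdorff_outer_empty)
  finally show ?thesis
    by (simp add: UN_binaryset_eq)
qed

lemma hausdorff_outer_separated:
  assumes "d > 0" and sep: "\<And>x y. x \<in> A \<Longrightarrow> y \<in> B \<Longrightarrow> dist x y \<ge> d"
  shows "hausdorff_outer s A + hausdorff_outer s B \<le> hausdorff_outer s (A \<union> B)"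
proof -
  have pre: "hausdorff_pre s \<delta> A + hausdorff_pre s \<delta> B \<le> hausdorff_pre s \<delta> (A \<union> B)"
    if "\<delta> < d" for \<delta>
    unfolding hausdorff_pre_def[of s \<delta> "A \<union> B"]
  proof (rule INF_greatest)
    fix E :: "nat \<Rightarrow> 'a set"
    assume "E \<in> {E. A \<union> B \<subseteq> (\<Union>i. E i) \<and> (\<forall>i. bounded (E i) \<and> diameter (E i) \<le> \<delta>)}"
    then have E: "A \<union> B \<subseteq> (\<Union>i. E i)" "\<And>i. bounded (E i)" "\<And>i. diameter (E i) \<le> \<delta>"
      by auto
    define EA where "EA i = (if E i \<inter> A = {} then {} else E i)" for i
    define EB where "EB i = (if E i \<inter> B = {} then {} else E i)" for i
    have disj: "E i \<inter> A = {} \<or> E i \<inter> B = {}" for i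
    proof (rule ccontr)
      assume "\<not> ?thesis"
      then obtain x y where "x \<in> E i" "x \<in> A" "y \<in> E i" "y \<in> B" by blast
      then show False
        using sep[of x y] diameter_bounded_bound[of "E i" x y] E(2,3)[of i] that by auto
    qed
    have "0 \<le> \<delta>"
      using E(3)[of 0] diameter_ge_0[OF E(2)[of 0]] by linarith
    have "A \<subseteq> (\<Union>i. EA i)" "B \<subseteq> (\<Union>i. EB i)"
      using E(1) unfolding EA_def EB_def by fastforce+
    then have "hausdorff_pre s \<delta> A \<le> (\<Sum>i. hausdorff_gauge s (EA i))"
      using E(2,3) \<open>0 \<le> \<delta>\<close> by (intro hausdorff_pre_le) (auto simp: EA_def)
    moreover have "hausdorff_pre s \<delta> B \<le> (\<Sum>i. hausdorff_gauge s (EB i))"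
      using E(2,3) \<open>0 \<le> \<delta>\<close> \<open>B \<subseteq> (\<Union>i. EB i)\<close> by (intro hausdorff_pre_le) (auto simp: EB_def)
    ultimately have "hausdorff_pre s \<delta> A + hausdorff_pre s \<delta> B \<le>
        (\<Sum>i. hausdorff_gauge s (EA i)) + (\<Sum>i. hausdorff_gauge s (EB i))"
      by (rule add_mono)
    also have "\<dots> = (\<Sum>i. hausdorff_gauge s (EA i) + hausdorff_gauge s (EB i))"
      by (intro suminf_add) auto
    also have "\<dots> \<le> (\<Sum>i. hausdorff_gauge s (E i))"
      using disj by (intro suminf_le) (auto simp: EA_def EB_def)
    finally show "hausdorff_pre s \<delta> A + hausdorff_pre s \<delta> B \<le> (\<Sum>i. hausdorff_gauge s (E i))" .
  qed
  have le: "hausdorff_pre s \<delta>1 A + hausdorff_pre s \<delta>2 B \<le> hausdorff_outer s (A \<union> B)"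
    if "\<delta>1 > 0" "\<delta>2 > 0" for \<delta>1 \<delta>2
  proof -
    define \<delta> where "\<delta> = min (min \<delta>1 \<delta>2) (d/2)"
    have \<delta>: "0 < \<delta>" "\<delta> < d" "\<delta> \<le> \<delta>1" "\<delta> \<le> \<delta>2"
      using that assms(1) by (auto simp: \<delta>_def)
    have "hausdorff_pre s \<delta>1 A + hausdorff_pre s \<delta>2 B \<le> hausdorff_pre s \<delta> A + hausdorff_pre s \<delta> B"
      using \<delta> by (intro add_mono hausdorff_pre_antimono) auto
    also have "\<dots> \<le> hausdorff_pre s \<delta> (A \<union> B)"
      by (rule pre[OF \<delta>(2)])
    also have "\<dots> \<le> hausdorff_outer s (A \<union> B)"
      unfolding hausdorff_outer_def using \<delta> by (intro SUP_upper) auto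
    finally show ?thesis .
  qed
  have ne: "{0<..} \<noteq> ({} :: real set)"
    using greaterThan_iff[of 1 "0::real"] by (metis empty_iff zero_less_one greaterThan_iff)
  have "hausdorff_outer s A + hausdorff_pre s \<delta>2 B \<le> hausdorff_outer s (A \<union> B)" if "\<delta>2 > 0" for \<delta>2
    unfolding hausdorff_outer_def[of s A]
    using le that by (subst ennreal_SUP_add_left[symmetric, OF ne]) (auto intro: SUP_least)
  then show ?thesis
    unfolding hausdorff_outer_def[of s B] add.commute[of "hausdorff_outer s A"]
    by (subst ennreal_SUP_add_left[symmetric, OF ne]) (auto intro: SUP_least)
qed

lemma hausdorff_outer_separated_sum:
  fixes R :: "nat \<Rightarrow> 'a::metric_space set"
  assumes "\<And>n. d n > 0"
    and sep: "\<And>m n x y. m < n \<Longrightarrow> x \<in> R m \<Longrightarrow> y \<in> R n \<Longrightarrow> dist x y \<ge> d m"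
  shows "(\<Sum>i<n. hausdorff_outer s (R i)) \<le> hausdorff_outer s (\<Union>i<n. R i)"
proof (induction n)
  case 0
  then show ?case by simp
next
  case (Suc n)
  define e where "e = Min (insert 1 (d ` {..<n}))"
  have "e > 0"
    using assms(1) by (auto simp: e_def)
  have "e \<le> d m" if "m < n" for m
    using that by (auto simp: e_def)
  then have "e \<le> dist x y" if "x \<in> (\<Union>i<n. R i)" "y \<in> R n" for x y
    using sep that by (metis UN_iff lessThan_iff order_trans)
  then have "hausdorff_outer s (\<Union>i<n. R i) + hausdorff_outer s (R n) \<le>
      hausdorff_outer s ((\<Union>i<n. R i) \<union> R n)"
    by (rule hausdorff_outer_separated[OF \<open>e > 0\<close>])
  also have "(\<Union>i<n. R i) \<union> R n = (\<Union>i<Suc n. R i)"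
    by (auto simp: less_Suc_eq)
  finally show ?case
    using order_trans[OF add_right_mono[OF Suc.IH]] by simp
qed

lemma hausdorff_outer_closed:
  assumes "closed F"
  shows "hausdorff_outer s (X \<inter> F) + hausdorff_outer s (X - F) \<le> hausdorff_outer s X"
proof (cases "F = {} \<or> hausdorff_outer s X = top")
  case True
  then show ?thesis by (auto simp: hausdorff_outer_empty)
next
  case False
  then have F: "F \<noteq> {}" and fin: "hausdorff_outer s X < top"
    by (auto simp: less_top)
  define Y where "Y k = {x\<in>X. infdist x F \<ge> 1 / real (Suc k)}" for k
  define R where "R k = {x\<in>X. 1 / real (Suc (Suc k)) \<le> infdist x F \<and> infdist x F < 1 / real (Suc k)}" for k
  have sepR: "dist x y \<ge> 1 / real (Suc (Suc m)) - 1 / real (Suc n)"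
    if "x \<in> R m" "y \<in> R n" for x y m n
  proof -
    have "infdist x F \<le> infdist y F + dist x y" by (rule infdist_triangle)
    with that show ?thesis by (auto simp: R_def)
  qed
  have sumR: "(\<Sum>i. hausdorff_outer s (R (2 * i + c))) \<le> hausdorff_outer s X" for c
  proof (rule suminf_le_const[OF summableI])
    fix n
    define d where "d m = 1 / real (Suc (Suc (2*m+c))) - 1 / real (Suc (Suc (Suc (2*m+c))))" for m
    have "(\<Sum>i<n. hausdorff_outer s (R (2*i+c))) \<le> hausdorff_outer s (\<Union>i<n. R (2*i+c))"
    proof (rule hausdorff_outer_separated_sum[where d = d])
      show "d m > 0" for m
        unfolding d_def by (simp add: frac_less2)
      show "d m \<le> dist x y" if "m < n" "x \<in> R (2*m+c)" "y \<in> R (2*n+c)" for m n x y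
      proof -
        have "1 / real (Suc (2*n+c)) \<le> 1 / real (Suc (Suc (Suc (2*m+c))))"
          using that(1) by (intro divide_left_mono) auto
        then show ?thesis
          using sepR[OF that(2,3)] by (simp add: d_def)
      qed
    qed
    also have "\<dots> \<le> hausdorff_outer s X"
      by (intro hausdorff_outer_mono) (auto simp: R_def)
    finally show "(\<Sum>i<n. hausdorff_outer s (R (2*i+c))) \<le> hausdorff_outer s X" .
  qed
  have "(\<Sum>i. hausdorff_outer s (R i)) \<le> hausdorff_outer s X + hausdorff_outer s X"
  proof (rule suminf_le_const[OF summableI])
    fix n
    have "(\<Sum>i<n. hausdorff_outer s (R i)) \<le> (\<Sum>i<2*n. hausdorff_outer s (R i))"
      by (intro sum_mono2) auto
    also have "\<dots> = (\<Sum>i<n. hausdorff_outer s (R (2*i+0))) + (\<Sum>i<n. hausdorff_outer s (R (2*i+1)))"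
      by (induction n) (auto simp: algebra_simps)
    also have "\<dots> \<le> (\<Sum>i. hausdorff_outer s (R (2*i+0))) + (\<Sum>i. hausdorff_outer s (R (2*i+1)))"
      by (intro add_mono sum_le_suminf) auto
    also have "\<dots> \<le> hausdorff_outer s X + hausdorff_outer s X"
      by (intro add_mono sumR)
    finally show "(\<Sum>i<n. hausdorff_outer s (R i)) \<le> hausdorff_outer s X + hausdorff_outer s X" .
  qed
  then have finR: "(\<Sum>i. hausdorff_outer s (R i)) < top"
    using fin by (auto simp: less_top[symmetric] top_unique intro: le_less_trans)
  have cover: "X - F \<subseteq> Y k \<union> (\<Union>i. R (i + k))" for k
  proof
    fix x assume x: "x \<in> X - F"
    then have pos: "infdist x F > 0"
      using assms F in_closed_iff_infdist_zero infdist_nonneg by (metis DiffD2 less_eq_real_def)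
    show "x \<in> Y k \<union> (\<Union>i. R (i + k))"
    proof (cases "x \<in> Y k")
      case nY: False
      define j where "j = (LEAST j. 1 / real (Suc j) \<le> infdist x F)"
      have ex: "\<exists>j. 1 / real (Suc j) \<le> infdist x F"
        using nat_approx_posE[OF pos] less_imp_le by metis
      have j: "1 / real (Suc j) \<le> infdist x F"
        unfolding j_def by (rule LeastI_ex[OF ex])
      have "k < j"
      proof (rule ccontr)
        assume "\<not> k < j"
        then have "1 / real (Suc k) \<le> 1 / real (Suc j)"
          by (intro divide_left_mono) auto
        then show False
          using j nY x by (auto simp: Y_def)
      qed
      then obtain i where i: "j = Suc i" "k \<le> i" by (cases j) auto
      then have "\<not> 1 / real (Suc i) \<le> infdist x F"
        using not_less_Least[of i "\<lambda>j. 1 / real (Suc j) \<le> infdist x F"] j_def by auto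
      then have "x \<in> R ((i - k) + k)"
        using x i j by (auto simp: R_def)
      then show ?thesis by blast
    qed simp
  qed
  have le: "hausdorff_outer s (X \<inter> F) + hausdorff_outer s (X - F) \<le>
      hausdorff_outer s X + (\<Sum>i. hausdorff_outer s (R (i + k)))" for k
  proof -
    have "hausdorff_outer s (X - F) \<le> hausdorff_outer s (Y k \<union> (\<Union>i. R (i + k)))"
      by (intro hausdorff_outer_mono cover)
    also have "\<dots> \<le> hausdorff_outer s (Y k) + hausdorff_outer s (\<Union>i. R (i + k))"
      by (rule hausdorff_outer_Un)
    also have "\<dots> \<le> hausdorff_outer s (Y k) + (\<Sum>i. hausdorff_outer s (R (i + k)))"
      by (intro add_left_mono hausdorff_outer_UN)
    finally have "hausdorff_outer s (X \<inter> F) + hausdorff_outer s (X - F) \<le>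
        (hausdorff_outer s (X \<inter> F) + hausdorff_outer s (Y k)) + (\<Sum>i. hausdorff_outer s (R (i + k)))"
      by (simp add: add.assoc add_left_mono)
    also have "hausdorff_outer s (X \<inter> F) + hausdorff_outer s (Y k) \<le> hausdorff_outer s ((X \<inter> F) \<union> Y k)"
    proof (rule hausdorff_outer_separated)
      show "1 / real (Suc k) \<le> dist x y" if "x \<in> X \<inter> F" "y \<in> Y k" for x y
        using that infdist_le[of x F y] by (auto simp: Y_def dist_commute)
    qed simp
    also have "\<dots> \<le> hausdorff_outer s X"
      by (intro hausdorff_outer_mono) (auto simp: Y_def)
    finally show ?thesis by (simp add: add_right_mono)
  qed
  define r where "r i = enn2real (hausdorff_outer s (R i))" for i
  have "hausdorff_outer s (R i) < top" for i
    using finR ennreal_suminf_lessD by blast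
  then have r: "hausdorff_outer s (R i) = ennreal (r i)" for i
    by (simp add: r_def less_top)
  have nn: "0 \<le> r i" for i by (simp add: r_def)
  have sm: "summable r"
    using finR nn unfolding r by (intro summable_suminf_not_top) auto
  have "(\<lambda>k. \<Sum>i. r (i + k)) \<longlonglongrightarrow> 0"
    using suminf_exist_split2[OF sm] .
  then have "(\<lambda>k. ennreal (\<Sum>i. r (i + k))) \<longlonglongrightarrow> ennreal 0"
    by (rule tendsto_ennrealI)
  moreover have "(\<Sum>i. hausdorff_outer s (R (i + k))) = ennreal (\<Sum>i. r (i + k))" for k
    unfolding r using nn sm by (intro suminf_ennreal2) (auto simp: summable_iff_shift)
  ultimately have "(\<lambda>k. \<Sum>i. hausdorff_outer s (R (i + k))) \<longlonglongrightarrow> 0"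
    by simp
  then have "(\<lambda>k. hausdorff_outer s X + (\<Sum>i. hausdorff_outer s (R (i + k)))) \<longlonglongrightarrow> hausdorff_outer s X + 0"
    by (intro tendsto_add tendsto_const)
  then show ?thesis
    using le by (intro LIMSEQ_le_const[where X = "\<lambda>k. hausdorff_outer s X + (\<Sum>i. hausdorff_outer s (R (i + k)))"]) auto
qed

lemma measure_space_hausdorff_outer:
  "measure_space UNIV (sets borel) (hausdorff_outer s :: 'a::metric_space set \<Rightarrow> ennreal)"
proof -
  interpret P: sigma_algebra UNIV "Pow (UNIV :: 'a set)"
    by (rule sigma_algebra_Pow)
  let ?L = "lambda_system UNIV (Pow UNIV) (hausdorff_outer s :: 'a set \<Rightarrow> ennreal)"
  have ms: "measure_space UNIV ?L (hausdorff_outer s)"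
    by (rule P.caratheodory_lemma[OF outer_measure_space_hausdorff])
  have "F \<in> ?L" if "closed F" for F
  proof -
    have "hausdorff_outer s (X \<inter> F) + hausdorff_outer s (X - F) = hausdorff_outer s X" for X
    proof (rule antisym[OF hausdorff_outer_closed[OF that]])
      show "hausdorff_outer s X \<le> hausdorff_outer s (X \<inter> F) + hausdorff_outer s (X - F)"
        using hausdorff_outer_Un[of s "X \<inter> F" "X - F"] by (simp add: Int_Diff_Un)
    qed
    then show ?thesis
      unfolding P.lambda_system_eq by simp
  qed
  then have "Collect closed \<subseteq> ?L" by auto
  then have "sigma_sets UNIV (Collect closed) \<subseteq> ?L"
    using ms by (intro sigma_algebra.sigma_sets_subset) (auto simp: measure_space_def)
  then have sub: "sets borel \<subseteq> ?L"
    by (simp add: borel_eq_closed)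
  have "sigma_algebra UNIV (sets (borel :: 'a measure))"
    using sets.sigma_algebra_axioms[of "borel :: 'a measure"] by simp
  with ms sub show ?thesis
    by (auto simp: measure_space_def positive_def countably_additive_def)
qed

lemma sets_hausdorff_measure [simp, measurable_cong]: "sets (hausdorff_measure s) = sets borel"
  unfolding hausdorff_measure_def by (metis sets.sigma_sets_eq sets_measure_of space_borel subset_UNIV Pow_UNIV)

lemma space_hausdorff_measure [simp]: "space (hausdorff_measure s) = UNIV"
  unfolding hausdorff_measure_def by (simp add: space_measure_of_conv)

lemma emeasure_hausdorff_measure:
  "A \<in> sets borel \<Longrightarrow> emeasure (hausdorff_measure s) A = hausdorff_outer s A"
  using measure_space_hausdorff_outer[of s] unfolding hausdorff_measure_def
  by (intro emeasure_measure_of_sigma) (auto simp: measure_space_def)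

definition surface_measure :: "(real^'n) set \<Rightarrow> (real^'n) measure" where
  "surface_measure \<Omega> = restrict_space (hausdorff_measure (CARD('n) - 1)) (frontier \<Omega>)"


section \<open>Norms, admissible vector fields, solutions\<close>

definition L2_norm :: "'a measure \<Rightarrow> 'a set \<Rightarrow> ('a \<Rightarrow> 'b::real_normed_vector) \<Rightarrow> real" where
  "L2_norm M A f = sqrt (LINT x:A|M. (norm (f x))\<^sup>2)"

(* The squared norm in L^2(0,T; L^\<infinity>(\<Omega>)), possibly infinite. *)
definition L2_Linf_norm_sq ::
    "real \<Rightarrow> (real^'n) set \<Rightarrow> ((real^'n) \<times> real \<Rightarrow> 'b::real_normed_vector) \<Rightarrow> ennreal" where
  "L2_Linf_norm_sq T \<Omega> f =
     (\<integral>\<^sup>+t\<in>{0<..<T}. (esssup (lebesgue_on \<Omega>) (\<lambda>x. ennreal (norm (f (x, t)))))\<^sup>2 \<partial>lborel)"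

definition admissible ::
    "(real^'n) set \<Rightarrow> real^'n \<Rightarrow> real \<Rightarrow> real \<Rightarrow> (real^'n \<Rightarrow> real^'n) set" where
  "admissible \<Omega> x0 \<delta>0 M = {H. C1_closure \<Omega> H \<and> C1_norm \<Omega> H \<le> M \<and>
     H x0 \<bullet> outward_normal \<Omega> x0 > \<delta>0 \<and> (\<forall>x\<in>\<Omega>. norm (H x) > \<delta>0)}"

definition solution ::
    "(real^'n) set \<Rightarrow> real \<Rightarrow> (real^'n \<Rightarrow> real) \<Rightarrow> (real^'n \<Rightarrow> real^'n) \<Rightarrow> (real^'n \<Rightarrow> real) \<Rightarrow>
      ((real^'n) \<times> real \<Rightarrow> real) \<Rightarrow> bool" where
  "solution \<Omega> T p H a u \<longleftrightarrow> C1_closure (\<Omega> \<times> {0<..<T}) u \<and>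
     (\<forall>x\<in>\<Omega>. \<forall>t\<in>{0<..<T}. dt T u (x, t) + H x \<bullet> grad_x u (x, t) + p x * u (x, t) = 0) \<and>
     (\<forall>x\<in>\<Omega>. u (x, 0) = a x)"

end

theory Submission
  imports Defs
begin

text \<open>
  Let \<open>u1\<close> and \<open>u2\<close> be solutions for the fields \<open>H1\<close> and \<open>H2\<close> with the same initial value \<open>a\<close>, and put
  \<open>f = H2 - H1\<close> and \<open>z = \<partial>\<^sub>t u1 - \<partial>\<^sub>t u2\<close>. Differentiating the equations in time gives
  \<open>\<partial>\<^sub>t z + H1 \<bullet> \<nabla>z + p z = f \<bullet> \<partial>\<^sub>t \<nabla>u2\<close>, and reading them at time 0 gives \<open>z(., 0) = f \<bullet> \<nabla>a\<close>
  (\<open>solution_time_derivative_equation\<close>, \<open>solution_initial_time_derivative\<close>). The gradients of the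
  \<open>n\<close> initial values form a matrix that is invertible uniformly on the closed domain
  (\<open>exists_det_lower_bound\<close>), so \<open>f\<close> is controlled by the \<open>n\<close> functions \<open>z(., 0)\<close>. On the other hand
  \<open>f\<close> is also the source of the transport equation, multiplied by a function that is bounded in the
  mean square over time. It remains to bound \<open>z(., 0)\<close> near \<open>x0\<close> by the values of \<open>z\<close> on the lateral
  boundary and by a small multiple of the source.

  This is an energy estimate with the weight \<open>exp (\<sigma> (\<nu> \<bullet> (x - x0))) (max 0 \<psi>)\<^sup>2\<close>, where \<open>\<nu>\<close> is the
  outward normal at \<open>x0\<close> and \<open>\<psi>\<close> describes a small cap of the domain at \<open>x0\<close> that recedes towards the
  boundary and has left the domain by time \<open>T\<close>. An admissible field has normal component greater than
  \<open>\<delta>0\<close> at \<open>x0\<close> and a derivative bounded by \<open>M\<close>; hence there is one neighbourhood of \<open>x0\<close> in which all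
  admissible fields flow outward with a uniform speed, faster than the cap recedes. The weight therefore
  grows along every admissible field at a rate proportional to \<open>\<sigma>\<close> (\<open>weight_transport_ge\<close>), while it
  vanishes on the inner part of the boundary of the cap and at the final time. What remains in the energy
  balance is the initial energy, the outflow through the piece of the boundary in \<open>\<Gamma>\<close>, and the
  source, whose factor is as small as desired if \<open>\<sigma>\<close> is large (\<open>energy_estimate\<close>). A large \<open>M0\<close> only
  requires a larger \<open>\<sigma>\<close>; the cap, and the cone \<open>D\<close> with vertex \<open>x0\<close> on which the weight is bounded below
  at time 0, are chosen before. After absorption of the source (\<open>stability_on_cone\<close>) the estimate is linear
  in the norms of the boundary data, so the sum of the powers on the right-hand side may be added with
  any exponent.

  The boundary term is obtained without a divergence theorem on smooth domains. The energy balance is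
  localised by a cutoff that vanishes in a layer of width \<open>\<epsilon>\<close> at the boundary, so only functions with
  compact support are integrated by parts (\<open>transport_identity\<close>). The gradient of the cutoff produces
  \<open>1 / \<epsilon>\<close> times an integral over a thin strip, which is compared with an integral against the Hausdorff
  measure (\<open>nn_integral_strip_le\<close>, \<open>boundary_layer\<close>): covering a set by small pieces shows that a layer of
  thickness \<open>l\<close> over it has volume at most a constant times \<open>l\<close> times its surface measure
  (\<open>emeasure_tube_le_hausdorff\<close>). Conversely, a packing argument shows that the surface measure of the
  boundary is finite (\<open>hausdorff_outer_frontier_finite\<close>), so the norms over the boundary are integrals in
  the proper sense.
\<close>

section \<open>Hausdorff measure and the volume of thin layers\<close>

definition tube :: "'a::real_normed_vector set \<Rightarrow> 'a \<Rightarrow> real \<Rightarrow> 'a set" where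
  "tube A \<nu> l = (\<lambda>(y, s). y - s *\<^sub>R \<nu>) ` (A \<times> {0..l})"

text \<open>Cut the tube across its axis into about \<open>l / d\<close> pieces. Each piece lies in a ball of radius
  \<open>2 * d\<close>, so its volume is of order \<open>d ^ n\<close>.\<close>

lemma emeasure_tube_le_of_diameter_less:
  fixes E :: "'a::euclidean_space set"
  assumes "bounded E" "diameter E \<le> d" "0 < d" "norm \<nu> = 1" "0 \<le> l"
  shows "emeasure lborel (tube E \<nu> l) \<le>
    ennreal (unit_ball_vol (DIM('a)) * 2 ^ DIM('a) * (l * d ^ (DIM('a) - 1) + d ^ DIM('a)))"
proof (cases "E = {}")
  case True
  then show ?thesis by (simp add: tube_def)
next
  case False
  then obtain y0 where y0: "y0 \<in> E" by blast
  define n where "n = DIM('a)"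
  have n: "n > 0" by (simp add: n_def)
  define k where "k = nat \<lfloor>l / d\<rfloor>"
  have k: "real k \<le> l / d"
    unfolding k_def using assms by (simp add: of_nat_nat)
  have "tube E \<nu> l \<subseteq> (\<Union>j\<in>{..k}. cball (y0 - (real j * d) *\<^sub>R \<nu>) (2 * d))"
  proof
    fix x assume "x \<in> tube E \<nu> l"
    then obtain y s where ys: "y \<in> E" "0 \<le> s" "s \<le> l" "x = y - s *\<^sub>R \<nu>"
      by (auto simp: tube_def)
    define j where "j = nat \<lfloor>s / d\<rfloor>"
    have "real j \<le> s / d" "s / d < real j + 1"
      unfolding j_def using ys assms by (auto simp: of_nat_nat)
    then have j: "real j * d \<le> s" "s < real j * d + d"
      using \<open>0 < d\<close> by (auto simp: field_simps)
    have "j \<le> k"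
      unfolding j_def k_def using ys \<open>0 < d\<close> by (intro nat_mono floor_mono divide_right_mono) auto
    moreover have "dist (y0 - (real j * d) *\<^sub>R \<nu>) x \<le> 2 * d"
    proof -
      have "dist (y0 - (real j * d) *\<^sub>R \<nu>) x = norm ((y0 - y) + (s - real j * d) *\<^sub>R \<nu>)"
        by (simp add: dist_norm ys algebra_simps)
      also have "\<dots> \<le> norm (y0 - y) + \<bar>s - real j * d\<bar>"
        using norm_triangle_ineq[of "y0 - y" "(s - real j * d) *\<^sub>R \<nu>"] assms by simp
      also have "norm (y0 - y) \<le> d"
        using diameter_bounded_bound[OF \<open>bounded E\<close> y0 ys(1)] assms(2) by (simp add: dist_norm)
      finally show ?thesis using j by simp
    qed
    ultimately show "x \<in> (\<Union>j\<in>{..k}. cball (y0 - (real j * d) *\<^sub>R \<nu>) (2 * d))" by auto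
  qed
  then have "emeasure lborel (tube E \<nu> l) \<le> emeasure lborel (\<Union>j\<in>{..k}. cball (y0 - (real j * d) *\<^sub>R \<nu>) (2 * d))"
    by (intro emeasure_mono) auto
  also have "\<dots> \<le> (\<Sum>j\<in>{..k}. emeasure lborel (cball (y0 - (real j * d) *\<^sub>R \<nu>) (2 * d)))"
    by (intro emeasure_subadditive_finite) auto
  also have "\<dots> = of_nat (Suc k) * ennreal (unit_ball_vol n * (2 * d) ^ n)"
    using \<open>0 < d\<close> by (simp add: emeasure_cball n_def)
  also have "\<dots> = ennreal (real (Suc k) * (unit_ball_vol n * (2 * d) ^ n))"
    unfolding ennreal_of_nat_eq_real_of_nat using \<open>0 < d\<close> by (subst ennreal_mult) auto
  also have "\<dots> \<le> ennreal (unit_ball_vol n * 2 ^ n * (l * d ^ (n - 1) + d ^ n))"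
  proof (rule ennreal_leI)
    have dn: "d ^ n = d * d ^ (n - 1)"
      using n by (cases n) auto
    have "real (Suc k) * (unit_ball_vol n * (2 * d) ^ n) \<le> (l / d + 1) * (unit_ball_vol n * (2 * d) ^ n)"
      using k \<open>0 < d\<close> by (intro mult_right_mono) auto
    also have "\<dots> = unit_ball_vol n * 2 ^ n * (l * d ^ (n - 1) + d ^ n)"
      using \<open>0 < d\<close> by (simp add: power_mult_distrib dn field_simps)
    finally show "real (Suc k) * (unit_ball_vol n * (2 * d) ^ n) \<le> unit_ball_vol n * 2 ^ n * (l * d ^ (n - 1) + d ^ n)" .
  qed
  finally show ?thesis by (simp add: n_def)
qed

text \<open>The limit of the previous bound as \<open>d\<close> decreases to the diameter. Passing to the limit covers
  sets of diameter 0; in dimension one, where \<open>0 ^ 0 = 1\<close>, the bound for a point is then \<open>l\<close>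
  times a constant, as it must be for the counting measure.\<close>

lemma emeasure_tube_le_diameter:
  fixes E :: "'a::euclidean_space set"
  assumes "bounded E" "norm \<nu> = 1" "0 \<le> l"
  shows "emeasure lborel (tube E \<nu> l) \<le>
    ennreal (unit_ball_vol (DIM('a)) * 2 ^ DIM('a) *
      (l * diameter E ^ (DIM('a) - 1) + diameter E ^ DIM('a)))"
proof (rule tendsto_lowerbound)
  let ?f = "\<lambda>d. ennreal (unit_ball_vol (DIM('a)) * 2 ^ DIM('a) * (l * d ^ (DIM('a) - 1) + d ^ DIM('a)))"
  show "(?f \<longlongrightarrow> ?f (diameter E)) (at_right (diameter E))"
    by (intro tendsto_ennrealI tendsto_intros)
  have "emeasure lborel (tube E \<nu> l) \<le> ?f d" if "diameter E < d" for d
    using assms diameter_ge_0[OF assms(1)] that by (intro emeasure_tube_le_of_diameter_less) auto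
  then show "\<forall>\<^sub>F d in at_right (diameter E). emeasure lborel (tube E \<nu> l) \<le> ?f d"
    using eventually_at_right_less[of "diameter E"] by (rule eventually_mono[rotated])
qed simp

lemma tube_UN_subset: "A \<subseteq> (\<Union>i. E i) \<Longrightarrow> tube A \<nu> l \<subseteq> (\<Union>i. tube (E i) \<nu> l)"
  unfolding tube_def by fastforce

lemma compact_tube: "compact A \<Longrightarrow> compact (tube A \<nu> l)"
  unfolding tube_def by (intro compact_continuous_image compact_Times) (auto simp: split_beta intro!: continuous_intros)

text \<open>The factor that turns \<open>2 ^ n * \<omega>\<^sub>n * diameter ^ (n - 1)\<close> into a multiple of the gauge
  \<open>\<omega>\<^sub>n\<^sub>-\<^sub>1 * (diameter / 2) ^ (n - 1)\<close> of the Hausdorff measure.\<close>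

definition tube_const :: "nat \<Rightarrow> real" where
  "tube_const n = unit_ball_vol n * 2 ^ n * 2 ^ (n - 1) / unit_ball_vol (n - 1)"

lemma tube_const_pos: "tube_const n > 0"
  by (auto simp: tube_const_def)

lemma emeasure_tube_le_gauge:
  fixes E :: "'a::euclidean_space set"
  assumes "bounded E" "norm \<nu> = 1" "0 \<le> l" "diameter E \<le> \<delta>"
  shows "emeasure lborel (tube E \<nu> l) \<le>
    ennreal (tube_const (DIM('a)) * (l + \<delta>)) * hausdorff_gauge (DIM('a) - 1) E"
proof (cases "E = {}")
  case True
  then show ?thesis by (simp add: tube_def)
next
  case False
  define n where "n = DIM('a)"
  define D where "D = diameter E"
  have D: "0 \<le> D" "D \<le> \<delta>" using diameter_ge_0 assms D_def by auto
  have dn: "D ^ n = D * D ^ (n - 1)"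
    using DIM_positive[where 'a='a] by (cases n) (auto simp: n_def)
  have "emeasure lborel (tube E \<nu> l) \<le> ennreal (unit_ball_vol n * 2 ^ n * (l * D ^ (n - 1) + D ^ n))"
    using emeasure_tube_le_diameter[OF assms(1-3)] by (simp add: n_def D_def)
  also have "\<dots> \<le> ennreal ((tube_const n * (l + \<delta>)) * (unit_ball_vol (real (n - 1)) * (D / 2) ^ (n - 1)))"
  proof (rule ennreal_leI)
    have "l * D ^ (n - 1) + D ^ n \<le> (l + \<delta>) * D ^ (n - 1)"
      using D by (auto simp: dn distrib_right intro!: mult_right_mono)
    then have "unit_ball_vol n * 2 ^ n * (l * D ^ (n - 1) + D ^ n) \<le> unit_ball_vol n * 2 ^ n * ((l + \<delta>) * D ^ (n - 1))"
      by (intro mult_left_mono) auto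
    also have "\<dots> = (tube_const n * (l + \<delta>)) * (unit_ball_vol (real (n - 1)) * (D / 2) ^ (n - 1))"
      using unit_ball_vol_pos[of "real (n - 1)"]
      by (simp add: tube_const_def power_divide field_simps del: unit_ball_vol_pos)
    finally show "unit_ball_vol n * 2 ^ n * (l * D ^ (n - 1) + D ^ n) \<le> (tube_const n * (l + \<delta>)) * (unit_ball_vol (real (n - 1)) * (D / 2) ^ (n - 1))" .
  qed
  also have "\<dots> = ennreal (tube_const n * (l + \<delta>)) * ennreal (unit_ball_vol (real (n - 1)) * (D / 2) ^ (n - 1))"
    using D assms(3) tube_const_pos[of n] by (intro ennreal_mult) auto
  finally show ?thesis using False by (simp add: n_def D_def hausdorff_gauge_def)
qed

lemma hausdorff_gauge_closure:
  "bounded E \<Longrightarrow> hausdorff_gauge s (closure E) = hausdorff_gauge s E"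
  by (simp add: hausdorff_gauge_def diameter_closure)

text \<open>A cover of \<open>A\<close> gives a cover of the tube over \<open>A\<close> by tubes. The cover sets are replaced by their
  closures, which have the same diameters, because tubes over compact sets are compact and therefore
  measurable.\<close>

lemma emeasure_tube_le_hausdorff_pre:
  fixes A :: "'a::euclidean_space set"
  assumes "norm \<nu> = 1" "0 < l" "0 < \<delta>" "B \<subseteq> tube A \<nu> l"
  shows "emeasure lborel B \<le>
    ennreal (tube_const (DIM('a)) * (l + \<delta>)) * hausdorff_pre (DIM('a) - 1) \<delta> A"
proof -
  define K where "K = ennreal (tube_const (DIM('a)) * (l + \<delta>))"
  have K: "0 < K" "K < top"
    using assms tube_const_pos[of "DIM('a)"] by (auto simp: K_def)
  have "emeasure lborel B / K \<le> hausdorff_pre (DIM('a) - 1) \<delta> A"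
    unfolding hausdorff_pre_def
  proof (rule INF_greatest)
    fix E :: "nat \<Rightarrow> 'a set"
    assume "E \<in> {E. A \<subseteq> (\<Union>i. E i) \<and> (\<forall>i. bounded (E i) \<and> diameter (E i) \<le> \<delta>)}"
    then have E: "A \<subseteq> (\<Union>i. E i)" "\<And>i. bounded (E i)" "\<And>i. diameter (E i) \<le> \<delta>" by auto
    have comp: "compact (closure (E i))" for i
      using E(2) by (simp add: compact_closure)
    have "B \<subseteq> (\<Union>i. tube (closure (E i)) \<nu> l)"
    proof -
      have "A \<subseteq> (\<Union>i. closure (E i))"
        by (rule order_trans[OF E(1)]) (intro UN_mono closure_subset order_refl)
      then show ?thesis
        by (intro order_trans[OF assms(4) tube_UN_subset])
    qed
    then have "emeasure lborel B \<le> emeasure lborel (\<Union>i. tube (closure (E i)) \<nu> l)"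
      using borel_compact[OF compact_tube[OF comp]] by (intro emeasure_mono) auto
    also have "\<dots> \<le> (\<Sum>i. emeasure lborel (tube (closure (E i)) \<nu> l))"
      using borel_compact[OF compact_tube[OF comp]] by (intro emeasure_subadditive_countably) auto
    also have "\<dots> \<le> (\<Sum>i. K * hausdorff_gauge (DIM('a) - 1) (E i))"
    proof (intro suminf_le allI)
      fix i
      show "emeasure lborel (tube (closure (E i)) \<nu> l) \<le> K * hausdorff_gauge (DIM('a) - 1) (E i)"
        using emeasure_tube_le_gauge[of "closure (E i)" \<nu> l \<delta>] E assms bounded_closure[OF E(2)]
        by (simp add: K_def hausdorff_gauge_closure diameter_closure)
    qed auto
    also have "\<dots> = K * (\<Sum>i. hausdorff_gauge (DIM('a) - 1) (E i))" by simp
    finally show "emeasure lborel B / K \<le> (\<Sum>i. hausdorff_gauge (DIM('a) - 1) (E i))"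
      using K by (intro divide_le_posI_ennreal) auto
  qed
  then have "K * (emeasure lborel B / K) \<le> K * hausdorff_pre (DIM('a) - 1) \<delta> A"
    by (rule mult_left_mono) simp
  then show ?thesis
    using K by (simp add: ennreal_times_divide mult_divide_eq_ennreal mult.commute[of K] K_def[symmetric])
qed

text \<open>This is how volume integrals over thin layers are compared with integrals over the boundary: a layer
  of thickness \<open>l\<close> above \<open>A\<close> has volume at most a constant times \<open>l\<close> times the surface measure of
  \<open>A\<close>. Only this inequality between the two measures is used; no area formula is involved.\<close>

lemma emeasure_tube_le_hausdorff:
  fixes A :: "'a::euclidean_space set"
  assumes "norm \<nu> = 1" "0 < l" "B \<subseteq> tube A \<nu> l"
  shows "emeasure lborel B \<le>
    ennreal (tube_const (DIM('a)) * l) * hausdorff_outer (DIM('a) - 1) A"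
proof (cases "hausdorff_outer (DIM('a) - 1) A = top")
  case True
  then show ?thesis
    using assms tube_const_pos[of "DIM('a)"] by (auto simp: ennreal_mult_top)
next
  case False
  then obtain h where h: "0 \<le> h" "hausdorff_outer (DIM('a) - 1) A = ennreal h"
    by (cases "hausdorff_outer (DIM('a) - 1) A") auto
  let ?f = "\<lambda>\<delta>. ennreal (tube_const (DIM('a)) * (l + \<delta>) * h)"
  have "emeasure lborel B \<le> ?f 0"
  proof (rule tendsto_lowerbound)
    show "(?f \<longlongrightarrow> ?f 0) (at_right 0)"
      by (intro tendsto_ennrealI tendsto_intros)
    have "emeasure lborel B \<le> ?f \<delta>" if "0 < \<delta>" for \<delta>
    proof -
      have "emeasure lborel B \<le> ennreal (tube_const (DIM('a)) * (l + \<delta>)) * hausdorff_pre (DIM('a) - 1) \<delta> A"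
        using emeasure_tube_le_hausdorff_pre[OF assms(1,2) that assms(3)] .
      also have "hausdorff_pre (DIM('a) - 1) \<delta> A \<le> hausdorff_outer (DIM('a) - 1) A"
        unfolding hausdorff_outer_def using that by (intro SUP_upper) auto
      finally show ?thesis
        using that assms tube_const_pos[of "DIM('a)"] h by (simp add: mult_left_mono ennreal_mult)
    qed
    then show "\<forall>\<^sub>F \<delta> in at_right 0. emeasure lborel B \<le> ?f \<delta>"
      using eventually_at_right_less[of "0::real"] by (rule eventually_mono[rotated])
  qed simp
  then show ?thesis
    using h assms tube_const_pos[of "DIM('a)"] by (simp add: ennreal_mult)
qed


lemma norm_flat_shift_ge:
  fixes p \<nu> :: "'a::real_inner"
  assumes "\<bar>\<nu> \<bullet> p\<bar> \<le> norm p / 2" "norm \<nu> = 1"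
  shows "3 / 4 * (norm p)\<^sup>2 \<le> (norm (p + s *\<^sub>R \<nu>))\<^sup>2"
proof -
  have "(norm (p + s *\<^sub>R \<nu>))\<^sup>2 = (norm p)\<^sup>2 + 2 * s * (\<nu> \<bullet> p) + s\<^sup>2 * (norm \<nu>)\<^sup>2"
    unfolding power2_norm_eq_inner
    by (simp add: inner_add_left inner_add_right inner_commute power2_eq_square algebra_simps)
  moreover have "\<bar>2 * s * (\<nu> \<bullet> p)\<bar> \<le> \<bar>s\<bar> * norm p"
    using mult_left_mono[OF assms(1), of "2 * \<bar>s\<bar>"] by (simp add: abs_mult)
  moreover have "0 \<le> (\<bar>s\<bar> - norm p / 2)\<^sup>2" by simp
  then have "\<bar>s\<bar> * norm p \<le> s\<^sup>2 + (norm p)\<^sup>2 / 4"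
    by (simp add: power2_eq_square algebra_simps)
  ultimately show ?thesis
    using \<open>norm \<nu> = 1\<close> by auto
qed

text \<open>A packing argument. If \<open>P\<close> is \<open>\<delta>\<close>-separated with differences nearly orthogonal to \<open>\<nu>\<close>, the translates
  of \<open>P\<close> by multiples of \<open>\<delta> *\<^sub>R \<nu>\<close> up to length one are still separated on the scale \<open>\<delta>\<close>. There are
  about \<open>card P / \<delta>\<close> of them, and the disjoint balls around them fill a bounded set, so \<open>card P\<close> is at
  most of order \<open>\<delta> ^ (1 - n)\<close>. This bounds the surface measure of a graph without parametrising it.\<close>

lemma card_separated_le:
  fixes P :: "'a::euclidean_space set"
  assumes flat: "\<And>x y. x \<in> P \<Longrightarrow> y \<in> P \<Longrightarrow> \<bar>\<nu> \<bullet> (x - y)\<bar> \<le> norm (x - y) / 2"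
    and "norm \<nu> = 1" "P \<subseteq> cball c R" "0 \<le> R" "finite P" "0 < \<delta>" "\<delta> \<le> 1"
    and sep: "\<And>x y. x \<in> P \<Longrightarrow> y \<in> P \<Longrightarrow> x \<noteq> y \<Longrightarrow> \<delta> \<le> dist x y"
  shows "real (card P) * \<delta> ^ (DIM('a) - 1) \<le> (4 * (R + 2)) ^ DIM('a)"
proof -
  define n where "n = DIM('a)"
  have n: "n > 0" by (simp add: n_def)
  define m where "m = nat \<lceil>1 / \<delta>\<rceil>"
  have m: "1 / \<delta> \<le> real m" "real m < 1 / \<delta> + 1"
    unfolding m_def using \<open>0 < \<delta>\<close> by (simp_all add: of_nat_nat real_nat_ceiling_ge) linarith+
  define ctr where "ctr = (\<lambda>(y, j). y + (real j * \<delta>) *\<^sub>R \<nu>)"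
  define I where "I = P \<times> {..<m}"
  (* Pythagoras up to the defect allowed by flatness, for different base points; translates of the
     same point are at distance at least delta by construction. *)
  have far: "\<delta> / 2 < dist (ctr a) (ctr b)" if "a \<in> I" "b \<in> I" "a \<noteq> b" for a b
  proof -
    obtain y j where a: "a = (y, j)" by force
    obtain z l where b: "b = (z, l)" by force
    define s where "s = (real j - real l) * \<delta>"
    have d: "dist (ctr a) (ctr b) = norm ((y - z) + s *\<^sub>R \<nu>)"
      by (simp add: ctr_def a b dist_norm s_def algebra_simps)
    show ?thesis
    proof (cases "y = z")
      case True
      then have "j \<noteq> l" using that a b by auto
      then have "1 \<le> \<bar>real j - real l\<bar>" by linarith
      then have "1 * \<delta> \<le> \<bar>real j - real l\<bar> * \<delta>" using \<open>0 < \<delta>\<close> by (intro mult_right_mono) auto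
      then have "\<delta> \<le> \<bar>s\<bar>"
        using \<open>0 < \<delta>\<close> by (simp add: s_def abs_mult)
      then show ?thesis
        using d True \<open>norm \<nu> = 1\<close> \<open>0 < \<delta>\<close> by simp
    next
      case False
      define p where "p = y - z"
      have yz: "y \<in> P" "z \<in> P" using that a b by (auto simp: I_def)
      have p: "\<delta> \<le> norm p" "\<bar>\<nu> \<bullet> p\<bar> \<le> norm p / 2"
        using sep[OF yz False] flat[OF yz] by (auto simp: p_def dist_norm)
      have "3 / 4 * (norm p)\<^sup>2 \<le> (norm (p + s *\<^sub>R \<nu>))\<^sup>2"
        using p(2) \<open>norm \<nu> = 1\<close> by (rule norm_flat_shift_ge)
      moreover have "\<delta>\<^sup>2 \<le> (norm p)\<^sup>2" using p \<open>0 < \<delta>\<close> by (intro power_mono) auto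
      moreover have "0 < \<delta>\<^sup>2" using \<open>0 < \<delta>\<close> by simp
      moreover have "(\<delta> / 2)\<^sup>2 = \<delta>\<^sup>2 / 4"
        by (simp add: power_divide)
      ultimately have "(\<delta> / 2)\<^sup>2 < (norm (p + s *\<^sub>R \<nu>))\<^sup>2"
        by linarith
      then show ?thesis
        unfolding d p_def[symmetric] by (rule power_less_imp_less_base) simp
    qed
  qed
  have disj: "disjoint_family_on (\<lambda>a. ball (ctr a) (\<delta> / 4)) I"
    unfolding disjoint_family_on_def
  proof (intro ballI impI)
    fix a b assume ab: "a \<in> I" "b \<in> I" "a \<noteq> b"
    show "ball (ctr a) (\<delta> / 4) \<inter> ball (ctr b) (\<delta> / 4) = {}"
    proof (rule ccontr)
      assume "ball (ctr a) (\<delta> / 4) \<inter> ball (ctr b) (\<delta> / 4) \<noteq> {}"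
      then obtain x where "dist (ctr a) x < \<delta> / 4" "dist (ctr b) x < \<delta> / 4" by auto
      then show False
        using far[OF ab] dist_triangle2[of "ctr a" "ctr b" x] by simp
    qed
  qed
  have inside: "ball (ctr a) (\<delta> / 4) \<subseteq> cball c (R + 2)" if "a \<in> I" for a
  proof
    fix x assume x: "x \<in> ball (ctr a) (\<delta> / 4)"
    obtain y j where a: "a = (y, j)" by force
    have "y \<in> P" "j < m" using that a by (auto simp: I_def)
    then have "real j + 1 \<le> real m" by linarith
    then have "real j * \<delta> \<le> 1"
    proof -
      have "real j \<le> 1 / \<delta>" using m(2) \<open>real j + 1 \<le> real m\<close> by linarith
      then show ?thesis using \<open>0 < \<delta>\<close> by (simp add: pos_le_divide_eq)
    qed
    have "dist c y \<le> R" using \<open>y \<in> P\<close> assms(3) by auto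
    moreover have "dist y (ctr a) \<le> 1"
      using \<open>real j * \<delta> \<le> 1\<close> \<open>0 < \<delta>\<close> \<open>norm \<nu> = 1\<close> by (simp add: ctr_def a dist_norm)
    ultimately show "x \<in> cball c (R + 2)"
      using x \<open>\<delta> \<le> 1\<close> dist_triangle[of c x y] dist_triangle[of y x "ctr a"] by simp
  qed
  have finI: "finite I" using \<open>finite P\<close> by (simp add: I_def)
  have "of_nat (card I) * ennreal (unit_ball_vol n * (\<delta> / 4) ^ n) =
      (\<Sum>a\<in>I. emeasure lborel (ball (ctr a) (\<delta> / 4)))"
    using \<open>0 < \<delta>\<close> by (simp add: emeasure_ball n_def)
  also have "\<dots> = emeasure lborel (\<Union>a\<in>I. ball (ctr a) (\<delta> / 4))"
    using finI disj by (intro sum_emeasure) auto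
  also have "\<dots> \<le> emeasure lborel (cball c (R + 2))"
    using inside by (intro emeasure_mono) auto
  also have "\<dots> = ennreal (unit_ball_vol n * (R + 2) ^ n)"
    using \<open>0 \<le> R\<close> by (simp add: emeasure_cball n_def)
  finally have "ennreal (real (card I) * (unit_ball_vol n * (\<delta> / 4) ^ n)) \<le> ennreal (unit_ball_vol n * (R + 2) ^ n)"
    unfolding ennreal_of_nat_eq_real_of_nat using \<open>0 < \<delta>\<close> by (subst ennreal_mult) auto
  then have "real (card I) * (unit_ball_vol n * (\<delta> / 4) ^ n) \<le> unit_ball_vol n * (R + 2) ^ n"
    using \<open>0 \<le> R\<close> by (subst (asm) ennreal_le_iff) auto
  then have "unit_ball_vol n * (real (card I) * (\<delta> / 4) ^ n) \<le> unit_ball_vol n * (R + 2) ^ n"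
    by (simp add: ac_simps)
  then have 1: "real (card I) * (\<delta> / 4) ^ n \<le> (R + 2) ^ n"
    by (subst (asm) mult_le_cancel_left_pos) auto
  have dn: "\<delta> ^ n = \<delta> * \<delta> ^ (n - 1)"
    using n by (cases n) auto
  have "real (card P) * \<delta> ^ (n - 1) = real (card P) * (1 / \<delta>) * \<delta> ^ n"
    using \<open>0 < \<delta>\<close> by (simp add: dn)
  also have "\<dots> \<le> real (card P) * real m * \<delta> ^ n"
    using m(1) \<open>0 < \<delta>\<close> by (intro mult_right_mono mult_left_mono) auto
  also have "\<dots> = real (card I) * (\<delta> / 4) ^ n * 4 ^ n"
    by (simp add: I_def card_cartesian_product power_divide)
  also have "\<dots> \<le> (R + 2) ^ n * 4 ^ n"
    using 1 by (intro mult_right_mono) auto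
  also have "(R + 2) ^ n * 4 ^ n = (4 * (R + 2)) ^ n"
    by (simp only: power_mult_distrib mult.commute)
  finally show ?thesis
    by (simp only: n_def)
qed

text \<open>A \<open>\<delta>\<close>-separated subset of maximal cardinality is a \<open>\<delta>\<close>-net, and the packing bound makes the
  sum of the gauges of the balls of radius \<open>\<delta>\<close> around it bounded independently of \<open>\<delta>\<close>.\<close>

lemma hausdorff_outer_flat_finite:
  fixes A :: "'a::euclidean_space set"
  assumes flat: "\<And>x y. x \<in> A \<Longrightarrow> y \<in> A \<Longrightarrow> \<bar>\<nu> \<bullet> (x - y)\<bar> \<le> norm (x - y) / 2"
    and "norm \<nu> = 1" "A \<subseteq> cball c R"
  shows "hausdorff_outer (DIM('a) - 1) A < top"
proof (cases "A = {}")
  case True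
  then show ?thesis by (simp add: hausdorff_outer_empty)
next
  case False
  then have R: "0 \<le> R" using assms(3) by (metis cball_eq_empty not_le subset_empty)
  define n where "n = DIM('a)"
  define V where "V = unit_ball_vol (real (n - 1)) * (4 * (R + 2)) ^ n"
  have "hausdorff_pre (n - 1) d A \<le> ennreal V" if "0 < d" for d
  proof -
    define \<delta> where "\<delta> = min 1 (d / 2)"
    have \<delta>: "0 < \<delta>" "\<delta> \<le> 1" "2 * \<delta> \<le> d" using that by (auto simp: \<delta>_def)
    define good where "good P \<longleftrightarrow> finite P \<and> P \<subseteq> A \<and> (\<forall>x\<in>P. \<forall>y\<in>P. x \<noteq> y \<longrightarrow> \<delta> \<le> dist x y)" for P
    have bnd: "real (card P) * \<delta> ^ (n - 1) \<le> (4 * (R + 2)) ^ n" if "good P" for P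
      unfolding n_def using that assms R \<delta>
      by (intro card_separated_le[where \<nu> = \<nu> and c = c]) (auto simp: good_def)
    have "card P < Suc (nat \<lceil>(4 * (R + 2)) ^ n / \<delta> ^ (n - 1)\<rceil>)" if "good P" for P
    proof -
      have "real (card P) \<le> (4 * (R + 2)) ^ n / \<delta> ^ (n - 1)"
        using bnd[OF that] \<delta> by (simp add: pos_le_divide_eq)
      also have "\<dots> \<le> real (nat \<lceil>(4 * (R + 2)) ^ n / \<delta> ^ (n - 1)\<rceil>)"
        by (rule real_nat_ceiling_ge)
      finally show ?thesis by linarith
    qed
    moreover have "good {}" by (simp add: good_def)
    ultimately obtain P where P: "good P" "\<And>Q. good Q \<Longrightarrow> card Q \<le> card P"
      using ex_has_greatest_nat[of good "{}" card] by blast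
    have cov: "\<exists>y\<in>P. x \<in> cball y \<delta>" if "x \<in> A" for x
    proof (rule ccontr)
      assume *: "\<not> ?thesis"
      then have "x \<notin> P" using \<delta> by auto
      moreover have "good (insert x P)"
        using * that P(1) by (force simp: good_def dist_commute)
      ultimately show False
        using P(2)[of "insert x P"] P(1) by (auto simp: good_def)
    qed
    obtain f where f: "bij_betw f {..<card P} P"
      using P(1) by (metis good_def bij_betw_from_nat_into_finite)
    define E where "E i = (if i < card P then cball (f i) \<delta> else {})" for i
    have "hausdorff_pre (n - 1) d A \<le> (\<Sum>i. hausdorff_gauge (n - 1) (E i))"
    proof (rule hausdorff_pre_le)
      show "A \<subseteq> (\<Union>i. E i)"
      proof
        fix x assume "x \<in> A"
        then obtain y where "y \<in> P" "x \<in> cball y \<delta>" using cov by blast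
        moreover then obtain i where "i < card P" "f i = y"
          using f by (metis bij_betw_iff_bijections lessThan_iff)
        ultimately show "x \<in> (\<Union>i. E i)" by (auto simp: E_def intro!: exI[of _ i])
      qed
      show "diameter (E i) \<le> d" for i
        using \<delta> by (auto simp: E_def)
    qed (auto simp: E_def)
    also have "\<dots> = (\<Sum>i<card P. hausdorff_gauge (n - 1) (E i))"
      by (rule suminf_finite) (auto simp: E_def)
    also have "\<dots> = (\<Sum>i<card P. ennreal (unit_ball_vol (real (n - 1)) * \<delta> ^ (n - 1)))"
      using \<delta> by (intro sum.cong) (auto simp: E_def hausdorff_gauge_def)
    also have "\<dots> = ennreal (real (card P) * (unit_ball_vol (real (n - 1)) * \<delta> ^ (n - 1)))"
      using \<delta> by (simp add: ennreal_of_nat_eq_real_of_nat ennreal_mult)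
    also have "\<dots> \<le> ennreal V"
      using mult_left_mono[OF bnd[OF P(1)], of "unit_ball_vol (real (n - 1))"]
      by (intro ennreal_leI) (simp add: V_def ac_simps)
    finally show ?thesis .
  qed
  then have "hausdorff_outer (n - 1) A \<le> ennreal V"
    unfolding hausdorff_outer_def by (intro SUP_least) auto
  then show ?thesis
    unfolding n_def using ennreal_less_top le_less_trans by blast
qed

lemma hausdorff_outer_finite_of_locally_finite:
  fixes K :: "'a::metric_space set"
  assumes "compact K" and loc: "\<And>x. x \<in> K \<Longrightarrow> \<exists>r>0. hausdorff_outer s (K \<inter> ball x r) < top"
  shows "hausdorff_outer s K < top"
proof -
  obtain r where r: "\<And>x. x \<in> K \<Longrightarrow> 0 < r x \<and> hausdorff_outer s (K \<inter> ball x (r x)) < top"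
    using loc by metis
  obtain F where F: "F \<subseteq> K" "finite F" "K \<subseteq> (\<Union>x\<in>F. ball x (r x))"
  proof (rule compactE_image[OF assms(1), of K "\<lambda>x. ball x (r x)"])
    show "K \<subseteq> (\<Union>x\<in>K. ball x (r x))" using r by force
  qed auto
  have "hausdorff_outer s (\<Union>x\<in>G. K \<inter> ball x (r x)) < top" if "finite G" "G \<subseteq> K" for G
    using that
  proof (induction G)
    case empty
    then show ?case by (simp add: hausdorff_outer_empty)
  next
    case (insert x G)
    have "hausdorff_outer s (\<Union>x\<in>insert x G. K \<inter> ball x (r x)) \<le>
        hausdorff_outer s (K \<inter> ball x (r x)) + hausdorff_outer s (\<Union>x\<in>G. K \<inter> ball x (r x))"
      unfolding UN_insert by (rule hausdorff_outer_Un)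
    also have "\<dots> < top" using insert r by (simp add: less_top[symmetric])
    finally show ?case .
  qed
  then have "hausdorff_outer s (\<Union>x\<in>F. K \<inter> ball x (r x)) < top" using F by blast
  moreover have "hausdorff_outer s K \<le> hausdorff_outer s (\<Union>x\<in>F. K \<inter> ball x (r x))"
    by (rule hausdorff_outer_mono) (use F(3) in blast)
  ultimately show ?thesis by (rule le_less_trans[rotated])
qed

section \<open>Charts of the boundary in which it is almost flat\<close>

lemma linear_eq_inner_axis:
  fixes f :: "real^'n \<Rightarrow> real"
  assumes "linear f"
  shows "f h = (\<chi> i. f (axis i 1)) \<bullet> h"
proof -
  interpret linear f by fact
  have "f h = f (\<Sum>i\<in>UNIV. (h $ i) *\<^sub>R axis i 1)"
    using basis_expansion[of h] by (simp add: scalar_mult_eq_scaleR)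
  also have "\<dots> = (\<Sum>i\<in>UNIV. (h $ i) * f (axis i 1))"
    by (simp add: sum scaleR)
  also have "\<dots> = (\<chi> i. f (axis i 1)) \<bullet> h"
    by (simp add: inner_vec_def mult.commute)
  finally show ?thesis .
qed

lemma has_derivative_grad:
  fixes f :: "real^'n \<Rightarrow> real"
  assumes "(f has_derivative f') (at x)"
  shows "(f has_derivative (\<lambda>h. grad f x \<bullet> h)) (at x)"
proof -
  have "f' h = grad f x \<bullet> h" for h
    using linear_eq_inner_axis[OF has_derivative_linear[OF assms], of h] frechet_derivative_at[OF assms]
    by (simp add: grad_def)
  then have "f' = (\<lambda>h. grad f x \<bullet> h)" by (rule ext)
  then show ?thesis using assms by simp
qed

lemma grad_eqI:
  fixes f :: "real^'n \<Rightarrow> real"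
  assumes "(f has_derivative (\<lambda>h. v \<bullet> h)) (at x)"
  shows "grad f x = v"
  using frechet_derivative_at[OF assms, symmetric] by (simp add: grad_def vec_eq_iff inner_axis)

lemma local_defining_function_deriv:
  assumes "local_defining_function \<Omega> U \<rho>"
  shows "x \<in> U \<Longrightarrow> (\<rho> has_derivative (\<lambda>h. grad \<rho> x \<bullet> h)) (at x)"
    and "continuous_on U (grad \<rho>)"
proof -
  have "Ck_on (Suc 0) U \<rho>"
    using assms by (auto simp: local_defining_function_def smooth_on_def simp del: Ck_on.simps)
  then obtain f' where f': "\<And>x. x \<in> U \<Longrightarrow> (\<rho> has_derivative f' x) (at x)"
    "\<And>v. continuous_on U (\<lambda>x. f' x v)" by auto
  show "x \<in> U \<Longrightarrow> (\<rho> has_derivative (\<lambda>h. grad \<rho> x \<bullet> h)) (at x)"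
    using has_derivative_grad f'(1) by blast
  have "continuous_on U (\<lambda>x. \<chi> i. f' x (axis i 1))"
    by (intro continuous_on_vec_lambda f'(2))
  then show "continuous_on U (grad \<rho>)"
  proof (rule continuous_on_eq)
    fix x assume "x \<in> U"
    show "(\<chi> i. f' x (axis i 1)) = grad \<rho> x"
      using frechet_derivative_at[OF f'(1)[OF \<open>x \<in> U\<close>], symmetric] by (simp add: grad_def)
  qed
qed

text \<open>A boundary point is a limit of points where \<open>\<rho>\<close> is negative, but does not itself belong to the
  open set \<open>\<Omega>\<close>.\<close>

lemma frontier_sublevel_zero:
  fixes \<rho> :: "'a::euclidean_space \<Rightarrow> real"
  assumes "open \<Omega>" "open U" "continuous_on U \<rho>" "\<Omega> \<inter> U = {y\<in>U. \<rho> y < 0}"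
    and "x \<in> frontier \<Omega>" "x \<in> U"
  shows "\<rho> x = 0"
proof (rule antisym)
  have "x \<notin> \<Omega>" using assms by (simp add: frontier_def interior_open)
  then show "0 \<le> \<rho> x" using assms(4,6) by fastforce
  show "\<rho> x \<le> 0"
  proof (rule ccontr)
    assume "\<not> \<rho> x \<le> 0"
    then have "x \<in> U \<inter> \<rho> -` {0<..}" using assms by auto
    moreover have "open (U \<inter> \<rho> -` {0<..})"
      using assms(2,3) by (intro continuous_open_preimage) auto
    moreover have "x \<in> closure \<Omega>" using assms(5) by (simp add: frontier_def)
    ultimately obtain y where "y \<in> \<Omega>" "y \<in> U" "0 < \<rho> y"
      using open_Int_closure_eq_empty[of "U \<inter> \<rho> -` {0<..}" \<Omega>] by auto
    then show False using assms(4) by (auto simp: set_eq_iff dest!: spec[of _ y])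
  qed
qed

lemma local_defining_function_zero:
  assumes "local_defining_function \<Omega> U \<rho>" "open \<Omega>" "x \<in> frontier \<Omega>" "x \<in> U"
  shows "\<rho> x = 0"
proof (rule frontier_sublevel_zero[OF assms(2) _ _ _ assms(3,4)])
  show "continuous_on U \<rho>"
    using local_defining_function_deriv(1)[OF assms(1)]
    by (meson differentiableI differentiable_imp_continuous_on differentiable_on_def has_derivative_at_withinI)
qed (use assms(1) in \<open>auto simp: local_defining_function_def\<close>)

text \<open>Were the normalised gradients at a common zero different, one could leave the zero in a
  direction along which one function decreases and the other increases.\<close>

lemma local_defining_function_sgn_unique:
  assumes "local_defining_function \<Omega> U1 \<rho>1" "local_defining_function \<Omega> U2 \<rho>2"
    and "open \<Omega>" "x \<in> frontier \<Omega>" "x \<in> U1" "x \<in> U2"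
  shows "sgn (grad \<rho>1 x) = sgn (grad \<rho>2 x)"
proof (rule ccontr)
  assume ne: "sgn (grad \<rho>1 x) \<noteq> sgn (grad \<rho>2 x)"
  define g1 where "g1 = grad \<rho>1 x"
  define g2 where "g2 = grad \<rho>2 x"
  have nz: "g1 \<noteq> 0" "g2 \<noteq> 0"
    using assms by (auto simp: g1_def g2_def local_defining_function_def)
  define c where "c = sgn g1 \<bullet> sgn g2"
  have unit: "norm (sgn g1) = 1" "norm (sgn g2) = 1" using nz by (simp_all add: norm_sgn)
  have "(norm (sgn g1 - sgn g2))\<^sup>2 = 2 - 2 * c"
    unfolding c_def power2_norm_eq_inner using unit
    by (simp add: inner_diff_left inner_diff_right inner_commute norm_eq_1)
  moreover have "0 < (norm (sgn g1 - sgn g2))\<^sup>2" using ne by (simp add: g1_def g2_def)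
  ultimately have c: "c < 1" by linarith
  define d where "d = sgn g2 - sgn g1"
  have "sgn g1 \<bullet> d = c - 1" "sgn g2 \<bullet> d = 1 - c"
    unfolding d_def c_def inner_diff_right using unit by (simp_all add: norm_eq_1 inner_commute)
  moreover have "g1 \<bullet> d = norm g1 * (sgn g1 \<bullet> d)" "g2 \<bullet> d = norm g2 * (sgn g2 \<bullet> d)"
    using nz by (simp_all add: sgn_div_norm)
  ultimately have "g1 \<bullet> d = norm g1 * (c - 1)" "g2 \<bullet> d = norm g2 * (1 - c)"
    by simp_all
  then have sg: "g1 \<bullet> d < 0" "0 < g2 \<bullet> d"
    using nz c by (simp_all add: mult_pos_neg)
  have line: "((\<lambda>t. \<rho> (x + t *\<^sub>R d)) has_real_derivative grad \<rho> x \<bullet> d) (at 0)"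
    if "local_defining_function \<Omega> U \<rho>" "x \<in> U" for U \<rho>
  proof -
    have 1: "(\<rho> has_derivative (\<lambda>h. grad \<rho> x \<bullet> h)) (at (x + 0 *\<^sub>R d))"
      using local_defining_function_deriv(1)[OF that] by simp
    have 2: "((\<lambda>t::real. x + t *\<^sub>R d) has_derivative (\<lambda>t. t *\<^sub>R d)) (at 0)"
      by (auto intro!: derivative_eq_intros)
    show ?thesis
      using has_derivative_compose[OF 2 1] by (simp add: has_field_derivative_def mult.commute mult_commute_abs)
  qed
  have zero: "\<rho>1 x = 0" "\<rho>2 x = 0"
    using local_defining_function_zero assms by blast+
  obtain d1 where d1: "d1 > 0" "\<And>t. 0 < t \<Longrightarrow> t < d1 \<Longrightarrow> \<rho>1 (x + t *\<^sub>R d) < 0"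
    using DERIV_neg_dec_right[OF line[OF assms(1,5)]] sg zero by (auto simp: g1_def)
  obtain d2 where d2: "d2 > 0" "\<And>t. 0 < t \<Longrightarrow> t < d2 \<Longrightarrow> 0 < \<rho>2 (x + t *\<^sub>R d)"
    using DERIV_pos_inc_right[OF line[OF assms(2,6)]] sg zero by (auto simp: g2_def)
  have op: "open (U1 \<inter> U2)" using assms by (auto simp: local_defining_function_def)
  have "continuous (at 0) (\<lambda>t::real. x + t *\<^sub>R d)" by (intro continuous_intros)
  then have "\<forall>\<^sub>F t in at 0. x + t *\<^sub>R d \<in> U1 \<inter> U2"
    using op assms(5,6) by (intro topological_tendstoD[of _ x]) (auto simp: continuous_within)
  then obtain d3 where d3: "d3 > 0" "\<And>t. t \<noteq> 0 \<Longrightarrow> \<bar>t\<bar> < d3 \<Longrightarrow> x + t *\<^sub>R d \<in> U1 \<inter> U2"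
    by (auto simp: eventually_at)
  define t where "t = min d1 (min d2 d3) / 2"
  have "0 < t" "t < d1" "t < d2" "t < d3" using d1 d2 d3 by (auto simp: t_def)
  then have "\<rho>1 (x + t *\<^sub>R d) < 0" "0 < \<rho>2 (x + t *\<^sub>R d)" "x + t *\<^sub>R d \<in> U1 \<inter> U2"
    using d1(2) d2(2) d3(2) by auto
  moreover have "\<Omega> \<inter> U1 = {y\<in>U1. \<rho>1 y < 0}" "\<Omega> \<inter> U2 = {y\<in>U2. \<rho>2 y < 0}"
    using assms(1,2) by (auto simp: local_defining_function_def)
  ultimately show False by (smt (verit) IntD1 IntD2 IntI mem_Collect_eq)
qed

lemma outward_normal_eq:
  assumes "local_defining_function \<Omega> U \<rho>" "open \<Omega>" "x \<in> frontier \<Omega>" "x \<in> U"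
  shows "outward_normal \<Omega> x = sgn (grad \<rho> x)"
  unfolding outward_normal_def
  using assms local_defining_function_sgn_unique[OF assms(1)] by (intro the_equality) metis+

text \<open>Near a boundary point \<open>x0\<close> with outward normal \<open>\<nu>\<close>, a defining function divided by the length of
  its gradient at \<open>x0\<close> has a gradient within \<open>e\<close> of \<open>\<nu>\<close>. All the geometry below is read off from
  this: \<open>\<rho>\<close> differs from the affine function \<open>\<nu> \<bullet> (x - x0)\<close> by an \<open>e\<close>-Lipschitz function, so the
  boundary is an almost flat graph in the direction \<open>\<nu>\<close>. The bound \<open>1/8\<close> leaves room for the
  elementary estimates; \<open>e\<close> stays a parameter because the weight needs it smaller than the ratio of
  the lower bound for the normal component of the fields to the upper bound for their size.\<close>

locale boundary_chart =
  fixes \<Omega> :: "(real^'n) set" and x0 \<nu> :: "real^'n" and e R :: real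
    and \<rho> :: "real^'n \<Rightarrow> real" and G :: "real^'n \<Rightarrow> real^'n"
  assumes open_region: "open \<Omega>"
    and R_pos: "0 < R" and e_nonneg: "0 \<le> e" and e_le: "e \<le> 1/8"
    and norm_nu: "norm \<nu> = 1" and rho_center: "\<rho> x0 = 0"
    and rho_deriv: "x \<in> ball x0 R \<Longrightarrow> (\<rho> has_derivative (\<lambda>h. G x \<bullet> h)) (at x)"
    and G_cont: "continuous_on (ball x0 R) G"
    and G_close: "x \<in> ball x0 R \<Longrightarrow> norm (G x - \<nu>) \<le> e"
    and region: "\<Omega> \<inter> ball x0 R = {x \<in> ball x0 R. \<rho> x < 0}"

lemma boundary_chart_shrink:
  assumes "boundary_chart \<Omega> x0 \<nu> e R \<rho> G" "0 < r" "r \<le> R"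
  shows "boundary_chart \<Omega> x0 \<nu> e r \<rho> G"
proof -
  interpret boundary_chart \<Omega> x0 \<nu> e R \<rho> G by fact
  have sub: "ball x0 r \<subseteq> ball x0 R" using assms(3) by auto
  show ?thesis
  proof
    show "\<Omega> \<inter> ball x0 r = {x \<in> ball x0 r. \<rho> x < 0}" using region sub by blast
    show "continuous_on (ball x0 r) G" using G_cont sub continuous_on_subset by blast
  qed (use assms sub rho_deriv G_close open_region e_nonneg e_le norm_nu rho_center in auto)
qed

lemma exists_boundary_chart:
  assumes "smooth_boundary \<Omega>" "open \<Omega>" "x0 \<in> frontier \<Omega>" "0 < e" "e \<le> 1/8"
  shows "\<exists>R \<rho> G. boundary_chart \<Omega> x0 (outward_normal \<Omega> x0) e R \<rho> G"
proof -
  obtain U \<rho> where U: "x0 \<in> U" "local_defining_function \<Omega> U \<rho>"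
    using assms unfolding smooth_boundary_def by blast
  define g0 where "g0 = norm (grad \<rho> x0)"
  have g0: "g0 > 0" using U by (auto simp: g0_def local_defining_function_def)
  have op: "open U" and reg: "\<Omega> \<inter> U = {y\<in>U. \<rho> y < 0}"
    using U by (auto simp: local_defining_function_def)
  define G where "G x = grad \<rho> x /\<^sub>R g0" for x
  define \<rho>' where "\<rho>' x = \<rho> x / g0" for x
  have \<nu>: "outward_normal \<Omega> x0 = G x0"
    using outward_normal_eq[OF U(2) assms(2,3) U(1)] by (simp add: G_def sgn_div_norm g0_def)
  have Gc: "continuous_on U G"
    unfolding G_def by (intro continuous_intros local_defining_function_deriv(2)[OF U(2)])
  have "\<exists>d>0. \<forall>x\<in>U. dist x x0 < d \<longrightarrow> dist (G x) (G x0) < e"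
    using Gc U(1) assms(4) by (simp add: continuous_on_iff)
  then obtain d where d: "d > 0" "\<And>x. x \<in> U \<Longrightarrow> dist x x0 < d \<Longrightarrow> dist (G x) (G x0) < e"
    by blast
  obtain r where r: "r > 0" "ball x0 r \<subseteq> U"
    using op U(1) openE by blast
  define R where "R = min d r"
  have sub: "ball x0 R \<subseteq> U" using r by (auto simp: R_def)
  have "boundary_chart \<Omega> x0 (outward_normal \<Omega> x0) e R \<rho>' G"
  proof
    show "0 < R" using d r by (simp add: R_def)
    show "norm (outward_normal \<Omega> x0) = 1"
      using g0 by (simp add: \<nu> G_def g0_def)
    show "\<rho>' x0 = 0"
      using local_defining_function_zero[OF U(2) assms(2,3) U(1)] by (simp add: \<rho>'_def)
    show "(\<rho>' has_derivative (\<lambda>h. G x \<bullet> h)) (at x)" if "x \<in> ball x0 R" for x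
    proof -
      have "(\<rho> has_derivative (\<lambda>h. grad \<rho> x \<bullet> h)) (at x)"
        using local_defining_function_deriv(1)[OF U(2)] that sub by blast
      then have "((\<lambda>x. \<rho> x / g0) has_derivative (\<lambda>h. grad \<rho> x \<bullet> h / g0)) (at x)"
        using g0 by (auto intro!: derivative_eq_intros)
      then show ?thesis
        by (simp add: \<rho>'_def[abs_def] G_def divide_inverse mult.commute)
    qed
    show "norm (G x - outward_normal \<Omega> x0) \<le> e" if "x \<in> ball x0 R" for x
      using d(2)[of x] that sub by (force simp: \<nu> R_def dist_norm norm_minus_commute)
    show "\<Omega> \<inter> ball x0 R = {x \<in> ball x0 R. \<rho>' x < 0}"
      using reg sub g0 by (auto simp: \<rho>'_def divide_less_0_iff)
    show "continuous_on (ball x0 R) G" using Gc sub continuous_on_subset by blast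
  qed (use assms in auto)
  then show ?thesis by blast
qed

context boundary_chart
begin

lemma rho_almost_affine:
  assumes "x \<in> ball x0 R" "y \<in> ball x0 R"
  shows "\<bar>\<rho> x - \<rho> y - \<nu> \<bullet> (x - y)\<bar> \<le> e * norm (x - y)"
proof -
  have "norm ((\<rho> x - \<nu> \<bullet> x) - (\<rho> y - \<nu> \<bullet> y)) \<le> e * norm (x - y)"
  proof (rule differentiable_bound[where f' = "\<lambda>z h. (G z - \<nu>) \<bullet> h" and S = "ball x0 R"])
    show "((\<lambda>x. \<rho> x - \<nu> \<bullet> x) has_derivative (\<lambda>h. (G z - \<nu>) \<bullet> h)) (at z within ball x0 R)"
      if "z \<in> ball x0 R" for z
      using has_derivative_at_withinI[OF rho_deriv[OF that]]
      by (auto intro!: derivative_eq_intros simp: inner_diff_left)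
    show "onorm (\<lambda>h. (G z - \<nu>) \<bullet> h) \<le> e" if "z \<in> ball x0 R" for z
    proof (rule onorm_bound)
      fix h
      have "norm ((G z - \<nu>) \<bullet> h) \<le> norm (G z - \<nu>) * norm h"
        using Cauchy_Schwarz_ineq2 by auto
      also have "\<dots> \<le> e * norm h" using G_close[OF that] by (intro mult_right_mono) auto
      finally show "norm ((G z - \<nu>) \<bullet> h) \<le> e * norm h" .
    qed (rule e_nonneg)
  qed (use assms in auto)
  then show ?thesis by (simp add: inner_diff_right algebra_simps)
qed

lemma rho_cont: "continuous_on (ball x0 R) \<rho>"
  using rho_deriv
  by (meson differentiableI differentiable_imp_continuous_on differentiable_on_def has_derivative_at_withinI)

lemma level_set_flat:
  assumes "x \<in> ball x0 R" "y \<in> ball x0 R" "\<rho> x = 0" "\<rho> y = 0"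
  shows "\<bar>\<nu> \<bullet> (x - y)\<bar> \<le> norm (x - y) / 2"
proof -
  have "e * norm (x - y) \<le> 1/8 * norm (x - y)" using e_le by (intro mult_right_mono) auto
  then show ?thesis using rho_almost_affine[OF assms(1,2)] assms(3,4) by simp
qed

lemma rho_shift_bounds:
  assumes "x \<in> ball x0 R" "x + s *\<^sub>R \<nu> \<in> ball x0 R" "0 \<le> s"
  shows "\<rho> x + 7/8 * s \<le> \<rho> (x + s *\<^sub>R \<nu>)"
proof -
  have "\<bar>\<rho> (x + s *\<^sub>R \<nu>) - \<rho> x - \<nu> \<bullet> (s *\<^sub>R \<nu>)\<bar> \<le> e * s"
    using rho_almost_affine[OF assms(2,1)] norm_nu assms(3) by simp
  moreover have "\<nu> \<bullet> (s *\<^sub>R \<nu>) = s" using norm_nu by (simp add: dot_square_norm)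
  moreover have "e * s \<le> 1/8 * s" using e_le assms(3) by (intro mult_right_mono) auto
  ultimately show ?thesis by linarith
qed

lemma mem_frontier_iff:
  assumes "x \<in> ball x0 R"
  shows "x \<in> frontier \<Omega> \<longleftrightarrow> \<rho> x = 0"
proof
  assume "x \<in> frontier \<Omega>"
  then show "\<rho> x = 0"
    by (rule frontier_sublevel_zero[OF open_region open_ball rho_cont region _ assms])
next
  assume z: "\<rho> x = 0"
  then have "x \<notin> \<Omega>" using region assms by (metis (mono_tags, lifting) IntI less_irrefl mem_Collect_eq)
  moreover have "x \<in> closure \<Omega>"
    unfolding closure_approachable
  proof (intro allI impI)
    fix d :: real assume "0 < d"
    obtain t where t: "t > 0" "ball x t \<subseteq> ball x0 R" using assms openE by blast
    define s where "s = min d t / 2"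
    have s: "0 < s" "s < d" "s < t" using \<open>0 < d\<close> t by (auto simp: s_def)
    define y where "y = x - s *\<^sub>R \<nu>"
    have "y \<in> ball x t" using s norm_nu by (simp add: y_def dist_norm)
    then have y: "y \<in> ball x0 R" using t by blast
    have "\<rho> y + 7/8 * s \<le> \<rho> x" using rho_shift_bounds[OF y, of s] s assms by (simp add: y_def)
    then have "\<rho> y < 0" using z s by linarith
    then have "y \<in> \<Omega>" using region y by blast
    moreover have "dist y x < d" using s norm_nu by (simp add: y_def dist_norm)
    ultimately show "\<exists>y\<in>\<Omega>. dist y x < d" by blast
  qed
  ultimately show "x \<in> frontier \<Omega>" using open_region by (simp add: frontier_def interior_open)
qed

lemma center_in_frontier: "x0 \<in> frontier \<Omega>"
  using mem_frontier_iff[of x0] R_pos rho_center by simp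

text \<open>Two points of \<open>\<Omega>\<close> cannot in general be joined by a segment in \<open>\<Omega>\<close>, so a bound on the derivative
  of \<open>f\<close> is integrated along a detour: from \<open>x\<close> to the point \<open>3 * norm (x - x0)\<close> below \<open>x0\<close>, and from
  there straight up to \<open>x0\<close>. On both segments \<open>\<rho>\<close> stays negative because they descend, or stay
  below \<open>x0\<close>, in the direction \<open>\<nu>\<close>. The lengths are at most 4 and 3 times \<open>norm (x - x0)\<close>.\<close>

lemma lipschitz_at_center:
  fixes f :: "real^'n \<Rightarrow> 'b::real_normed_vector"
  assumes der: "\<And>x. x \<in> \<Omega> \<Longrightarrow> (f has_derivative f' x) (at x)"
    and bnd: "\<And>x h. x \<in> \<Omega> \<Longrightarrow> norm (f' x h) \<le> B * norm h"
    and "0 \<le> B" and cont: "continuous_on (closure \<Omega>) f"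
    and x: "x \<in> \<Omega> \<inter> ball x0 (R/4)"
  shows "norm (f x - f x0) \<le> 7 * B * norm (x - x0)"
proof -
  define d where "d = norm (x - x0)"
  have "x \<noteq> x0" using x center_in_frontier open_region by (auto simp: frontier_def interior_open)
  then have d: "0 < d" "d < R/4" using x by (auto simp: d_def dist_norm norm_minus_commute)
  define z where "z = x0 - (3 * d) *\<^sub>R \<nu>"
  have lip: "norm (f a - f b) \<le> B * norm (a - b)" if "closed_segment a b \<subseteq> \<Omega>" for a b
  proof (rule differentiable_bound[where S = "closed_segment a b"])
    show "(f has_derivative f' x) (at x within closed_segment a b)" if "x \<in> closed_segment a b" for x
      using der that \<open>closed_segment a b \<subseteq> \<Omega>\<close> has_derivative_at_withinI by blast
    show "onorm (f' x) \<le> B" if "x \<in> closed_segment a b" for x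
      using bnd that \<open>closed_segment a b \<subseteq> \<Omega>\<close> \<open>0 \<le> B\<close> by (intro onorm_bound) auto
  qed auto
  have nu1: "\<nu> \<bullet> \<nu> = 1" using norm_nu by (simp add: dot_square_norm)
  have inR: "z \<in> ball x0 R" "x \<in> ball x0 R"
    using d norm_nu x by (auto simp: z_def dist_norm)
  have "x - z = (x - x0) + (3 * d) *\<^sub>R \<nu>" by (simp add: z_def)
  then have "norm (x - z) \<le> norm (x - x0) + norm ((3 * d) *\<^sub>R \<nu>)"
    using norm_triangle_ineq[of "x - x0" "(3 * d) *\<^sub>R \<nu>"] by (simp only:)
  then have xz: "norm (x - z) \<le> 4 * d"
    using norm_nu d by (simp add: d_def[symmetric])
  have seg1: "closed_segment x z \<subseteq> \<Omega>"
  proof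
    fix y assume "y \<in> closed_segment x z"
    then obtain u where u: "0 \<le> u" "u \<le> 1" "y = x + u *\<^sub>R (z - x)"
      by (auto simp: closed_segment_def algebra_simps)
    have y: "y \<in> ball x0 R"
      using inR \<open>y \<in> closed_segment x z\<close> convex_ball closed_segment_subset by blast
    have nz: "norm (z - x) \<le> 4 * d" using xz by (simp add: norm_minus_commute)
    have "\<nu> \<bullet> (z - x) = - (\<nu> \<bullet> (x - x0)) - 3 * d"
      using nu1 by (simp add: z_def inner_diff_right)
    moreover have "\<bar>\<nu> \<bullet> (x - x0)\<bar> \<le> d"
      using Cauchy_Schwarz_ineq2[of \<nu> "x - x0"] norm_nu by (simp add: d_def)
    ultimately have vz: "\<nu> \<bullet> (z - x) \<le> - 2 * d" by linarith
    have "\<bar>\<rho> y - \<rho> x - u * (\<nu> \<bullet> (z - x))\<bar> \<le> e * (u * norm (z - x))"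
      using rho_almost_affine[OF y inR(2)] u by simp
    also have "\<dots> \<le> 1/8 * (u * (4 * d))"
      using e_nonneg e_le u nz d by (intro mult_mono) auto
    finally have "\<rho> y \<le> \<rho> x + u * (\<nu> \<bullet> (z - x)) + u * d / 2" by linarith
    moreover have "u * (\<nu> \<bullet> (z - x)) \<le> u * (- 2 * d)" using u vz by (intro mult_left_mono)
    moreover have "0 \<le> u * d" using u d by simp
    moreover have "\<rho> x < 0" using x inR region by blast
    ultimately have "\<rho> y < 0" by (simp add: algebra_simps)
    then show "y \<in> \<Omega>" using region y by blast
  qed
  have seg2: "closed_segment z (x0 - s *\<^sub>R \<nu>) \<subseteq> \<Omega>" if "0 < s" "s < 3 * d" for s
  proof
    fix y assume y: "y \<in> closed_segment z (x0 - s *\<^sub>R \<nu>)"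
    then obtain u where u: "0 \<le> u" "u \<le> 1" "y = (1 - u) *\<^sub>R z + u *\<^sub>R (x0 - s *\<^sub>R \<nu>)"
      by (auto simp: closed_segment_def)
    define q where "q = (1 - u) * (3 * d) + u * s"
    have yq: "y = x0 - q *\<^sub>R \<nu>" by (simp add: u z_def q_def algebra_simps)
    have "0 < q" using u d that by (cases "u = 0") (auto simp: q_def add_nonneg_pos)
    have "y \<in> ball x0 R"
    proof -
      have "x0 - s *\<^sub>R \<nu> \<in> ball x0 R" using that d norm_nu by (auto simp: dist_norm)
      then show ?thesis using inR(1) y convex_ball closed_segment_subset by blast
    qed
    moreover then have "\<rho> y + 7/8 * q \<le> \<rho> x0"
      using rho_shift_bounds[of y q] \<open>0 < q\<close> R_pos by (simp add: yq)
    ultimately show "y \<in> \<Omega>" using region \<open>0 < q\<close> rho_center by fastforce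
  qed
  have "norm (f z - f x0) \<le> B * norm (z - x0)"
  proof (rule tendsto_le[where F = "at_right (0::real)"])
    have "((\<lambda>s. x0 - s *\<^sub>R \<nu>) \<longlongrightarrow> x0 - 0 *\<^sub>R \<nu>) (at_right 0)" by (intro tendsto_intros)
    then have t: "((\<lambda>s. x0 - s *\<^sub>R \<nu>) \<longlongrightarrow> x0) (at_right 0)" by simp
    have ev: "\<forall>\<^sub>F s in at_right 0. 0 < s \<and> s < 3 * d"
      using d by (auto simp: eventually_at_right[of 0 "3 * d"])
    then have ev': "\<forall>\<^sub>F s in at_right 0. x0 - s *\<^sub>R \<nu> \<in> closure \<Omega>"
      by (rule eventually_mono) (use seg2 closure_subset in blast)
    have x0c: "x0 \<in> closure \<Omega>" using center_in_frontier by (simp add: frontier_def)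
    have "((\<lambda>s. f (x0 - s *\<^sub>R \<nu>)) \<longlongrightarrow> f x0) (at_right 0)"
      by (rule continuous_on_tendsto_compose[OF cont t x0c ev'])
    then show "((\<lambda>s. norm (f z - f (x0 - s *\<^sub>R \<nu>))) \<longlongrightarrow> norm (f z - f x0)) (at_right 0)"
      by (intro tendsto_intros)
    show "((\<lambda>s. B * norm (z - (x0 - s *\<^sub>R \<nu>))) \<longlongrightarrow> B * norm (z - x0)) (at_right 0)"
      by (intro tendsto_intros t)
    show "\<forall>\<^sub>F s in at_right 0. norm (f z - f (x0 - s *\<^sub>R \<nu>)) \<le> B * norm (z - (x0 - s *\<^sub>R \<nu>))"
      using ev by (rule eventually_mono) (use lip seg2 in blast)
  qed simp
  moreover have "norm (f x - f z) \<le> B * norm (x - z)" by (rule lip[OF seg1])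
  moreover have "norm (z - x0) = 3 * d" using norm_nu d by (simp add: z_def)
  moreover have "B * norm (x - z) \<le> B * (4 * d)" using xz \<open>0 \<le> B\<close> by (rule mult_left_mono)
  moreover have "norm (f x - f x0) \<le> norm (f x - f z) + norm (f z - f x0)"
    using norm_triangle_ineq[of "f x - f z" "f z - f x0"] by simp
  ultimately have "norm (f x - f x0) \<le> B * (4 * d) + B * (3 * d)" by simp
  then show ?thesis by (simp add: d_def algebra_simps)
qed


definition strip :: "real \<Rightarrow> (real^'n) set" where
  "strip l = {x \<in> ball x0 (R/2). - l < \<rho> x \<and> \<rho> x < 0}"

lemma open_strip: "open (strip l)"
proof -
  have "continuous_on (ball x0 (R/2)) \<rho>"
    by (rule continuous_on_subset[OF rho_cont]) (use R_pos in auto)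
  then have "open (ball x0 (R/2) \<inter> \<rho> -` {-l<..<0})"
    by (intro continuous_open_preimage) auto
  moreover have "strip l = ball x0 (R/2) \<inter> \<rho> -` {-l<..<0}" by (auto simp: strip_def)
  ultimately show ?thesis by simp
qed

text \<open>Moving up in the direction \<open>\<nu>\<close> increases \<open>\<rho>\<close> at rate at least \<open>7/8\<close>, so a point where
  \<open>\<rho> > - l\<close> meets the boundary within distance \<open>2 * l\<close>.\<close>

lemma strip_exit:
  assumes "x \<in> strip l" "0 < l" "l \<le> R/4"
  shows "\<exists>s\<in>{0..2*l}. x + s *\<^sub>R \<nu> \<in> frontier \<Omega> \<inter> ball x0 R"
proof -
  have x: "dist x0 x < R/2" "- l < \<rho> x" "\<rho> x < 0" using assms by (auto simp: strip_def)
  have inb: "x + s *\<^sub>R \<nu> \<in> ball x0 R" if "s \<in> {0..2*l}" for s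
  proof -
    have "dist x (x + s *\<^sub>R \<nu>) \<le> 2 * l" using that norm_nu by (simp add: dist_norm)
    then show ?thesis using dist_triangle[of x0 "x + s *\<^sub>R \<nu>" x] x assms by simp
  qed
  have cont: "continuous_on {0..2*l} (\<lambda>s. \<rho> (x + s *\<^sub>R \<nu>))"
    by (rule continuous_on_compose2[OF rho_cont]) (use inb in \<open>auto intro!: continuous_intros\<close>)
  have "x + (2*l) *\<^sub>R \<nu> \<in> ball x0 R" "x \<in> ball x0 R"
    using inb[of "2*l"] inb[of 0] assms by auto
  then have "\<rho> x + 7/8 * (2*l) \<le> \<rho> (x + (2*l) *\<^sub>R \<nu>)"
    using assms by (intro rho_shift_bounds) auto
  then have "0 \<le> \<rho> (x + (2*l) *\<^sub>R \<nu>)" using x assms by linarith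
  then obtain s where "0 \<le> s" "s \<le> 2*l" "\<rho> (x + s *\<^sub>R \<nu>) = 0"
    using IVT'[of "\<lambda>s. \<rho> (x + s *\<^sub>R \<nu>)" 0 0 "2*l", OF _ _ _ cont] x assms by auto
  then show ?thesis using mem_frontier_iff inb by (intro bexI[of _ s]) auto
qed

text \<open>The projection of the strip to the boundary along \<open>\<nu>\<close> is Lipschitz, hence measurable, since the
  boundary is flat. By the tube estimate the image of Lebesgue measure on the strip under this projection
  is at most \<open>2 * l\<close> times a constant times the Hausdorff measure.\<close>

lemma nn_integral_strip_le:
  fixes F f :: "real^'n \<Rightarrow> ennreal"
  assumes l: "0 < l" "l \<le> R/4" and f[measurable]: "f \<in> borel_measurable borel"
    and le: "\<And>x y. x \<in> strip l \<Longrightarrow> y \<in> frontier \<Omega> \<inter> ball x0 R \<Longrightarrow> dist x y \<le> 2*l \<Longrightarrow> F x \<le> f y"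
  shows "(\<integral>\<^sup>+x. F x * indicator (strip l) x \<partial>lborel) \<le> ennreal (tube_const (CARD('n)) * (2*l)) *
    (\<integral>\<^sup>+y. f y * indicator (frontier \<Omega> \<inter> ball x0 R) y \<partial>hausdorff_measure (CARD('n) - 1))"
proof -
  define Z where "Z = frontier \<Omega> \<inter> ball x0 R"
  have Z[measurable]: "Z \<in> sets borel" by (simp add: Z_def)
  have S[measurable]: "strip l \<in> sets borel" using open_strip by simp
  obtain s where s: "\<And>x. x \<in> strip l \<Longrightarrow> s x \<in> {0..2*l} \<and> x + s x *\<^sub>R \<nu> \<in> Z"
    using strip_exit[OF _ l] unfolding Z_def by metis
  define \<pi> where "\<pi> x = x + s x *\<^sub>R \<nu>" for x
  have \<pi>Z: "\<pi> x \<in> Z" if "x \<in> strip l" for x using s that by (simp add: \<pi>_def)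
  have "2-lipschitz_on (strip l) \<pi>"
  proof (rule lipschitz_onI)
    fix a b assume ab: "a \<in> strip l" "b \<in> strip l"
    define q where "q = \<pi> a - \<pi> b"
    have "\<bar>\<nu> \<bullet> q\<bar> \<le> norm q / 2"
      unfolding q_def using \<pi>Z[OF ab(1)] \<pi>Z[OF ab(2)] mem_frontier_iff
      by (intro level_set_flat) (auto simp: Z_def)
    then have "3/4 * (norm q)\<^sup>2 \<le> (norm (q + (s b - s a) *\<^sub>R \<nu>))\<^sup>2"
      using norm_nu by (rule norm_flat_shift_ge)
    moreover have "q + (s b - s a) *\<^sub>R \<nu> = a - b"
      by (simp add: q_def \<pi>_def algebra_simps)
    ultimately have "3/4 * (norm q)\<^sup>2 \<le> (norm (a - b))\<^sup>2" by simp
    moreover have "(2 * norm (a - b))\<^sup>2 = 4 * (norm (a - b))\<^sup>2" by (simp add: power_mult_distrib)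
    ultimately have "(norm q)\<^sup>2 \<le> (2 * norm (a - b))\<^sup>2"
      using zero_le_power2[of "norm q"] by linarith
    then have "norm q \<le> 2 * norm (a - b)"
      by (rule power2_le_imp_le) simp
    then show "dist (\<pi> a) (\<pi> b) \<le> 2 * dist a b" by (simp add: dist_norm q_def)
  qed simp
  then have "continuous_on (strip l) \<pi>" by (rule lipschitz_on_continuous_on)
  define M where "M = restrict_space lborel (strip l)"
  have \<pi>m[measurable]: "\<pi> \<in> M \<rightarrow>\<^sub>M borel"
    using borel_measurable_continuous_on_restrict[OF \<open>continuous_on (strip l) \<pi>\<close>]
    by (rule subst[OF measurable_cong_sets, rotated 2]) (simp_all add: M_def sets_restrict_space)
  define c where "c = ennreal (tube_const (CARD('n)) * (2*l))"
  let ?H = "hausdorff_measure (CARD('n) - 1) :: (real^'n) measure"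
  define h where "h y = f y * indicator Z y" for y
  have h[measurable]: "h \<in> borel_measurable borel" unfolding h_def by measurable
  have leM: "distr M borel \<pi> \<le> scale_measure c ?H"
  proof (subst le_measure, simp, intro ballI)
    fix A assume "A \<in> sets (distr M borel \<pi>)"
    then have A[measurable]: "A \<in> sets borel" by simp
    have "emeasure (distr M borel \<pi>) A = emeasure M (\<pi> -` A \<inter> space M)"
      by (rule emeasure_distr) auto
    also have "\<dots> = emeasure lborel (\<pi> -` A \<inter> strip l)"
      unfolding M_def using S by (subst emeasure_restrict_space) (auto simp: space_restrict_space)
    also have "\<dots> \<le> c * hausdorff_outer (DIM(real^'n) - 1) A"
    proof -
      have "\<pi> -` A \<inter> strip l \<subseteq> tube A \<nu> (2*l)"
      proof
        fix x assume x: "x \<in> \<pi> -` A \<inter> strip l"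
        then have "x = \<pi> x - s x *\<^sub>R \<nu>" "\<pi> x \<in> A" "s x \<in> {0..2*l}"
          using s by (auto simp: \<pi>_def)
        then show "x \<in> tube A \<nu> (2*l)" unfolding tube_def by force
      qed
      then show ?thesis
        using emeasure_tube_le_hausdorff[OF norm_nu, of "2*l"] l by (simp add: c_def)
    qed
    finally show "emeasure (distr M borel \<pi>) A \<le> emeasure (scale_measure c ?H) A"
      using A by (simp add: emeasure_hausdorff_measure)
  qed
  have "(\<integral>\<^sup>+x. F x * indicator (strip l) x \<partial>lborel) \<le> (\<integral>\<^sup>+x. h (\<pi> x) * indicator (strip l) x \<partial>lborel)"
  proof (rule nn_integral_mono)
    fix x
    show "F x * indicator (strip l) x \<le> h (\<pi> x) * indicator (strip l) x"
    proof (cases "x \<in> strip l")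
      case True
      have "dist x (\<pi> x) \<le> 2*l" using s[OF True] norm_nu by (simp add: \<pi>_def dist_norm)
      then show ?thesis using le[OF True] \<pi>Z[OF True] True by (simp add: h_def Z_def)
    qed simp
  qed
  also have "\<dots> = (\<integral>\<^sup>+x. h (\<pi> x) \<partial>M)"
    unfolding M_def using S by (subst nn_integral_restrict_space) auto
  also have "\<dots> = (\<integral>\<^sup>+y. h y \<partial>distr M borel \<pi>)"
    by (rule nn_integral_distr[symmetric]) auto
  also have "\<dots> \<le> (\<integral>\<^sup>+y. h y \<partial>scale_measure c ?H)"
    using leM by (intro nn_integral_mono_measure) auto
  also have "\<dots> = c * (\<integral>\<^sup>+y. h y \<partial>?H)"
    by (rule nn_integral_scale_measure) (simp cong: measurable_cong_sets)
  finally show ?thesis by (simp add: c_def h_def Z_def)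
qed

lemma hausdorff_outer_chart_finite: "hausdorff_outer (CARD('n) - 1) (frontier \<Omega> \<inter> ball x0 R) < top"
proof -
  have "\<bar>\<nu> \<bullet> (x - y)\<bar> \<le> norm (x - y) / 2" if "x \<in> frontier \<Omega> \<inter> ball x0 R" "y \<in> frontier \<Omega> \<inter> ball x0 R" for x y
    using that mem_frontier_iff by (intro level_set_flat) auto
  moreover have "frontier \<Omega> \<inter> ball x0 R \<subseteq> cball x0 R" by auto
  ultimately show ?thesis
    using hausdorff_outer_flat_finite[of "frontier \<Omega> \<inter> ball x0 R" \<nu> x0 R] norm_nu by simp
qed

end

lemma hausdorff_outer_frontier_finite:
  fixes \<Omega> :: "(real^'n) set"
  assumes "smooth_boundary \<Omega>" "open \<Omega>" "bounded \<Omega>"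
  shows "hausdorff_outer (CARD('n) - 1) (frontier \<Omega>) < top"
proof (rule hausdorff_outer_finite_of_locally_finite)
  show "compact (frontier \<Omega>)" using assms by (simp add: compact_frontier_bounded)
  fix x assume "x \<in> frontier \<Omega>"
  then obtain R \<rho> G where "boundary_chart \<Omega> x (outward_normal \<Omega> x) (1/8) R \<rho> G"
    using exists_boundary_chart[OF assms(1,2), of x "1/8"] by auto
  then interpret boundary_chart \<Omega> x "outward_normal \<Omega> x" "1/8" R \<rho> G .
  show "\<exists>r>0. hausdorff_outer (CARD('n) - 1) (frontier \<Omega> \<inter> ball x r) < top"
    using R_pos hausdorff_outer_chart_finite by blast
qed

section \<open>The divergence identity for transport in a cylinder\<close>

text \<open>The difference quotients have integral zero by translation invariance and are bounded by the
  derivative bound on a fixed compact set; dominated convergence gives the claim.\<close>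

lemma integral_directional_derivative_eq_0:
  fixes K :: "'a::euclidean_space \<Rightarrow> real"
  assumes der: "\<And>x. (K has_derivative K' x) (at x)"
    and S: "compact S" "\<And>x. x \<notin> S \<Longrightarrow> K x = 0"
    and B: "\<And>x. \<bar>K' x e\<bar> \<le> B"
  shows "integrable lborel (\<lambda>x. K' x e)" and "(\<integral>x. K' x e \<partial>lborel) = 0"
proof -
  define h :: "nat \<Rightarrow> real" where "h n = 1 / real (Suc n)" for n
  have h: "0 < h n" "h n \<le> 1" for n by (auto simp: h_def)
  define D where "D n x = (K (x + h n *\<^sub>R e) - K x) / h n" for n x
  have cont: "continuous_on UNIV K"
    using der by (meson continuous_at_imp_continuous_on has_derivative_continuous)
  then have Km[measurable]: "K \<in> borel_measurable borel"
    by (rule borel_measurable_continuous_onI)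
  have line: "((\<lambda>s. K (x + s *\<^sub>R e)) has_real_derivative K' (x + s *\<^sub>R e) e) (at s)" for x s
  proof -
    have "((\<lambda>s::real. x + s *\<^sub>R e) has_derivative (\<lambda>u. u *\<^sub>R e)) (at s)"
      by (auto intro!: derivative_eq_intros)
    from has_derivative_compose[OF this der]
    have "((\<lambda>s. K (x + s *\<^sub>R e)) has_derivative (\<lambda>u. K' (x + s *\<^sub>R e) (u *\<^sub>R e))) (at s)" .
    moreover have "K' (x + s *\<^sub>R e) (u *\<^sub>R e) = K' (x + s *\<^sub>R e) e * u" for u
      using linear_cmul[OF has_derivative_linear[OF der]] by (simp add: mult.commute)
    ultimately show ?thesis by (simp add: has_field_derivative_def)
  qed
  have B0: "0 \<le> B" using B[of undefined] by linarith
  have Dbnd: "\<bar>D n x\<bar> \<le> B" for n x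
  proof -
    obtain s where "0 < s" "s < h n" "K (x + h n *\<^sub>R e) - K (x + 0 *\<^sub>R e) = (h n - 0) * K' (x + s *\<^sub>R e) e"
      using MVT2[of 0 "h n" "\<lambda>s. K (x + s *\<^sub>R e)" "\<lambda>s. K' (x + s *\<^sub>R e) e"] h line by blast
    then have "D n x = K' (x + s *\<^sub>R e) e" using h[of n] by (simp add: D_def)
    then show ?thesis using B by simp
  qed
  have lim: "(\<lambda>n. D n x) \<longlonglongrightarrow> K' x e" for x
  proof -
    have "((\<lambda>u. (K (x + u *\<^sub>R e) - K x) / u) \<longlongrightarrow> K' x e) (at 0)"
      using line[of x 0] by (simp add: DERIV_def)
    moreover have "filterlim h (at 0) sequentially"
      unfolding filterlim_at h_def using LIMSEQ_Suc[OF lim_1_over_n] by auto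
    ultimately show ?thesis unfolding D_def by (rule filterlim_compose)
  qed
  define S' where "S' = (\<lambda>(x, s). x - s *\<^sub>R e) ` (S \<times> {0..1::real})"
  have S': "compact S'"
    unfolding S'_def using S(1)
    by (intro compact_continuous_image compact_Times) (auto simp: split_beta intro!: continuous_intros)
  have Dz: "D n x = 0" if "x \<notin> S'" for n x
  proof -
    have "x \<notin> S" using that by (force simp: S'_def)
    moreover have "x + h n *\<^sub>R e \<notin> S"
    proof
      assume "x + h n *\<^sub>R e \<in> S"
      then have "(\<lambda>(x, s). x - s *\<^sub>R e) (x + h n *\<^sub>R e, h n) \<in> S'"
        unfolding S'_def using h[of n] by (intro imageI) auto
      then show False using that by simp
    qed
    ultimately show ?thesis using S(2) by (simp add: D_def)
  qed
  have Dm: "D n \<in> borel_measurable lborel" for n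
    unfolding D_def by measurable
  have K'm: "(\<lambda>x. K' x e) \<in> borel_measurable lborel"
    by (rule borel_measurable_LIMSEQ_real[OF lim Dm])
  have finS: "emeasure lborel S' < \<infinity>"
    using emeasure_bounded_finite[OF compact_imp_bounded[OF S']] .
  have dom: "integrable lborel (\<lambda>x. B * indicator S' x)"
    using finS borel_compact[OF S'] by (intro integrable_mult_right) simp
  have bnd: "AE x in lborel. norm (D n x) \<le> B * indicator S' x" for n
    using Dbnd Dz B0 by (intro AE_I2) (auto simp: indicator_def)
  have limAE: "AE x in lborel. (\<lambda>n. D n x) \<longlonglongrightarrow> K' x e" using lim by simp
  show "integrable lborel (\<lambda>x. K' x e)"
    by (rule integrable_dominated_convergence[OF K'm Dm dom limAE bnd])
  have "(\<lambda>n. \<integral>x. D n x \<partial>lborel) \<longlonglongrightarrow> (\<integral>x. K' x e \<partial>lborel)"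
    by (rule integral_dominated_convergence[OF K'm Dm dom limAE bnd])
  moreover have "(\<integral>x. D n x \<partial>lborel) = 0" for n
  proof -
    have Kint: "integrable lborel K"
    proof -
      obtain b where b: "\<And>x. x \<in> S \<Longrightarrow> norm (K x) \<le> b"
        using compact_imp_bounded[OF compact_continuous_image[OF continuous_on_subset[OF cont] S(1)]]
        by (auto simp: bounded_iff)
      show ?thesis
      proof (rule integrableI_bounded_set[where A = S and B = b])
        show "emeasure lborel S < \<infinity>" using emeasure_bounded_finite[OF compact_imp_bounded[OF S(1)]] .
      qed (use S b borel_compact in auto)
    qed
    define c where "c = h n *\<^sub>R e"
    have "integrable (distr lborel borel ((+) c)) K" using Kint by (simp add: lborel_distr_plus)
    then have shint: "integrable lborel (\<lambda>x. K (c + x))"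
      by (subst (asm) integrable_distr_eq) auto
    have "(\<integral>x. K (c + x) \<partial>lborel) = (\<integral>x. K x \<partial>distr lborel borel ((+) c))"
      by (rule integral_distr[symmetric]) auto
    also have "\<dots> = (\<integral>x. K x \<partial>lborel)" by (simp add: lborel_distr_plus)
    finally have "(\<integral>x. K (c + x) - K x \<partial>lborel) = 0"
      using Kint shint by simp
    then show ?thesis
      by (simp add: D_def c_def add.commute)
  qed
  ultimately show "(\<integral>x. K' x e \<partial>lborel) = 0" by (simp add: LIMSEQ_const_iff)
qed

lemma integrable_supported_cylinder:
  fixes g :: "'a::euclidean_space \<times> real \<Rightarrow> real"
  assumes "open Ob" "compact S" "S \<subseteq> Ob" "continuous_on (Ob \<times> {0..T}) g"
    and z: "\<And>x t. x \<in> Ob - S \<Longrightarrow> t \<in> {0<..<T} \<Longrightarrow> g (x, t) = 0"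
  shows "integrable lborel (\<lambda>z. indicator (Ob \<times> {0<..<T}) z * g z)"
proof -
  have "continuous_on (S \<times> {0..T}) g" by (rule continuous_on_subset[OF assms(4)]) (use assms in auto)
  moreover have comp: "compact (S \<times> {0..T})" using assms by (intro compact_Times) auto
  ultimately obtain b where b: "\<And>z. z \<in> S \<times> {0..T} \<Longrightarrow> norm (g z) \<le> b"
    using compact_imp_bounded[OF compact_continuous_image] by (metis bounded_iff imageI)
  have z': "g z = 0" if "z \<notin> S \<times> {0..T}" "z \<in> Ob \<times> {0<..<T}" for z
    using that z[of "fst z" "snd z"] by (cases z) auto
  show ?thesis
  proof (rule integrableI_bounded_set[where A = "S \<times> {0..T}" and B = b])
    have "continuous_on (Ob \<times> {0<..<T}) g" by (rule continuous_on_subset[OF assms(4)]) auto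
    moreover have "open (Ob \<times> {0<..<T})" using assms by (intro open_Times) auto
    ultimately show "(\<lambda>z. indicator (Ob \<times> {0<..<T}) z * g z) \<in> borel_measurable lborel"
      using borel_measurable_continuous_on_indicator[of "Ob \<times> {0<..<T}" g] by auto
    show "S \<times> {0..T} \<in> sets lborel" using borel_compact[OF comp] by simp
    show "emeasure lborel (S \<times> {0..T}) < \<infinity>" using emeasure_bounded_finite[OF compact_imp_bounded[OF comp]] .
    show "AE z in lborel. z \<in> S \<times> {0..T} \<longrightarrow> norm (indicator (Ob \<times> {0<..<T}) z * g z) \<le> b"
      using b by (intro AE_I2) (fastforce simp: indicator_def abs_mult)
    show "AE z in lborel. z \<notin> S \<times> {0..T} \<longrightarrow> indicator (Ob \<times> {0<..<T}) z * g z = 0"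
      by (intro AE_I2) (use z' in \<open>simp add: indicator_def\<close>)
  qed
qed

text \<open>Integrate \<open>Div\<close>, the space-time divergence of \<open>(\<Phi> H, \<Phi>)\<close>. The spatial part integrates to zero at each
  time because \<open>\<Phi>\<close> has compact support in \<open>Ob\<close>; the time part leaves the values at time 0 since
  \<open>\<Phi>\<close> vanishes at time \<open>T\<close>. Boundary contributions of the domain enter later, through a cutoff in
  \<open>\<Phi>\<close> whose gradient concentrates at the boundary.\<close>

lemma transport_identity:
  fixes \<Phi> Q :: "(real^'n) \<times> real \<Rightarrow> real" and P :: "(real^'n) \<times> real \<Rightarrow> real^'n"
    and H :: "real^'n \<Rightarrow> real^'n" and J :: "real^'n \<Rightarrow> real^'n^'n"
  assumes Ob: "open Ob" and S: "compact S" "S \<subseteq> Ob" and T: "0 < T"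
    and zero: "\<And>x t. x \<in> Ob - S \<Longrightarrow> t \<in> {0..T} \<Longrightarrow> \<Phi> (x, t) = 0"
    and cont: "continuous_on (Ob \<times> {0..T}) \<Phi>" "continuous_on (Ob \<times> {0..T}) P" "continuous_on (Ob \<times> {0..T}) Q"
    and der: "\<And>x t. x \<in> Ob \<Longrightarrow> t \<in> {0<..<T} \<Longrightarrow>
      (\<Phi> has_derivative (\<lambda>(h, k). P (x, t) \<bullet> h + Q (x, t) * k)) (at (x, t))"
    and fin: "\<And>x. x \<in> Ob \<Longrightarrow> \<Phi> (x, T) = 0"
    and H: "\<And>x. x \<in> Ob \<Longrightarrow> (H has_derivative (\<lambda>h. J x *v h)) (at x)"
    and Hc: "continuous_on Ob H" "continuous_on Ob J"
  defines "Div \<equiv> \<lambda>(x, t). Q (x, t) + P (x, t) \<bullet> H x + \<Phi> (x, t) * trace (J x)"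
  shows "integrable lborel (\<lambda>z. indicator (Ob \<times> {0<..<T}) z * Div z)"
    and "(\<integral>z. indicator (Ob \<times> {0<..<T}) z * Div z \<partial>lborel) = - (\<integral>x. indicator Ob x * \<Phi> (x, 0) \<partial>lborel)"
proof -
  have closedS: "closed S" using S by (simp add: compact_imp_closed)
  have PQ0: "P (x, t) = 0 \<and> Q (x, t) = 0" if "x \<in> Ob - S" "t \<in> {0<..<T}" for x t
  proof -
    have "((\<lambda>z. 0::real) has_derivative (\<lambda>(h, k). P (x, t) \<bullet> h + Q (x, t) * k)) (at (x, t))"
    proof (rule has_derivative_transform_within_open[OF der])
      show "open ((Ob - S) \<times> {0<..<T})" using Ob closedS by (intro open_Times open_Diff) auto
      show "\<And>z. z \<in> (Ob - S) \<times> {0<..<T} \<Longrightarrow> \<Phi> z = 0" using zero by auto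
    qed (use that in auto)
    then have eq: "(\<lambda>(h, k). P (x, t) \<bullet> h + Q (x, t) * k) = (\<lambda>z. 0)"
      using has_derivative_unique has_derivative_const by blast
    show ?thesis using fun_cong[OF eq, of "(P (x, t), 0)"] fun_cong[OF eq, of "(0, 1)"] by simp
  qed
  define B where "B = (\<lambda>(x, t). P (x, t) \<bullet> H x + \<Phi> (x, t) * trace (J x))"
  let ?I = "\<lambda>z. indicator (Ob \<times> {0<..<T}) z :: real"
  have HJ: "continuous_on (Ob \<times> {0..T}) (\<lambda>z. H (fst z))" "continuous_on (Ob \<times> {0..T}) (\<lambda>z. J (fst z))"
    by (rule continuous_on_compose2[OF Hc(1)], auto intro!: continuous_intros)
       (rule continuous_on_compose2[OF Hc(2)], auto intro!: continuous_intros)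
  have Bc: "continuous_on (Ob \<times> {0..T}) B"
  proof -
    have "continuous_on (Ob \<times> {0..T}) (\<lambda>z. P z \<bullet> H (fst z) + \<Phi> z * (\<Sum>i\<in>UNIV. J (fst z) $ i $ i))"
      by (intro continuous_intros cont HJ)
    then show ?thesis by (simp add: B_def split_beta trace_def)
  qed
  have Qi: "integrable lborel (\<lambda>z. ?I z * Q z)"
    by (rule integrable_supported_cylinder[OF Ob S cont(3)]) (use PQ0 in auto)
  have Bi: "integrable lborel (\<lambda>z. ?I z * B z)"
    by (rule integrable_supported_cylinder[OF Ob S Bc]) (use PQ0 zero in \<open>auto simp: B_def\<close>)
  have DivQB: "(\<lambda>z. ?I z * Div z) = (\<lambda>z. ?I z * Q z + ?I z * B z)"
    by (auto simp: Div_def B_def algebra_simps)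
  show "integrable lborel (\<lambda>z. ?I z * Div z)"
    unfolding DivQB using Qi Bi by (rule Bochner_Integration.integrable_add)
  have "(\<integral>z. ?I z * Q z \<partial>lborel) = (\<integral>x. (\<integral>t. ?I (x, t) * Q (x, t) \<partial>lborel) \<partial>lborel)"
    using lborel_pair.integral_fst'[of "\<lambda>z. ?I z * Q z"] Qi by (simp add: lborel_prod)
  also have "\<dots> = (\<integral>x. - (indicator Ob x * \<Phi> (x, 0)) \<partial>lborel)"
  proof (rule Bochner_Integration.integral_cong)
    fix x :: "real^'n"
    show "(\<integral>t. ?I (x, t) * Q (x, t) \<partial>lborel) = - (indicator Ob x * \<Phi> (x, 0))"
    proof (cases "x \<in> Ob")
      case True
      have cQ: "continuous_on {0..T} (\<lambda>t. Q (x, t))" "continuous_on {0..T} (\<lambda>t. \<Phi> (x, t))"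
        by (rule continuous_on_compose2[OF cont(3)], use True in \<open>auto intro!: continuous_intros\<close>)
           (rule continuous_on_compose2[OF cont(1)], use True in \<open>auto intro!: continuous_intros\<close>)
      have d: "((\<lambda>t. \<Phi> (x, t)) has_vector_derivative Q (x, t)) (at t)" if "t \<in> {0<..<T}" for t
      proof -
        have "((\<lambda>t. (x, t)) has_derivative (\<lambda>k. (0, k))) (at t)"
          by (auto intro!: derivative_eq_intros)
        from has_derivative_compose[OF this der[OF True that]]
        show ?thesis by (simp add: has_vector_derivative_def mult.commute)
      qed
      have "((\<lambda>t. Q (x, t)) has_integral (\<Phi> (x, T) - \<Phi> (x, 0))) {0..T}"
        using T cQ(2) d by (intro fundamental_theorem_of_calculus_interior) auto
      then have "integral {0..T} (\<lambda>t. Q (x, t)) = - \<Phi> (x, 0)"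
        using fin[OF True] by (simp add: integral_unique)
      moreover have "(LINT t:{0..T}|lborel. Q (x, t)) = integral {0..T} (\<lambda>t. Q (x, t))"
        by (intro set_borel_integral_eq_integral borel_integrable_atLeastAtMost' cQ)
      moreover have "(\<integral>t. ?I (x, t) * Q (x, t) \<partial>lborel) = (LINT t:{0..T}|lborel. Q (x, t))"
        unfolding set_lebesgue_integral_def
      proof (rule integral_cong_AE)
        have "(\<lambda>t. indicator {0<..<T} t *\<^sub>R Q (x, t)) \<in> borel_measurable borel"
          by (rule borel_measurable_continuous_on_indicator) (auto intro: continuous_on_subset[OF cQ(1)])
        then show "(\<lambda>t. ?I (x, t) * Q (x, t)) \<in> borel_measurable lborel"
          using True by (simp add: indicator_times)
        show "(\<lambda>t. indicator {0..T} t *\<^sub>R Q (x, t)) \<in> borel_measurable lborel"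
          using borel_measurable_continuous_on_indicator[OF _ cQ(1)] by simp
        show "AE t in lborel. ?I (x, t) * Q (x, t) = indicator {0..T} t *\<^sub>R Q (x, t)"
          using AE_lborel_singleton[of 0] AE_lborel_singleton[of T]
          by eventually_elim (use True in \<open>auto simp: indicator_def\<close>)
      qed
      ultimately show ?thesis using True by simp
    next
      case False
      then show ?thesis by (simp add: indicator_times)
    qed
  qed simp
  finally have Qeq: "(\<integral>z. ?I z * Q z \<partial>lborel) = - (\<integral>x. indicator Ob x * \<Phi> (x, 0) \<partial>lborel)" by simp
  have "(\<integral>z. ?I z * B z \<partial>lborel) = (\<integral>t. (\<integral>x. ?I (x, t) * B (x, t) \<partial>lborel) \<partial>lborel)"
    using lborel_pair.integral_snd[of "\<lambda>x t. ?I (x, t) * B (x, t)"] Bi by (simp add: lborel_prod split_beta')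
  also have "\<dots> = (\<integral>t. 0 \<partial>(lborel :: real measure))"
  proof (rule Bochner_Integration.integral_cong)
    fix t :: real
    show "(\<integral>x. ?I (x, t) * B (x, t) \<partial>lborel) = 0"
    proof (cases "t \<in> {0<..<T}")
      case False
      then show ?thesis by (simp add: indicator_times)
    next
      case True
      define K where "K i x = (if x \<in> Ob then \<Phi> (x, t) * H x $ i else 0)" for i x
      define K' where "K' i x h = (if x \<in> Ob then \<Phi> (x, t) * (J x *v h) $ i + (P (x, t) \<bullet> h) * H x $ i else 0)" for i x h
      have K'0: "K' i x h = 0" if "x \<notin> S" for i x h
        using that PQ0[of x t] zero[of x t] True by (auto simp: K'_def)
      have Kd: "(K i has_derivative K' i x) (at x)" for i x
      proof (cases "x \<in> Ob")
        case inO: True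
        have "((\<lambda>x. (x, t)) has_derivative (\<lambda>h. (h, 0))) (at x)"
          by (auto intro!: derivative_eq_intros)
        from has_derivative_compose[OF this der[OF inO True]]
        have d1: "((\<lambda>x. \<Phi> (x, t)) has_derivative (\<lambda>h. P (x, t) \<bullet> h)) (at x)" by simp
        have d2: "((\<lambda>x. H x $ i) has_derivative (\<lambda>h. (J x *v h) $ i)) (at x)"
          by (rule bounded_linear.has_derivative[OF bounded_linear_vec_nth H[OF inO]])
        have "K' i x = (\<lambda>h. \<Phi> (x, t) * (J x *v h) $ i + (P (x, t) \<bullet> h) * H x $ i)"
          using inO by (simp add: K'_def fun_eq_iff)
        then have "((\<lambda>x. \<Phi> (x, t) * H x $ i) has_derivative K' i x) (at x)"
          using has_derivative_mult[OF d1 d2] by simp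
        then show ?thesis
          by (rule has_derivative_transform_within_open[OF _ Ob inO]) (simp add: K_def)
      next
        case False
        then have "x \<in> - S" using S by auto
        have "K' i x = (\<lambda>h. 0)" using False by (auto simp: K'_def)
        moreover have "(K i has_derivative (\<lambda>h. 0)) (at x)"
          by (rule has_derivative_transform_within_open[OF has_derivative_const _ \<open>x \<in> - S\<close>])
             (use closedS zero[of _ t] True in \<open>auto simp: K_def\<close>)
        ultimately show ?thesis by simp
      qed
      have cst: "continuous_on S (\<lambda>x. \<Phi> (x, t))" "continuous_on S (\<lambda>x. P (x, t))"
        by (rule continuous_on_compose2[OF cont(1)], use True S in \<open>auto intro!: continuous_intros\<close>)
           (rule continuous_on_compose2[OF cont(2)], use True S in \<open>auto intro!: continuous_intros\<close>)
      have cHJ: "continuous_on S H" "continuous_on S J"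
        using Hc S continuous_on_subset by blast+
      have bnd: "\<exists>b. \<forall>x. \<bar>K' i x (axis i 1)\<bar> \<le> b" for i
      proof -
        have "continuous_on S (\<lambda>x. \<Phi> (x, t) * (\<Sum>j\<in>UNIV. J x $ i $ j * axis i 1 $ j) + (P (x, t) \<bullet> axis i 1) * H x $ i)"
          by (intro continuous_intros cst cHJ)
        then have "continuous_on S (\<lambda>x. K' i x (axis i 1))"
          by (rule continuous_on_eq) (use S in \<open>auto simp: K'_def matrix_vector_mult_def\<close>)
        then obtain b where b: "\<And>x. x \<in> S \<Longrightarrow> norm (K' i x (axis i 1)) \<le> b"
          using compact_imp_bounded[OF compact_continuous_image[OF _ S(1)]] by (metis bounded_iff imageI)
        have "\<bar>K' i x (axis i 1)\<bar> \<le> max b 0" for x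
          using b[of x] K'0[of x i] by (cases "x \<in> S") auto
        then show ?thesis by blast
      qed
      have K0: "K i x = 0" if "x \<notin> S" for i x using that zero[of x t] True by (auto simp: K_def)
      have Ki: "integrable lborel (\<lambda>x. K' i x (axis i 1))" "(\<integral>x. K' i x (axis i 1) \<partial>lborel) = 0" for i
        using bnd[of i] integral_directional_derivative_eq_0[OF Kd S(1) K0] by blast+
      have "?I (x, t) * B (x, t) = (\<Sum>i\<in>UNIV. K' i x (axis i 1))" for x
      proof (cases "x \<in> Ob")
        case inO: True
        have "(J x *v axis i 1) $ i = J x $ i $ i" for i
          by (simp add: matrix_vector_mult_def axis_def if_distrib cong: if_cong)
        then have "(\<Sum>i\<in>UNIV. K' i x (axis i 1)) = (\<Sum>i\<in>UNIV. \<Phi> (x, t) * J x $ i $ i + P (x, t) $ i * H x $ i)"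
          using inO by (simp add: K'_def inner_axis)
        then show ?thesis
          using inO True by (simp add: B_def trace_def inner_vec_def sum.distrib sum_distrib_left indicator_times)
      qed (simp add: K'_def indicator_times)
      then have "(\<integral>x. ?I (x, t) * B (x, t) \<partial>lborel) = (\<Sum>i\<in>UNIV. (\<integral>x. K' i x (axis i 1) \<partial>lborel))"
        using Ki(1) by (simp add: Bochner_Integration.integral_sum)
      then show ?thesis using Ki(2) by simp
    qed
  qed simp
  finally have Beq: "(\<integral>z. ?I z * B z \<partial>lborel) = 0" by simp
  show "(\<integral>z. ?I z * Div z \<partial>lborel) = - (\<integral>x. indicator Ob x * \<Phi> (x, 0) \<partial>lborel)"
    unfolding DivQB using Qi Bi Qeq Beq by simp
qed

section \<open>Derivatives that extend continuously to the boundary\<close>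

lemma C1_closure_grad_closure:
  fixes a :: "real^'n \<Rightarrow> real"
  assumes "C1_closure \<Omega> a" "open \<Omega>"
  shows "continuous_on (closure \<Omega>) (grad_closure \<Omega> a)"
    and "x \<in> \<Omega> \<Longrightarrow> (a has_derivative (\<lambda>h. grad_closure \<Omega> a x \<bullet> h)) (at x)"
proof -
  obtain f' :: "real^'n \<Rightarrow> ((real^'n) \<Rightarrow>\<^sub>L real)" where f': "continuous_on (closure \<Omega>) f'"
    "\<And>x. x \<in> \<Omega> \<Longrightarrow> (a has_derivative blinfun_apply (f' x)) (at x)"
    using assms(1) by (auto simp: C1_closure_def)
  have fr: "frechet_derivative a (at y) = blinfun_apply (f' y)" if "y \<in> \<Omega>" for y
    using frechet_derivative_at[OF f'(2)[OF that]] by simp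
  have eq: "partial_closure \<Omega> a i x = f' x (axis i 1)" if "x \<in> closure \<Omega>" for x i
    unfolding partial_closure_def
  proof (rule tendsto_Lim)
    have "x islimpt \<Omega>"
    proof (cases "x \<in> \<Omega>")
      case True
      then show ?thesis using assms(2) by (intro interior_limit_point) (simp add: interior_open)
    next
      case False
      then show ?thesis using that by (simp add: closure_def)
    qed
    then show "at x within \<Omega> \<noteq> bot" by (simp add: trivial_limit_within)
    have "(f' \<longlongrightarrow> f' x) (at x within closure \<Omega>)"
      using f'(1) that by (simp add: continuous_on)
    then have "(f' \<longlongrightarrow> f' x) (at x within \<Omega>)"
      by (rule tendsto_within_subset) (rule closure_subset)
    then have "((\<lambda>y. f' y (axis i 1)) \<longlongrightarrow> f' x (axis i 1)) (at x within \<Omega>)"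
      by (intro tendsto_intros)
    then show "((\<lambda>y. frechet_derivative a (at y) (axis i 1)) \<longlongrightarrow> f' x (axis i 1)) (at x within \<Omega>)"
      by (rule Lim_transform_eventually) (auto simp: eventually_at_filter fr)
  qed
  have "continuous_on (closure \<Omega>) (\<lambda>x. \<chi> i. f' x (axis i 1))"
    by (intro continuous_intros f'(1))
  then show "continuous_on (closure \<Omega>) (grad_closure \<Omega> a)"
    by (rule continuous_on_eq) (simp add: grad_closure_def eq)
  show "(a has_derivative (\<lambda>h. grad_closure \<Omega> a x \<bullet> h)) (at x)" if x: "x \<in> \<Omega>"
  proof -
    have "x \<in> closure \<Omega>" using x closure_subset by blast
    then have "blinfun_apply (f' x) h = grad_closure \<Omega> a x \<bullet> h" for h
      using linear_eq_inner_axis[OF has_derivative_linear[OF f'(2)[OF x]], of h]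
      by (simp add: grad_closure_def eq)
    then have "blinfun_apply (f' x) = (\<lambda>h. grad_closure \<Omega> a x \<bullet> h)" by (rule ext)
    then show ?thesis using f'(2)[OF x] by simp
  qed
qed

definition jac_closure :: "(real^'n) set \<Rightarrow> (real^'n \<Rightarrow> real^'n) \<Rightarrow> real^'n \<Rightarrow> real^'n^'n" where
  "jac_closure \<Omega> H x = (\<chi> j. grad_closure \<Omega> (\<lambda>y. H y $ j) x)"

lemma C1_closure_component:
  fixes H :: "real^'n \<Rightarrow> real^'n"
  assumes "C1_closure \<Omega> H"
  shows "C1_closure \<Omega> (\<lambda>y. H y $ j)"
proof -
  obtain f' :: "real^'n \<Rightarrow> ((real^'n) \<Rightarrow>\<^sub>L (real^'n))" where f': "continuous_on (closure \<Omega>) f'"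
    "\<And>x. x \<in> \<Omega> \<Longrightarrow> (H has_derivative blinfun_apply (f' x)) (at x)" and c: "continuous_on (closure \<Omega>) H"
    using assms by (auto simp: C1_closure_def)
  define L where "L = Blinfun (\<lambda>v::real^'n. v $ j)"
  have L: "blinfun_apply L = (\<lambda>v. v $ j)"
    unfolding L_def by (rule bounded_linear_Blinfun_apply) (rule bounded_linear_vec_nth)
  have "((\<lambda>y. H y $ j) has_derivative blinfun_apply (L o\<^sub>L f' x)) (at x)" if "x \<in> \<Omega>" for x
    using bounded_linear.has_derivative[OF bounded_linear_vec_nth f'(2)[OF that], of j]
    by (simp add: L blinfun_apply_blinfun_compose[abs_def])
  moreover have "continuous_on (closure \<Omega>) (\<lambda>x. L o\<^sub>L f' x)"
    by (intro continuous_intros f'(1))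
  moreover have "continuous_on (closure \<Omega>) (\<lambda>y. H y $ j)"
    using c by (intro continuous_intros)
  ultimately show ?thesis unfolding C1_closure_def by blast
qed

lemma C1_closure_jac_closure:
  fixes H :: "real^'n \<Rightarrow> real^'n"
  assumes "C1_closure \<Omega> H" "open \<Omega>"
  shows "continuous_on (closure \<Omega>) (jac_closure \<Omega> H)"
    and "x \<in> \<Omega> \<Longrightarrow> (H has_derivative (\<lambda>h. jac_closure \<Omega> H x *v h)) (at x)"
proof -
  show "continuous_on (closure \<Omega>) (jac_closure \<Omega> H)"
    unfolding jac_closure_def
    by (intro continuous_intros C1_closure_grad_closure(1) C1_closure_component assms)
  assume x: "x \<in> \<Omega>"
  obtain f' where f': "(H has_derivative f') (at x)"
    using assms(1) x by (auto simp: C1_closure_def)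
  have "f' h = jac_closure \<Omega> H x *v h" for h
  proof (rule vec_eq_iff[THEN iffD2], rule allI)
    fix j
    have 1: "((\<lambda>y. H y $ j) has_derivative (\<lambda>h. f' h $ j)) (at x)"
      by (rule bounded_linear.has_derivative[OF bounded_linear_vec_nth f'])
    have 2: "((\<lambda>y. H y $ j) has_derivative (\<lambda>h. grad_closure \<Omega> (\<lambda>y. H y $ j) x \<bullet> h)) (at x)"
      by (rule C1_closure_grad_closure(2)[OF C1_closure_component[OF assms(1)] assms(2) x])
    show "f' h $ j = (jac_closure \<Omega> H x *v h) $ j"
      using fun_cong[OF has_derivative_unique[OF 1 2], of h]
      by (simp add: jac_closure_def matrix_vector_mul_component)
  qed
  then have "f' = (\<lambda>h. jac_closure \<Omega> H x *v h)" by (rule ext)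
  then show "(H has_derivative (\<lambda>h. jac_closure \<Omega> H x *v h)) (at x)" using f' by simp
qed

lemma norm_matrix_vector_mult_le: "norm (A *v h) \<le> norm A * norm (h :: real^'n)"
  for A :: "real^'n^'m"
proof -
  have "norm (A *v h) = L2_set (\<lambda>j. A $ j \<bullet> h) UNIV"
    by (simp add: norm_vec_def matrix_vector_mul_component L2_set_def)
  also have "\<dots> \<le> L2_set (\<lambda>j. norm (A $ j) * norm h) UNIV"
    unfolding L2_set_def
    by (intro real_sqrt_le_mono sum_mono) (metis Cauchy_Schwarz_ineq2 abs_ge_zero power2_abs power_mono)
  also have "\<dots> = norm A * norm h"
    by (subst L2_set_left_distrib[symmetric]) (simp_all add: norm_vec_def)
  finally show ?thesis .
qed

lemma abs_trace_le: "\<bar>trace A\<bar> \<le> real CARD('n) * norm A"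
  for A :: "real^'n^'n"
proof -
  have "\<bar>trace A\<bar> \<le> (\<Sum>i\<in>UNIV. \<bar>A $ i $ i\<bar>)" unfolding trace_def by (rule sum_abs)
  also have "\<dots> \<le> (\<Sum>i\<in>(UNIV::'n set). norm A)"
  proof (rule sum_mono)
    fix i
    show "\<bar>A $ i $ i\<bar> \<le> norm A"
      using component_le_norm_cart[of "A $ i" i] Finite_Cartesian_Product.norm_nth_le[of A i] by linarith
  qed
  finally show ?thesis by simp
qed

lemma C1_norm_bounds:
  fixes H :: "real^'n \<Rightarrow> real^'n"
  assumes "C1_closure \<Omega> H" "open \<Omega>" "bounded \<Omega>" "C1_norm \<Omega> H \<le> M" "x \<in> closure \<Omega>"
  shows "norm (H x) \<le> M" and "norm (jac_closure \<Omega> H x) \<le> M"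
proof -
  have comp: "compact (closure \<Omega>)" using assms by simp
  have c: "continuous_on (closure \<Omega>) H" using assms by (simp add: C1_closure_def)
  have fro: "sqrt (\<Sum>j\<in>UNIV. \<Sum>k\<in>UNIV. (partial_closure \<Omega> (\<lambda>y. H y $ j) k x)\<^sup>2) = norm (jac_closure \<Omega> H x)" for x
    by (simp add: norm_vec_def L2_set_def jac_closure_def grad_closure_def sum_nonneg)
  have bdd: "bdd_above ((\<lambda>x. norm (g x)) ` closure \<Omega>)" if "continuous_on (closure \<Omega>) g" for g :: "real^'n \<Rightarrow> 'b::real_normed_vector"
    using comp that by (intro bounded_imp_bdd_above compact_imp_bounded compact_continuous_image continuous_intros)
  have 1: "norm (H x) \<le> (SUP x\<in>closure \<Omega>. norm (H x))"
    using bdd[OF c] assms(5) by (intro cSUP_upper)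
  have 2: "norm (jac_closure \<Omega> H x) \<le> (SUP x\<in>closure \<Omega>. norm (jac_closure \<Omega> H x))"
    using bdd[OF C1_closure_jac_closure(1)[OF assms(1,2)]] assms(5) by (intro cSUP_upper)
  have "(SUP x\<in>closure \<Omega>. norm (H x)) + (SUP x\<in>closure \<Omega>. norm (jac_closure \<Omega> H x)) \<le> M"
    using assms(4) unfolding C1_norm_def fro .
  then show "norm (H x) \<le> M" "norm (jac_closure \<Omega> H x) \<le> M"
    using 1 2 norm_ge_zero[of "H x"] norm_ge_zero[of "jac_closure \<Omega> H x"] by linarith+
qed

text \<open>The property of being continuously differentiable up to the boundary of a space-time cylinder, with the
  space gradient \<open>P\<close> and the time derivative \<open>Q\<close> named together with their continuous extensions.\<close>

definition spacetime_C1 ::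
  "(real^'n) set \<Rightarrow> real \<Rightarrow> ((real^'n) \<times> real \<Rightarrow> real) \<Rightarrow> ((real^'n) \<times> real \<Rightarrow> real^'n) \<Rightarrow>
    ((real^'n) \<times> real \<Rightarrow> real) \<Rightarrow> bool" where
  "spacetime_C1 \<Omega> T v P Q \<longleftrightarrow>
    continuous_on (closure \<Omega> \<times> {0..T}) v \<and> continuous_on (closure \<Omega> \<times> {0..T}) P \<and>
    continuous_on (closure \<Omega> \<times> {0..T}) Q \<and>
    (\<forall>x\<in>\<Omega>. \<forall>t\<in>{0<..<T}. (v has_derivative (\<lambda>(h, k). P (x, t) \<bullet> h + Q (x, t) * k)) (at (x, t)))"

lemma C1_closure_spacetime:
  fixes v :: "(real^'n) \<times> real \<Rightarrow> real"
  assumes "C1_closure (\<Omega> \<times> {0<..<T}) v" "0 < T"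
  shows "\<exists>P Q. spacetime_C1 \<Omega> T v P Q"
proof -
  have cl: "closure (\<Omega> \<times> {0<..<T}) = closure \<Omega> \<times> {0..T}"
    using assms(2) by (simp add: closure_Times)
  obtain f' :: "(real^'n) \<times> real \<Rightarrow> (((real^'n) \<times> real) \<Rightarrow>\<^sub>L real)" where f': "continuous_on (closure \<Omega> \<times> {0..T}) f'"
    "\<And>z. z \<in> \<Omega> \<times> {0<..<T} \<Longrightarrow> (v has_derivative blinfun_apply (f' z)) (at z)"
    and c: "continuous_on (closure \<Omega> \<times> {0..T}) v"
    using assms(1) by (auto simp: C1_closure_def cl)
  define P where "P z = (\<chi> i. f' z (axis i 1, 0))" for z
  define Q where "Q z = f' z (0, 1)" for z
  have "continuous_on (closure \<Omega> \<times> {0..T}) P" "continuous_on (closure \<Omega> \<times> {0..T}) Q"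
    unfolding P_def Q_def by (intro continuous_intros f'(1))+
  moreover have "(v has_derivative (\<lambda>(h, k). P (x, t) \<bullet> h + Q (x, t) * k)) (at (x, t))"
    if "x \<in> \<Omega>" "t \<in> {0<..<T}" for x t
  proof -
    have lin: "linear (\<lambda>h. blinfun_apply (f' (x, t)) (h, 0))"
    proof (rule linearI)
      fix b c :: "real^'n" and r :: real
      have "(b + c, 0::real) = (b, 0) + (c, 0)" "(r *\<^sub>R b, 0::real) = r *\<^sub>R (b, 0)" by simp_all
      then show "blinfun_apply (f' (x, t)) (b + c, 0) = blinfun_apply (f' (x, t)) (b, 0) + blinfun_apply (f' (x, t)) (c, 0)"
        "blinfun_apply (f' (x, t)) (r *\<^sub>R b, 0) = r *\<^sub>R blinfun_apply (f' (x, t)) (b, 0)"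
        by (simp_all only: blinfun.add_right blinfun.scaleR_right)
    qed
    have "blinfun_apply (f' (x, t)) (h, k) = P (x, t) \<bullet> h + Q (x, t) * k" for h k
    proof -
      have "(h, k) = (h, 0) + k *\<^sub>R (0, 1)" by simp
      then have "blinfun_apply (f' (x, t)) (h, k) = blinfun_apply (f' (x, t)) (h, 0) + k * blinfun_apply (f' (x, t)) (0, 1)"
        by (metis blinfun.add_right blinfun.scaleR_right real_scaleR_def)
      then show ?thesis
        using linear_eq_inner_axis[OF lin, of h] by (simp add: P_def Q_def mult.commute)
    qed
    then have "blinfun_apply (f' (x, t)) = (\<lambda>(h, k). P (x, t) \<bullet> h + Q (x, t) * k)"
      by (simp add: fun_eq_iff)
    then show ?thesis using f'(2)[of "(x, t)"] that by simp
  qed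
  ultimately show ?thesis using c unfolding spacetime_C1_def by blast
qed

context
  fixes \<Omega> :: "(real^'n) set" and T :: real and v :: "(real^'n) \<times> real \<Rightarrow> real"
    and P :: "(real^'n) \<times> real \<Rightarrow> real^'n" and Q :: "(real^'n) \<times> real \<Rightarrow> real"
  assumes C1: "spacetime_C1 \<Omega> T v P Q"
begin

lemma spacetime_C1_deriv_x:
  assumes "x \<in> \<Omega>" "t \<in> {0<..<T}"
  shows "((\<lambda>y. v (y, t)) has_derivative (\<lambda>h. P (x, t) \<bullet> h)) (at x)"
proof -
  have "((\<lambda>y. (y, t)) has_derivative (\<lambda>h. (h, 0))) (at x)"
    by (auto intro!: derivative_eq_intros)
  from has_derivative_compose[OF this] show ?thesis
    using C1 assms unfolding spacetime_C1_def by fastforce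
qed

lemma spacetime_C1_grad_x:
  assumes "x \<in> \<Omega>" "t \<in> {0<..<T}"
  shows "grad_x v (x, t) = P (x, t)"
  using grad_eqI[OF spacetime_C1_deriv_x[OF assms]] by (simp add: grad_x_def)

lemma spacetime_C1_deriv_t:
  assumes "x \<in> \<Omega>" "t \<in> {0<..<T}"
  shows "((\<lambda>s. v (x, s)) has_real_derivative Q (x, t)) (at t)"
proof -
  have "((\<lambda>s. (x, s)) has_derivative (\<lambda>k. (0, k))) (at t)"
    by (auto intro!: derivative_eq_intros)
  moreover have "(v has_derivative (\<lambda>(h, k). P (x, t) \<bullet> h + Q (x, t) * k)) (at (x, t))"
    using C1 assms unfolding spacetime_C1_def by blast
  ultimately have "((\<lambda>s. v (x, s)) has_derivative (\<lambda>k. (\<lambda>(h, k). P (x, t) \<bullet> h + Q (x, t) * k) (0, k))) (at t)"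
    by (rule has_derivative_compose)
  then show ?thesis by (simp add: has_field_derivative_def)
qed

lemma spacetime_C1_dt:
  assumes "x \<in> \<Omega>" "t \<in> {0<..<T}"
  shows "dt T v (x, t) = Q (x, t)"
  unfolding dt_def using spacetime_C1_deriv_t[OF assms] assms
  by (auto intro!: vector_derivative_at_within_ivl simp: has_real_derivative_iff_has_vector_derivative)

lemma spacetime_C1_cont:
  "continuous_on (closure \<Omega> \<times> {0..T}) v" "continuous_on (closure \<Omega> \<times> {0..T}) P"
  "continuous_on (closure \<Omega> \<times> {0..T}) Q"
  using C1 by (auto simp: spacetime_C1_def)

end

text \<open>Schwarz: write \<open>u\<close> as the time integral of its time derivative and differentiate under the
  integral.\<close>

lemma deriv_t_grad_x:
  fixes u v :: "(real^'n) \<times> real \<Rightarrow> real"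
  assumes u: "spacetime_C1 \<Omega> T u Pu Qu" and v: "spacetime_C1 \<Omega> T v P Q"
    and uv: "\<And>x t. x \<in> \<Omega> \<Longrightarrow> t \<in> {0<..<T} \<Longrightarrow> Qu (x, t) = v (x, t)"
    and "open \<Omega>" "x \<in> \<Omega>" and t: "t \<in> {0<..<T}"
  shows "((\<lambda>s. Pu (x, s)) has_vector_derivative P (x, t)) (at t)"
proof -
  (* A compact time interval around t on which everything is continuous, away from both ends. *)
  define a where "a = t / 2"
  define b where "b = (t + T) / 2"
  have ab: "0 < a" "a < t" "t < b" "b < T" using t by (auto simp: a_def b_def)
  then have sub: "{a..b} \<subseteq> {0<..<T}" by auto
  obtain d where d: "d > 0" "ball x d \<subseteq> \<Omega>" using \<open>open \<Omega>\<close> \<open>x \<in> \<Omega>\<close> openE by blast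
  have cP: "continuous_on {a..b} (\<lambda>\<tau>. P (x, \<tau>))"
    by (rule continuous_on_compose2[OF spacetime_C1_cont(2)[OF v]])
       (use ab \<open>x \<in> \<Omega>\<close> closure_subset in \<open>auto intro!: continuous_intros\<close>)
  have comp: "Pu (x, s) \<bullet> e = Pu (x, a) \<bullet> e + integral {a..s} (\<lambda>\<tau>. P (x, \<tau>) \<bullet> e)"
    if s: "s \<in> {a..b}" and e: "norm e = 1" for s e
  proof -
    have inO: "x + \<sigma> *\<^sub>R e \<in> \<Omega>" if "\<sigma> \<in> ball 0 d" for \<sigma>
      using that d e by (auto simp: dist_norm)
    have lin: "((\<lambda>\<sigma>. w (x + \<sigma> *\<^sub>R e, r)) has_real_derivative Pw (x + \<sigma> *\<^sub>R e, r) \<bullet> e) (at \<sigma>)"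
      if "spacetime_C1 \<Omega> T w Pw Qw" "\<sigma> \<in> ball 0 d" "r \<in> {a..b}" for w Pw Qw \<sigma> r
    proof -
      have 1: "((\<lambda>\<sigma>::real. x + \<sigma> *\<^sub>R e) has_derivative (\<lambda>h. h *\<^sub>R e)) (at \<sigma>)"
        by (auto intro!: derivative_eq_intros)
      have 2: "((\<lambda>y. w (y, r)) has_derivative (\<lambda>h. Pw (x + \<sigma> *\<^sub>R e, r) \<bullet> h)) (at (x + \<sigma> *\<^sub>R e))"
        using that sub inO by (intro spacetime_C1_deriv_x) auto
      show ?thesis
        using has_derivative_compose[OF 1 2] by (simp add: has_field_derivative_def mult.commute mult_commute_abs)
    qed
    have cv: "continuous_on (ball 0 d \<times> {a..s}) (\<lambda>(\<sigma>, \<tau>). w (x + \<sigma> *\<^sub>R e, \<tau>))"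
      if "continuous_on (closure \<Omega> \<times> {0..T}) w" for w :: "(real^'n) \<times> real \<Rightarrow> 'c::topological_space"
      unfolding split_beta
      by (rule continuous_on_compose2[OF that])
         (use inO closure_subset s ab in \<open>fastforce intro!: continuous_intros\<close>)+
    have int: "u (x + \<sigma> *\<^sub>R e, s) = u (x + \<sigma> *\<^sub>R e, a) + integral {a..s} (\<lambda>\<tau>. v (x + \<sigma> *\<^sub>R e, \<tau>))"
      if "\<sigma> \<in> ball 0 d" for \<sigma>
    proof -
      have "((\<lambda>\<tau>. v (x + \<sigma> *\<^sub>R e, \<tau>)) has_integral (u (x + \<sigma> *\<^sub>R e, s) - u (x + \<sigma> *\<^sub>R e, a))) {a..s}"
      proof (rule fundamental_theorem_of_calculus)
        fix \<tau> assume "\<tau> \<in> {a..s}"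
        then have "\<tau> \<in> {0<..<T}" using s ab by auto
        then show "((\<lambda>\<tau>. u (x + \<sigma> *\<^sub>R e, \<tau>)) has_vector_derivative v (x + \<sigma> *\<^sub>R e, \<tau>)) (at \<tau> within {a..s})"
          using spacetime_C1_deriv_t[OF u inO[OF that]] uv[OF inO[OF that]]
          by (metis has_real_derivative_iff_has_vector_derivative has_vector_derivative_at_within)
      qed (use s in auto)
      then show ?thesis by (simp add: integral_unique)
    qed
    have "((\<lambda>\<sigma>. integral (cbox a s) (\<lambda>\<tau>. v (x + \<sigma> *\<^sub>R e, \<tau>))) has_field_derivative
        integral (cbox a s) (\<lambda>\<tau>. P (x + 0 *\<^sub>R e, \<tau>) \<bullet> e)) (at 0 within ball 0 d)"
    proof (rule leibniz_rule_field_derivative[where f = "\<lambda>\<sigma> \<tau>. v (x + \<sigma> *\<^sub>R e, \<tau>)"])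
      show "((\<lambda>\<sigma>. v (x + \<sigma> *\<^sub>R e, \<tau>)) has_field_derivative P (x + \<sigma> *\<^sub>R e, \<tau>) \<bullet> e) (at \<sigma> within ball 0 d)"
        if "\<sigma> \<in> ball 0 d" "\<tau> \<in> cbox a s" for \<sigma> \<tau>
        using lin[OF v that(1), of \<tau>] that(2) s by (auto intro: has_field_derivative_at_within)
      show "(\<lambda>\<tau>. v (x + \<sigma> *\<^sub>R e, \<tau>)) integrable_on cbox a s" if "\<sigma> \<in> ball 0 d" for \<sigma>
      proof (rule integrable_continuous)
        show "continuous_on (cbox a s) (\<lambda>\<tau>. v (x + \<sigma> *\<^sub>R e, \<tau>))"
          by (rule continuous_on_compose2[OF spacetime_C1_cont(1)[OF v]])
             (use inO[OF that] closure_subset s ab in \<open>fastforce intro!: continuous_intros\<close>)+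
      qed
      have "continuous_on (ball 0 d \<times> {a..s}) (\<lambda>z. (case z of (\<sigma>, \<tau>) \<Rightarrow> P (x + \<sigma> *\<^sub>R e, \<tau>)) \<bullet> e)"
        by (intro continuous_intros cv spacetime_C1_cont(2)[OF v])
      then show "continuous_on (ball 0 d \<times> cbox a s) (\<lambda>(\<sigma>, \<tau>). P (x + \<sigma> *\<^sub>R e, \<tau>) \<bullet> e)"
        by (simp add: split_beta)
    qed (use d in auto)
    then have I: "((\<lambda>\<sigma>. integral {a..s} (\<lambda>\<tau>. v (x + \<sigma> *\<^sub>R e, \<tau>))) has_real_derivative
        integral {a..s} (\<lambda>\<tau>. P (x, \<tau>) \<bullet> e)) (at 0)"
      using d at_within_open[of "0::real" "ball 0 d"] by simp
    have "0 \<in> ball (0::real) d" using d by simp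
    have A: "((\<lambda>\<sigma>. u (x + \<sigma> *\<^sub>R e, a)) has_real_derivative Pu (x, a) \<bullet> e) (at 0)"
      using lin[OF u \<open>0 \<in> ball 0 d\<close>, of a] ab by simp
    have Sd: "((\<lambda>\<sigma>. u (x + \<sigma> *\<^sub>R e, s)) has_real_derivative Pu (x, s) \<bullet> e) (at 0)"
      using lin[OF u \<open>0 \<in> ball 0 d\<close>, of s] s by simp
    have "((\<lambda>\<sigma>. u (x + \<sigma> *\<^sub>R e, s)) has_real_derivative
        Pu (x, a) \<bullet> e + integral {a..s} (\<lambda>\<tau>. P (x, \<tau>) \<bullet> e)) (at 0)"
      by (rule has_field_derivative_transform_within_open[OF DERIV_add[OF A I] open_ball \<open>0 \<in> ball 0 d\<close>])
         (simp add: int)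
    then show ?thesis by (rule DERIV_unique[OF Sd])
  qed
  have eq: "Pu (x, s) = Pu (x, a) + integral {a..s} (\<lambda>\<tau>. P (x, \<tau>))" if s: "s \<in> {a..b}" for s
  proof (rule vec_eq_iff[THEN iffD2], rule allI)
    fix i
    have "(\<lambda>\<tau>. P (x, \<tau>)) integrable_on {a..s}"
      by (rule integrable_continuous_interval) (rule continuous_on_subset[OF cP], use s in auto)
    then show "Pu (x, s) $ i = (Pu (x, a) + integral {a..s} (\<lambda>\<tau>. P (x, \<tau>))) $ i"
      using comp[OF s, of "axis i 1"]
      by (simp only: integral_component_eq_cart norm_axis_1 inner_axis inner_real_def mult_1_right vector_add_component)
  qed
  have "((\<lambda>s. integral {a..s} (\<lambda>\<tau>. P (x, \<tau>))) has_vector_derivative P (x, t)) (at t within {a..b})"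
    using cP ab by (intro integral_has_vector_derivative) auto
  then have "((\<lambda>s. integral {a..s} (\<lambda>\<tau>. P (x, \<tau>))) has_vector_derivative P (x, t)) (at t)"
    using ab by (simp add: at_within_Icc_at)
  then have "((\<lambda>s. Pu (x, a) + integral {a..s} (\<lambda>\<tau>. P (x, \<tau>))) has_vector_derivative P (x, t)) (at t)"
    by (auto intro!: derivative_eq_intros)
  then show ?thesis
  proof (rule has_vector_derivative_transform_within_open[where S = "{a<..<b}"])
    show "Pu (x, a) + integral {a..s} (\<lambda>\<tau>. P (x, \<tau>)) = Pu (x, s)" if "s \<in> {a<..<b}" for s
      using that by (intro eq[symmetric]) auto
  qed (use ab in auto)
qed


text \<open>Differentiating the equation in time at a fixed point of space gives a transport equation for the time
  derivative. The mixed derivative that appears there is the one whose norm the hypotheses control.\<close>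

lemma solution_time_derivative_equation:
  assumes sol: "solution \<Omega> T p H a u" and "open \<Omega>" "0 < T"
    and v: "spacetime_C1 \<Omega> T (dt T u) P Q"
    and x: "x \<in> \<Omega>" and t: "t \<in> {0<..<T}"
  shows "dt T (grad_x u) (x, t) = P (x, t)"
    and "Q (x, t) + H x \<bullet> P (x, t) + p x * dt T u (x, t) = 0"
proof -
  obtain Pu Qu where u: "spacetime_C1 \<Omega> T u Pu Qu"
    using sol C1_closure_spacetime[OF _ \<open>0 < T\<close>, of \<Omega> u] by (auto simp: solution_def)
  have uv: "Qu (y, s) = dt T u (y, s)" if "y \<in> \<Omega>" "s \<in> {0<..<T}" for y s
    using spacetime_C1_dt[OF u that] by simp
  have gx: "grad_x u (x, s) = Pu (x, s)" if "s \<in> {0<..<T}" for s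
    using spacetime_C1_grad_x[OF u x that] .
  have "((\<lambda>s. Pu (x, s)) has_vector_derivative P (x, t)) (at t)"
    by (rule deriv_t_grad_x[OF u v uv \<open>open \<Omega>\<close> x t])
  then have g: "((\<lambda>s. grad_x u (x, s)) has_vector_derivative P (x, t)) (at t)"
    by (rule has_vector_derivative_transform_within_open[where S = "{0<..<T}"]) (use t gx in auto)
  then show "dt T (grad_x u) (x, t) = P (x, t)"
    unfolding dt_def using t by (auto intro!: vector_derivative_at_within_ivl)
  have Hg: "((\<lambda>s. H x \<bullet> grad_x u (x, s)) has_real_derivative H x \<bullet> P (x, t)) (at t)"
    using bounded_linear.has_vector_derivative[OF bounded_linear_inner_right g, of "H x"]
    by (simp add: has_real_derivative_iff_has_vector_derivative)
  have ut: "((\<lambda>s. u (x, s)) has_real_derivative dt T u (x, t)) (at t)"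
    using spacetime_C1_deriv_t[OF u x t] uv[OF x t] by simp
  have vt: "((\<lambda>s. dt T u (x, s)) has_real_derivative Q (x, t)) (at t)"
    by (rule spacetime_C1_deriv_t[OF v x t])
  have "((\<lambda>s. dt T u (x, s) + H x \<bullet> grad_x u (x, s) + p x * u (x, s)) has_real_derivative
      Q (x, t) + H x \<bullet> P (x, t) + p x * dt T u (x, t)) (at t)"
    by (intro DERIV_add vt Hg DERIV_cmult ut)
  moreover have "((\<lambda>s. dt T u (x, s) + H x \<bullet> grad_x u (x, s) + p x * u (x, s)) has_real_derivative 0) (at t)"
    by (rule has_field_derivative_transform_within_open[OF DERIV_const[of 0] open_greaterThanLessThan t])
       (use sol x in \<open>auto simp: solution_def\<close>)
  ultimately show "Q (x, t) + H x \<bullet> P (x, t) + p x * dt T u (x, t) = 0"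
    by (rule DERIV_unique)
qed

lemma tendsto_at_right_time:
  fixes w :: "(real^'n) \<times> real \<Rightarrow> 'b::topological_space"
  assumes "continuous_on (closure \<Omega> \<times> {0..T}) w" "x \<in> closure \<Omega>" "0 < T"
  shows "((\<lambda>s. w (x, s)) \<longlongrightarrow> w (x, 0)) (at_right 0)"
proof (rule continuous_on_tendsto_compose[OF assms(1)])
  show "((\<lambda>s. (x, s)) \<longlongrightarrow> (x, 0)) (at_right 0)" by (intro tendsto_intros)
  have "\<forall>\<^sub>F s in at_right 0. 0 < s \<and> s < T"
    using assms(3) by (auto simp: eventually_at_right[of 0 T])
  then show "\<forall>\<^sub>F s in at_right 0. (x, s) \<in> closure \<Omega> \<times> {0..T}"
    by (rule eventually_mono) (use assms in auto)
qed (use assms in auto)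

text \<open>On a small ball around \<open>x\<close> and for small positive times, \<open>u(., s) - P (x, 0) \<bullet> (.)\<close> has a small
  gradient. The resulting Lipschitz bound survives the limit \<open>s \<rightarrow> 0\<close> and says that \<open>P (x, 0)\<close> is the
  derivative of the initial value at \<open>x\<close>.\<close>

lemma gradient_at_initial_time:
  fixes u :: "(real^'n) \<times> real \<Rightarrow> real"
  assumes u: "spacetime_C1 \<Omega> T u P Q" and "open \<Omega>" "0 < T" "x \<in> \<Omega>"
    and a: "\<And>x. x \<in> \<Omega> \<Longrightarrow> u (x, 0) = a x" "(a has_derivative (\<lambda>h. A \<bullet> h)) (at x)"
  shows "P (x, 0) = A"
proof -
  have "(a has_derivative (\<lambda>h. P (x, 0) \<bullet> h)) (at x)"
    unfolding has_derivative_at_alt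
  proof (intro conjI allI impI)
    show "bounded_linear (\<lambda>h. P (x, 0) \<bullet> h)" by (rule bounded_linear_inner_right)
    fix e :: real assume "0 < e"
    have xc: "x \<in> closure \<Omega>" using \<open>x \<in> \<Omega>\<close> closure_subset by blast
    obtain d1 where d1: "d1 > 0" "ball x d1 \<subseteq> \<Omega>" using \<open>open \<Omega>\<close> \<open>x \<in> \<Omega>\<close> openE by blast
    have "(x, 0) \<in> closure \<Omega> \<times> {0..T}" using xc \<open>0 < T\<close> by auto
    then obtain d2 where d2: "d2 > 0" "\<And>z. z \<in> closure \<Omega> \<times> {0..T} \<Longrightarrow> dist z (x, 0) < d2 \<Longrightarrow> dist (P z) (P (x, 0)) < e"
      using spacetime_C1_cont(2)[OF u] \<open>0 < e\<close> unfolding continuous_on_iff by metis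
    define d where "d = min d1 (min (d2 / 2) T)"
    have d: "0 < d" "d \<le> d1" "d \<le> d2 / 2" "d \<le> T" using d1 d2 \<open>0 < T\<close> by (auto simp: d_def)
    have near: "norm (u (y, s) - u (x, s) - P (x, 0) \<bullet> (y - x)) \<le> e * norm (y - x)"
      if "norm (y - x) < d" "0 < s" "s < d" for y s
    proof -
      have "norm ((u (y, s) - P (x, 0) \<bullet> y) - (u (x, s) - P (x, 0) \<bullet> x)) \<le> e * norm (y - x)"
      proof (rule differentiable_bound[where S = "ball x d" and f' = "\<lambda>z h. (P (z, s) - P (x, 0)) \<bullet> h"])
        fix z assume z: "z \<in> ball x d"
        then have zO: "z \<in> \<Omega>" using d1 d by auto
        have "((\<lambda>y. u (y, s)) has_derivative (\<lambda>h. P (z, s) \<bullet> h)) (at z)"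
          using that d by (intro spacetime_C1_deriv_x[OF u zO]) auto
        from has_derivative_at_withinI[OF this, of "ball x d"]
        show "((\<lambda>y. u (y, s) - P (x, 0) \<bullet> y) has_derivative (\<lambda>h. (P (z, s) - P (x, 0)) \<bullet> h)) (at z within ball x d)"
          by (auto intro!: derivative_eq_intros simp: inner_diff_left)
        have "dist (z, s) (x, 0) \<le> dist z x + \<bar>s\<bar>"
          using norm_Pair_le[of "z - x" s] by (simp add: dist_norm)
        also have "\<dots> < d2" using z that d by (simp add: dist_commute)
        finally have "dist (P (z, s)) (P (x, 0)) < e"
          using d2(2)[of "(z, s)"] zO closure_subset that d by fastforce
        then have le: "norm (P (z, s) - P (x, 0)) \<le> e" by (simp add: dist_norm)
        show "onorm (\<lambda>h. (P (z, s) - P (x, 0)) \<bullet> h) \<le> e"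
        proof (rule onorm_bound)
          fix h
          have "norm ((P (z, s) - P (x, 0)) \<bullet> h) \<le> norm (P (z, s) - P (x, 0)) * norm h"
            using Cauchy_Schwarz_ineq2 by auto
          also have "\<dots> \<le> e * norm h" using le by (intro mult_right_mono) auto
          finally show "norm ((P (z, s) - P (x, 0)) \<bullet> h) \<le> e * norm h" .
        qed (use \<open>0 < e\<close> in simp)
      qed (use that d in \<open>auto simp: dist_norm norm_minus_commute\<close>)
      then show ?thesis by (simp add: inner_diff_right algebra_simps)
    qed
    have "norm (a y - a x - P (x, 0) \<bullet> (y - x)) \<le> e * norm (y - x)" if y: "norm (y - x) < d" for y
    proof -
      have yO: "y \<in> \<Omega>" using y d1 d by (auto simp: dist_norm norm_minus_commute)
      then have yc: "y \<in> closure \<Omega>" using closure_subset by blast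
      have "((\<lambda>s. norm (u (y, s) - u (x, s) - P (x, 0) \<bullet> (y - x))) \<longlongrightarrow>
          norm (u (y, 0) - u (x, 0) - P (x, 0) \<bullet> (y - x))) (at_right 0)"
        by (intro tendsto_intros tendsto_at_right_time[OF spacetime_C1_cont(1)[OF u]] yc xc \<open>0 < T\<close>)
      moreover have "\<forall>\<^sub>F s in at_right 0. 0 < s \<and> s < d"
        using d by (auto simp: eventually_at_right[of 0 d])
      then have "\<forall>\<^sub>F s in at_right 0. norm (u (y, s) - u (x, s) - P (x, 0) \<bullet> (y - x)) \<le> e * norm (y - x)"
        by (rule eventually_mono) (use near y in auto)
      ultimately have "norm (u (y, 0) - u (x, 0) - P (x, 0) \<bullet> (y - x)) \<le> e * norm (y - x)"
        by (intro tendsto_upperbound) auto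
      then show ?thesis using a(1) yO \<open>x \<in> \<Omega>\<close> by simp
    qed
    then show "\<exists>d>0. \<forall>y. norm (y - x) < d \<longrightarrow> norm (a y - a x - P (x, 0) \<bullet> (y - x)) \<le> e * norm (y - x)"
      using d(1) by blast
  qed
  then have "(\<lambda>h. P (x, 0) \<bullet> h) = (\<lambda>h. A \<bullet> h)"
    using a(2) by (rule has_derivative_unique)
  then have "P (x, 0) \<bullet> (P (x, 0) - A) = A \<bullet> (P (x, 0) - A)" by meson
  then have "(P (x, 0) - A) \<bullet> (P (x, 0) - A) = 0" by (simp add: inner_diff_left)
  then show ?thesis by simp
qed

text \<open>The equation itself, read at time 0 by continuity. For two solutions with the same initial value, the
  difference of the time derivatives at time 0 is therefore \<open>(H2 - H1) \<bullet> \<nabla>a\<close>.\<close>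

lemma solution_initial_time_derivative:
  assumes sol: "solution \<Omega> T p H a u" and "open \<Omega>" "0 < T"
    and v: "spacetime_C1 \<Omega> T (dt T u) P Q" and a: "C1_closure \<Omega> a" and x: "x \<in> \<Omega>"
  shows "dt T u (x, 0) = - (H x \<bullet> grad_closure \<Omega> a x) - p x * a x"
proof -
  obtain Pu Qu where u: "spacetime_C1 \<Omega> T u Pu Qu"
    using sol C1_closure_spacetime[OF _ \<open>0 < T\<close>, of \<Omega> u] by (auto simp: solution_def)
  have ic: "\<And>x. x \<in> \<Omega> \<Longrightarrow> u (x, 0) = a x" using sol by (auto simp: solution_def)
  have Pu: "Pu (x, 0) = grad_closure \<Omega> a x"
    by (rule gradient_at_initial_time[OF u \<open>open \<Omega>\<close> \<open>0 < T\<close> x ic C1_closure_grad_closure(2)[OF a \<open>open \<Omega>\<close> x]])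
  have xc: "x \<in> closure \<Omega>" using x closure_subset by blast
  note lim = tendsto_at_right_time[OF _ xc \<open>0 < T\<close>]
  have "((\<lambda>s. dt T u (x, s) + H x \<bullet> Pu (x, s) + p x * u (x, s)) \<longlongrightarrow>
      dt T u (x, 0) + H x \<bullet> Pu (x, 0) + p x * u (x, 0)) (at_right 0)"
    by (intro tendsto_intros lim spacetime_C1_cont[OF u] spacetime_C1_cont[OF v])
  moreover have "\<forall>\<^sub>F s in at_right 0. s \<in> {0<..<T}"
    using \<open>0 < T\<close> by (auto simp: eventually_at_right[of 0 T])
  then have "\<forall>\<^sub>F s in at_right 0. dt T u (x, s) + H x \<bullet> Pu (x, s) + p x * u (x, s) = 0"
  proof (rule eventually_mono)
    fix s assume s: "s \<in> {0<..<T}"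
    then show "dt T u (x, s) + H x \<bullet> Pu (x, s) + p x * u (x, s) = 0"
      using sol x spacetime_C1_grad_x[OF u x s] unfolding solution_def by metis
  qed
  then have "((\<lambda>s. dt T u (x, s) + H x \<bullet> Pu (x, s) + p x * u (x, s)) \<longlongrightarrow> 0) (at_right 0)"
    by (rule tendsto_eventually)
  ultimately have "dt T u (x, 0) + H x \<bullet> Pu (x, 0) + p x * u (x, 0) = 0"
    by (rule tendsto_unique[rotated]) simp
  then show ?thesis using Pu ic[OF x] by simp
qed

text \<open>A nonempty open set is not a null set.\<close>

lemma AE_le_imp_le_of_continuous:
  fixes f :: "'a::euclidean_space \<Rightarrow> ennreal"
  assumes "open \<Omega>" "continuous_on \<Omega> f" "AE x in lebesgue_on \<Omega>. f x \<le> c" "x \<in> \<Omega>"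
  shows "f x \<le> c"
proof (rule ccontr)
  assume "\<not> f x \<le> c"
  define U where "U = \<Omega> \<inter> f -` {c<..}"
  have U: "open U" "x \<in> U"
    using assms \<open>\<not> f x \<le> c\<close> by (auto simp: U_def not_le intro!: continuous_open_preimage)
  have "AE x in lebesgue. x \<in> \<Omega> \<longrightarrow> f x \<le> c"
    using assms by (subst (asm) AE_restrict_space_iff) auto
  then have "AE x in lebesgue. x \<notin> U" by eventually_elim (auto simp: U_def not_le)
  then have "AE x in lborel. x \<notin> U" by (simp add: AE_completion_iff)
  then have "emeasure lborel U = 0"
    using U by (subst (asm) AE_iff_measurable[where N = U]) auto
  then have "negligible U" using U by (simp add: negligible_iff_null_sets null_sets_completionI null_setsI)
  then show False using open_not_negligible U by blast
qed

text \<open>The mixed norm in the hypotheses takes the supremum over space before integrating in time. It is used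
  in the weaker form in which the point \<open>x\<close> is fixed; this avoids the question whether the supremum is
  measurable in time.\<close>

lemma nn_integral_time_bound:
  assumes sol: "solution \<Omega> T p H a u" and "open \<Omega>" "0 < T"
    and v: "spacetime_C1 \<Omega> T (dt T u) P Q"
    and bnd: "L2_Linf_norm_sq T \<Omega> (dt T (grad_x u)) \<le> ennreal (M0\<^sup>2)"
    and x: "x \<in> \<Omega>"
  shows "(\<integral>\<^sup>+t\<in>{0<..<T}. ennreal ((norm (P (x, t)))\<^sup>2) \<partial>lborel) \<le> ennreal (M0\<^sup>2)"
proof -
  have "(\<integral>\<^sup>+t\<in>{0<..<T}. ennreal ((norm (P (x, t)))\<^sup>2) \<partial>lborel) \<le> L2_Linf_norm_sq T \<Omega> (dt T (grad_x u))"
    unfolding L2_Linf_norm_sq_def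
  proof (rule nn_integral_mono)
    fix t :: real
    show "ennreal ((norm (P (x, t)))\<^sup>2) * indicator {0<..<T} t \<le>
      (esssup (lebesgue_on \<Omega>) (\<lambda>x. ennreal (norm (dt T (grad_x u) (x, t)))))\<^sup>2 * indicator {0<..<T} t"
    proof (cases "t \<in> {0<..<T}")
      case True
      have eq: "dt T (grad_x u) (y, t) = P (y, t)" if "y \<in> \<Omega>" for y
        using solution_time_derivative_equation(1)[OF sol \<open>open \<Omega>\<close> \<open>0 < T\<close> v that True] .
      have cP: "continuous_on \<Omega> (\<lambda>y. P (y, t))"
        by (rule continuous_on_compose2[OF spacetime_C1_cont(2)[OF v]])
           (use True closure_subset in \<open>auto intro!: continuous_intros\<close>)
      have "continuous_on \<Omega> (\<lambda>y. ennreal (norm (P (y, t))))"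
        by (intro continuous_on_ennreal continuous_intros cP)
      then have c: "continuous_on \<Omega> (\<lambda>y. ennreal (norm (dt T (grad_x u) (y, t))))"
        by (rule continuous_on_eq) (simp add: eq)
      have "ennreal (norm (dt T (grad_x u) (x, t))) \<le> esssup (lebesgue_on \<Omega>) (\<lambda>x. ennreal (norm (dt T (grad_x u) (x, t))))"
        by (rule AE_le_imp_le_of_continuous[OF \<open>open \<Omega>\<close> c esssup_AE x])
      then have "(ennreal (norm (P (x, t))))\<^sup>2 \<le> (esssup (lebesgue_on \<Omega>) (\<lambda>x. ennreal (norm (dt T (grad_x u) (x, t)))))\<^sup>2"
        unfolding eq[OF x] by (rule power_mono) simp
      then show ?thesis using True by (simp add: ennreal_power)
    qed simp
  qed
  then show ?thesis using bnd by (rule order_trans)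
qed

text \<open>The quadratic form is continuous and positive on the compact set \<open>K \<times> sphere 0 1\<close>, since the vectors
  \<open>A x k\<close> form an invertible matrix.\<close>

lemma exists_det_lower_bound:
  fixes A :: "real^'n \<Rightarrow> 'n \<Rightarrow> real^'n"
  assumes K: "compact K" "K \<noteq> {}" and cont: "\<And>k. continuous_on K (\<lambda>x. A x k)"
    and det: "\<And>x. x \<in> K \<Longrightarrow> det (\<chi> i k. A x k $ i) \<noteq> 0"
  shows "\<exists>c>0. \<forall>x\<in>K. \<forall>f. c * (norm f)\<^sup>2 \<le> (\<Sum>k\<in>UNIV. (f \<bullet> A x k)\<^sup>2)"
proof -
  define S where "S = sphere (0::real^'n) 1"
  have S: "compact S" "S \<noteq> {}" unfolding S_def by auto
  define q where "q = (\<lambda>(x, f). \<Sum>k\<in>UNIV. (f \<bullet> A x k)\<^sup>2)"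
  have "continuous_on (K \<times> S) (\<lambda>z. \<Sum>k\<in>UNIV. (snd z \<bullet> A (fst z) k)\<^sup>2)"
    by (intro continuous_intros continuous_on_compose2[OF cont]) auto
  then have "continuous_on (K \<times> S) q" by (simp add: q_def split_beta)
  then have "\<exists>z\<in>K \<times> S. \<forall>w\<in>K \<times> S. q z \<le> q w"
    using K S by (intro continuous_attains_inf compact_Times) auto
  then obtain z where z: "z \<in> K \<times> S" "\<And>w. w \<in> K \<times> S \<Longrightarrow> q z \<le> q w"
    by blast
  obtain x f where xf: "z = (x, f)" "x \<in> K" "f \<in> S" using z by (cases z) auto
  have "q z \<noteq> 0"
  proof
    assume "q z = 0"
    then have "\<And>k. f \<bullet> A x k = 0"
      by (simp add: xf q_def sum_nonneg_eq_0_iff)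
    then have "transpose (\<chi> i k. A x k $ i) *v f = 0"
      by (simp add: vec_eq_iff matrix_vector_mult_def transpose_def inner_vec_def mult.commute)
    moreover have "invertible (transpose (\<chi> i k. A x k $ i))"
      using det[OF xf(2)] by (simp add: invertible_det_nz det_transpose)
    ultimately have "f = 0"
      by (metis invertible_def matrix_left_invertible_ker)
    then show False using xf by (simp add: S_def)
  qed
  then have c: "0 < q z" by (simp add: q_def xf less_le sum_nonneg)
  have "q z * (norm f)\<^sup>2 \<le> (\<Sum>k\<in>UNIV. (f \<bullet> A x k)\<^sup>2)" if "x \<in> K" for x f
  proof (cases "f = 0")
    case False
    have "q z \<le> q (x, sgn f)"
      using z(2)[of "(x, sgn f)"] that False by (simp add: S_def norm_sgn)
    then have "q z * (norm f)\<^sup>2 \<le> q (x, sgn f) * (norm f)\<^sup>2" by (rule mult_right_mono) simp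
    also have "\<dots> = (\<Sum>k\<in>UNIV. (f \<bullet> A x k)\<^sup>2)"
    proof -
      have "(sgn f \<bullet> A x k)\<^sup>2 * (norm f)\<^sup>2 = (f \<bullet> A x k)\<^sup>2" for k
        using False by (simp add: sgn_div_norm power_mult_distrib field_simps)
      then show ?thesis by (simp add: q_def sum_distrib_right)
    qed
    finally show ?thesis .
  qed simp
  then show ?thesis using c by blast
qed

section \<open>A weight that grows along all admissible fields\<close>

definition pos_sq :: "real \<Rightarrow> real" where "pos_sq s = (max 0 s)\<^sup>2"

lemma pos_sq_nonneg: "0 \<le> pos_sq s" by (simp add: pos_sq_def)

lemma pos_sq_mono: "s \<le> t \<Longrightarrow> pos_sq s \<le> pos_sq t"
  unfolding pos_sq_def by (intro power_mono) auto

lemma pos_sq_deriv: "(pos_sq has_real_derivative 2 * max 0 s) (at s)"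
proof -
  consider "s < 0" | "s > 0" | "s = 0" by linarith
  then show ?thesis
  proof cases
    case 1
    have "((\<lambda>s. 0) has_real_derivative 0) (at s)" by simp
    then have "(pos_sq has_real_derivative 0) (at s)"
      by (rule has_field_derivative_transform_within_open[where S = "{..<0}"]) (use 1 in \<open>auto simp: pos_sq_def\<close>)
    then show ?thesis using 1 by simp
  next
    case 2
    have "((\<lambda>s. s\<^sup>2) has_real_derivative 2 * s) (at s)" by (auto intro!: derivative_eq_intros)
    then have "(pos_sq has_real_derivative 2 * s) (at s)"
      by (rule has_field_derivative_transform_within_open[where S = "{0<..}"]) (use 2 in \<open>auto simp: pos_sq_def\<close>)
    then show ?thesis using 2 by simp
  next
    case 3
    have "(\<lambda>h. pos_sq h / h) \<midarrow>0\<rightarrow> 0"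
    proof (rule Lim_null_comparison)
      show "\<forall>\<^sub>F h in at 0. norm (pos_sq h / h) \<le> \<bar>h\<bar>"
        by (rule always_eventually) (auto simp: pos_sq_def power2_eq_square max_def)
      have "((\<lambda>h::real. \<bar>h\<bar>) \<longlongrightarrow> \<bar>0\<bar>) (at 0)" by (intro tendsto_intros)
      then show "((\<lambda>h::real. \<bar>h\<bar>) \<longlongrightarrow> 0) (at 0)" by simp
    qed
    then show ?thesis using 3 by (simp add: DERIV_def pos_sq_def)
  qed
qed

lemma pos_sq_cont: "continuous_on A pos_sq"
  by (intro continuous_at_imp_continuous_on ballI DERIV_isCont[OF pos_sq_deriv])

lemma continuous_on_pos_sq [continuous_intros]:
  "continuous_on A f \<Longrightarrow> continuous_on A (\<lambda>x. pos_sq (f x))"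
  using continuous_on_compose2[OF pos_sq_cont] by blast

text \<open>A continuously differentiable step from 0 to 1 on the interval from 1 to 2: the second difference of
  \<open>pos_sq\<close> with step \<open>1/2\<close>, so that its derivative is a tent function of height 2.\<close>

definition smooth_step :: "real \<Rightarrow> real" where
  "smooth_step s = 2 * (pos_sq (s - 1) - 2 * pos_sq (s - 3/2) + pos_sq (s - 2))"

definition smooth_step_slope :: "real \<Rightarrow> real" where
  "smooth_step_slope s = 4 * (max 0 (s - 1) - 2 * max 0 (s - 3/2) + max 0 (s - 2))"

lemma smooth_step_deriv: "(smooth_step has_real_derivative smooth_step_slope s) (at s)"
  unfolding smooth_step_def[abs_def] smooth_step_slope_def
  by (auto intro!: derivative_eq_intros DERIV_chain2[OF pos_sq_deriv])

lemma smooth_step_zero: "s \<le> 1 \<Longrightarrow> smooth_step s = 0"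
  by (simp add: smooth_step_def pos_sq_def)

lemma smooth_step_one: "2 \<le> s \<Longrightarrow> smooth_step s = 1"
  by (simp add: smooth_step_def pos_sq_def power2_eq_square algebra_simps)

lemma smooth_step_bounds: "0 \<le> smooth_step s" "smooth_step s \<le> 1"
proof -
  consider "s \<le> 1" | "1 < s" "s \<le> 3/2" | "3/2 < s" "s < 2" | "2 \<le> s" by linarith
  then have "0 \<le> smooth_step s \<and> smooth_step s \<le> 1"
  proof cases
    case 2
    then have eq: "smooth_step s = 2 * (s - 1)\<^sup>2" by (simp add: smooth_step_def pos_sq_def)
    have "(s - 1)\<^sup>2 \<le> (1/2)\<^sup>2" using 2 by (intro power_mono) auto
    then show ?thesis unfolding eq by (simp add: power_divide)
  next
    case 3
    then have "smooth_step s = 1 - 2 * (2 - s)\<^sup>2"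
      by (simp add: smooth_step_def pos_sq_def power2_eq_square algebra_simps)
    moreover have "(2 - s)\<^sup>2 \<le> (1/2)\<^sup>2" using 3 by (intro power_mono) auto
    ultimately show ?thesis by (simp add: power_divide)
  qed (auto simp: smooth_step_zero smooth_step_one)
  then show "0 \<le> smooth_step s" "smooth_step s \<le> 1" by auto
qed

lemma smooth_step_slope_bounds: "0 \<le> smooth_step_slope s" "smooth_step_slope s \<le> 2"
  by (auto simp: smooth_step_slope_def max_def)

lemma smooth_step_slope_zero: "s \<le> 1 \<or> 2 \<le> s \<Longrightarrow> smooth_step_slope s = 0"
  by (auto simp: smooth_step_slope_def max_def)

lemma smooth_step_cont [continuous_intros]: "continuous_on A f \<Longrightarrow> continuous_on A (\<lambda>x. smooth_step (f x))"
  unfolding smooth_step_def by (intro continuous_intros)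

lemma smooth_step_slope_cont [continuous_intros]: "continuous_on A f \<Longrightarrow> continuous_on A (\<lambda>x. smooth_step_slope (f x))"
  unfolding smooth_step_slope_def by (intro continuous_intros)

text \<open>The conditions on the radius \<open>R\<close> and the flatness \<open>e\<close> depend only on \<open>T\<close>, \<open>\<delta>0\<close> and \<open>M\<close>. They ensure
  in turn that the support of the weight shrinks away from the chart boundary (\<open>e_small\<close>), that it is
  empty at time \<open>T\<close> (\<open>R_le_T\<close>), and that every admissible field still points outward on it (\<open>R_le\<close>).\<close>

locale weighted_chart = boundary_chart \<Omega> x0 \<nu> e R \<rho> G
  for \<Omega> :: "(real^'n) set" and x0 \<nu> :: "real^'n" and e R :: real and \<rho> G +
  fixes T \<delta>0 M :: real
  assumes bounded_region: "bounded \<Omega>"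
    and T_pos: "0 < T" and \<delta>0_pos: "0 < \<delta>0" and M_pos: "0 < M"
    and e_small: "e \<le> \<delta>0 / (64 * M)"
    and R_le_T: "R \<le> 64 * M * T" and R_le: "R \<le> 2 * \<delta>0 / (7 * M)"
begin

text \<open>The radius \<open>r\<close> is a quarter of \<open>R\<close> because comparing a field with its value at \<open>x0\<close> needs a
  detour that leaves the ball of radius \<open>r\<close>. With \<open>\<kappa> = \<delta>0 / (8 * M)\<close> the term of \<open>\<psi>\<close> with coefficient
  \<open>curv\<close> changes along a field at rate at most \<open>\<delta>0 / 8\<close> on the ball of radius \<open>r / 2\<close>, and the height
  \<open>\<epsilon>0\<close> of the cap is small enough for the cap to stay in that ball.\<close>

definition \<kappa> where "\<kappa> = \<delta>0 / (8 * M)"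
definition r where "r = R / 4"
definition \<epsilon>0 where "\<epsilon>0 = \<kappa> * r / 16"

definition curv where "curv = \<kappa> / r"

text \<open>The set where \<open>\<psi>\<close> is positive is a paraboloid-shaped cap below the boundary. Inside \<open>\<Omega>\<close> it is
  contained in the ball of radius \<open>r / 2\<close>: the curvature term beats the linear term there because
  \<open>\<nu> \<bullet> (x - x0) \<le> e * norm (x - x0)\<close> in \<open>\<Omega>\<close>. The cap recedes with speed \<open>\<delta>0 / 4\<close>, slower than
  the normal speed \<open>\<delta>0 / 2\<close> of the fields, so that \<open>\<psi>\<close> still increases along trajectories.\<close>

definition \<psi> :: "(real^'n) \<times> real \<Rightarrow> real" where
  "\<psi> = (\<lambda>(x, t). \<epsilon>0 + \<nu> \<bullet> (x - x0) - curv * ((x - x0) \<bullet> (x - x0)) - \<delta>0 / 4 * t)"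

text \<open>The square of the positive part makes the weight continuously differentiable with support in the cap.
  The exponential, with a free parameter \<open>\<sigma>\<close>, makes it grow along the fields at a rate
  proportional to \<open>\<sigma>\<close>.\<close>

definition weight :: "real \<Rightarrow> (real^'n) \<times> real \<Rightarrow> real" where
  "weight \<sigma> z = exp (\<sigma> * (\<nu> \<bullet> (fst z - x0))) * pos_sq (\<psi> z)"

definition weight_x :: "real \<Rightarrow> (real^'n) \<times> real \<Rightarrow> real^'n" where
  "weight_x \<sigma> z = exp (\<sigma> * (\<nu> \<bullet> (fst z - x0))) *\<^sub>R
     ((\<sigma> * pos_sq (\<psi> z)) *\<^sub>R \<nu> + (2 * max 0 (\<psi> z)) *\<^sub>R (\<nu> - (2 * curv) *\<^sub>R (fst z - x0)))"

definition weight_t :: "real \<Rightarrow> (real^'n) \<times> real \<Rightarrow> real" where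
  "weight_t \<sigma> z = - (\<delta>0 / 4) * exp (\<sigma> * (\<nu> \<bullet> (fst z - x0))) * (2 * max 0 (\<psi> z))"

lemma kr_pos: "0 < \<kappa>" "0 < r" "0 < \<epsilon>0" "0 < curv"
  using \<delta>0_pos M_pos R_pos by (auto simp: \<kappa>_def r_def \<epsilon>0_def curv_def)

lemma e_le_\<kappa>: "e \<le> \<kappa> / 8"
  using e_small by (simp add: \<kappa>_def)

lemma weight_nonneg: "0 \<le> weight \<sigma> z"
  by (simp add: weight_def pos_sq_nonneg)

lemma \<psi>_cont [continuous_intros]: "continuous_on A \<psi>"
  unfolding \<psi>_def split_beta by (intro continuous_intros)

lemma weight_cont: "continuous_on A (weight \<sigma>)" "continuous_on A (weight_x \<sigma>)" "continuous_on A (weight_t \<sigma>)"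
  unfolding weight_def[abs_def] weight_x_def[abs_def] weight_t_def[abs_def] by (intro continuous_intros)+

lemma \<psi>_deriv: "(\<psi> has_derivative (\<lambda>(h, k). (\<nu> - (2 * curv) *\<^sub>R (x - x0)) \<bullet> h - \<delta>0 / 4 * k)) (at (x, t))"
proof -
  have "((\<lambda>z. \<epsilon>0 + \<nu> \<bullet> (fst z - x0) - curv * ((fst z - x0) \<bullet> (fst z - x0)) - \<delta>0 / 4 * snd z) has_derivative
      (\<lambda>z. \<nu> \<bullet> fst z - curv * ((x - x0) \<bullet> fst z + fst z \<bullet> (x - x0)) - \<delta>0 / 4 * snd z)) (at (x, t))"
    by (auto intro!: derivative_eq_intros)
  then show ?thesis
    unfolding \<psi>_def split_beta'
    by (rule has_derivative_eq_rhs) (auto simp: fun_eq_iff inner_diff_left inner_diff_right inner_commute algebra_simps)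
qed

lemma weight_deriv: "(weight \<sigma> has_derivative (\<lambda>(h, k). weight_x \<sigma> (x, t) \<bullet> h + weight_t \<sigma> (x, t) * k)) (at (x, t))"
proof -
  have e: "((\<lambda>z. exp (\<sigma> * (\<nu> \<bullet> (fst z - x0)))) has_derivative
      (\<lambda>z. exp (\<sigma> * (\<nu> \<bullet> (x - x0))) * (\<sigma> * (\<nu> \<bullet> fst z)))) (at (x, t))"
    by (auto intro!: derivative_eq_intros)
  have p: "((\<lambda>z. pos_sq (\<psi> z)) has_derivative
      (\<lambda>z. 2 * max 0 (\<psi> (x, t)) * ((\<nu> - (2 * curv) *\<^sub>R (x - x0)) \<bullet> fst z - \<delta>0 / 4 * snd z))) (at (x, t))"
    using has_derivative_compose[OF \<psi>_deriv[of x t] pos_sq_deriv[of "\<psi> (x, t)", unfolded has_field_derivative_def]]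
    by (simp add: split_beta)
  show ?thesis
    unfolding weight_def[abs_def]
    by (rule has_derivative_eq_rhs[OF has_derivative_mult[OF e p]])
       (auto simp: fun_eq_iff weight_x_def weight_t_def inner_add_left inner_diff_left algebra_simps)
qed

lemma center_almost_max:
  assumes "x \<in> \<Omega> \<inter> ball x0 R"
  shows "\<nu> \<bullet> (x - x0) \<le> e * norm (x - x0)"
proof -
  have x: "x \<in> ball x0 R" "\<rho> x < 0" using assms region by blast+
  then show ?thesis using rho_almost_affine[of x x0] rho_center R_pos by simp
qed

lemma \<psi>_pos_imp_near:
  assumes "x \<in> \<Omega> \<inter> ball x0 R" "0 \<le> t" "0 < \<psi> (x, t)"
  shows "norm (x - x0) < r / 2"
proof (rule ccontr)
  define d where "d = norm (x - x0)"
  assume "\<not> norm (x - x0) < r / 2"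
  then have d: "r / 2 \<le> d" by (simp add: d_def)
  have "e * d \<le> \<kappa> / 8 * d" using e_le_\<kappa> d kr_pos by (intro mult_right_mono) auto
  moreover have "\<kappa> / 2 * d \<le> curv * d\<^sup>2"
  proof -
    have "curv * (r / 2 * d) \<le> curv * (d * d)"
      using d kr_pos by (intro mult_left_mono mult_right_mono) auto
    then show ?thesis using kr_pos by (simp add: power2_eq_square curv_def)
  qed
  moreover have "\<kappa> * (r / 2) \<le> \<kappa> * d" using d kr_pos by (intro mult_left_mono) auto
  moreover have "\<nu> \<bullet> (x - x0) \<le> e * d" using center_almost_max assms by (simp add: d_def)
  moreover have "0 \<le> \<delta>0 / 4 * t" using assms \<delta>0_pos by simp
  moreover have "0 < \<kappa> * r" using kr_pos by simp
  moreover have "\<psi> (x, t) = \<kappa> * r / 16 + \<nu> \<bullet> (x - x0) - curv * d\<^sup>2 - \<delta>0 / 4 * t"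
    by (simp add: \<psi>_def \<epsilon>0_def d_def power2_norm_eq_inner)
  ultimately have "\<psi> (x, t) \<le> 0" by (simp add: algebra_simps)
  then show False using assms by simp
qed

lemma weight_far:
  assumes "x \<in> \<Omega> \<inter> ball x0 R" "0 \<le> t" "r / 2 \<le> norm (x - x0)"
  shows "weight \<sigma> (x, t) = 0" "weight_x \<sigma> (x, t) = 0" "weight_t \<sigma> (x, t) = 0"
proof -
  have "max 0 (\<psi> (x, t)) = 0"
    using \<psi>_pos_imp_near[OF assms(1,2)] assms(3) by (meson max.absorb1 not_le)
  then show "weight \<sigma> (x, t) = 0" "weight_x \<sigma> (x, t) = 0" "weight_t \<sigma> (x, t) = 0"
    by (simp_all add: weight_def weight_x_def weight_t_def pos_sq_def)
qed

lemma weight_final: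
  assumes x: "x \<in> \<Omega> \<inter> ball x0 R"
  shows "weight \<sigma> (x, T) = 0"
proof -
  have "\<psi> (x, T) \<le> 0"
  proof (rule ccontr)
    assume "\<not> \<psi> (x, T) \<le> 0"
    then have d: "norm (x - x0) < r / 2" using \<psi>_pos_imp_near[OF x, of T] T_pos by simp
    have "e * norm (x - x0) \<le> \<kappa> / 8 * (r / 2)"
      using e_le_\<kappa> e_nonneg d kr_pos by (intro mult_mono) auto
    moreover have "0 \<le> curv * ((x - x0) \<bullet> (x - x0))" using kr_pos by simp
    moreover have "\<nu> \<bullet> (x - x0) \<le> e * norm (x - x0)" by (rule center_almost_max[OF x])
    moreover have "\<kappa> * r / 8 \<le> \<delta>0 / 4 * T"
    proof -
      have "\<kappa> * r / 8 = \<delta>0 / (256 * M) * R" by (simp add: \<kappa>_def r_def)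
      also have "\<dots> \<le> \<delta>0 / (256 * M) * (64 * M * T)"
        using R_le_T \<delta>0_pos M_pos by (intro mult_left_mono) auto
      also have "\<dots> = \<delta>0 / 4 * T" using M_pos by simp
      finally show ?thesis .
    qed
    ultimately have "\<psi> (x, T) \<le> 0" unfolding \<psi>_def \<epsilon>0_def prod.case by linarith
    then show False using \<open>\<not> \<psi> (x, T) \<le> 0\<close> by simp
  qed
  then show ?thesis by (simp add: weight_def pos_sq_def)
qed

lemma weight_le_initial: "0 \<le> t \<Longrightarrow> weight \<sigma> (x, t) \<le> weight \<sigma> (x, 0)"
  using \<delta>0_pos unfolding weight_def by (auto intro!: mult_left_mono pos_sq_mono simp: \<psi>_def)

lemma weight_le:
  assumes "x \<in> ball x0 R" "0 \<le> t" "0 \<le> \<sigma>"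
  shows "weight \<sigma> (x, t) \<le> exp (\<sigma> * R) * (\<epsilon>0 + R)\<^sup>2"
proof -
  have "\<nu> \<bullet> (x - x0) \<le> norm (x - x0)"
    using norm_cauchy_schwarz[of \<nu> "x - x0"] norm_nu by simp
  then have n: "\<nu> \<bullet> (x - x0) \<le> R" using assms by (simp add: dist_norm norm_minus_commute)
  have "0 \<le> curv * ((x - x0) \<bullet> (x - x0))" "0 \<le> \<delta>0 / 4 * t" using kr_pos \<delta>0_pos assms by simp_all
  then have "\<psi> (x, t) \<le> \<epsilon>0 + R" using n unfolding \<psi>_def prod.case by linarith
  then have "max 0 (\<psi> (x, t)) \<le> \<epsilon>0 + R" using kr_pos R_pos by simp
  then have "pos_sq (\<psi> (x, t)) \<le> (\<epsilon>0 + R)\<^sup>2"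
    unfolding pos_sq_def by (intro power_mono) auto
  moreover have "exp (\<sigma> * (\<nu> \<bullet> (x - x0))) \<le> exp (\<sigma> * R)"
    using n assms by (simp add: mult_left_mono)
  ultimately show ?thesis
    unfolding weight_def by (intro mult_mono) (auto simp: pos_sq_nonneg)
qed

definition field_ok :: "(real^'n \<Rightarrow> real^'n) \<Rightarrow> bool" where
  "field_ok H \<longleftrightarrow> C1_closure \<Omega> H \<and> C1_norm \<Omega> H \<le> M \<and> \<delta>0 < H x0 \<bullet> \<nu>"

lemma field_ok_bounds:
  assumes "field_ok H" "x \<in> closure \<Omega>"
  shows "norm (H x) \<le> M" "norm (jac_closure \<Omega> H x) \<le> M"
  using C1_norm_bounds[OF _ open_region bounded_region _ assms(2)] assms(1) by (auto simp: field_ok_def)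

text \<open>The normal component exceeds \<open>\<delta>0\<close> at \<open>x0\<close> and the field varies by at most
  \<open>7 * M * norm (x - x0)\<close>, so the lower bound \<open>\<delta>0 / 2\<close> holds on a ball that does not depend on the
  field.\<close>

lemma field_ok_outward:
  assumes H: "field_ok H" and x: "x \<in> \<Omega>" "norm (x - x0) < r / 2"
  shows "\<delta>0 / 2 \<le> H x \<bullet> \<nu>"
proof -
  have C1: "C1_closure \<Omega> H" using H by (simp add: field_ok_def)
  have cl: "y \<in> closure \<Omega>" if "y \<in> \<Omega>" for y using that closure_subset by blast
  have "norm (H x - H x0) \<le> 7 * M * norm (x - x0)"
  proof (rule lipschitz_at_center)
    show "(H has_derivative (\<lambda>h. jac_closure \<Omega> H y *v h)) (at y)" if "y \<in> \<Omega>" for y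
      by (rule C1_closure_jac_closure(2)[OF C1 open_region that])
    show "norm (jac_closure \<Omega> H y *v h) \<le> M * norm h" if "y \<in> \<Omega>" for y h
      using norm_matrix_vector_mult_le[of "jac_closure \<Omega> H y" h] field_ok_bounds(2)[OF H cl[OF that]]
        mult_right_mono[of "norm (jac_closure \<Omega> H y)" M "norm h"] by simp
    show "continuous_on (closure \<Omega>) H" using C1 by (simp add: C1_closure_def)
    show "x \<in> \<Omega> \<inter> ball x0 (R / 4)" using x kr_pos by (simp add: r_def dist_norm norm_minus_commute)
  qed (use M_pos in simp)
  also have "\<dots> \<le> 7 * M * (r / 2)" using x M_pos by (intro mult_left_mono) auto
  also have "\<dots> = 7 * M / 8 * R" by (simp add: r_def)
  also have "\<dots> \<le> 7 * M / 8 * (2 * \<delta>0 / (7 * M))" using R_le M_pos by (intro mult_left_mono) auto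
  also have "\<dots> = \<delta>0 / 4" using M_pos by simp
  finally have "norm (H x - H x0) \<le> \<delta>0 / 4" .
  moreover have "\<bar>(H x - H x0) \<bullet> \<nu>\<bar> \<le> norm (H x - H x0)"
    using Cauchy_Schwarz_ineq2[of "H x - H x0" \<nu>] norm_nu by simp
  moreover have "\<delta>0 < H x0 \<bullet> \<nu>" using H by (simp add: field_ok_def)
  ultimately show ?thesis using \<delta>0_pos by (simp add: inner_diff_left)
qed

text \<open>The estimate on which everything rests: the weight grows along every admissible field at the relative
  rate \<open>\<sigma> * \<delta>0 / 2\<close>, which is arbitrarily large. The derivative of the exponential gives the rate, and
  the derivative of \<open>\<psi>\<close> along the field is nonnegative.\<close>

lemma weight_transport_ge:
  assumes H: "field_ok H" and x: "x \<in> \<Omega> \<inter> ball x0 R" and "0 \<le> t" "0 \<le> \<sigma>"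
  shows "\<sigma> * \<delta>0 / 2 * weight \<sigma> (x, t) \<le> weight_t \<sigma> (x, t) + weight_x \<sigma> (x, t) \<bullet> H x"
proof (cases "0 < \<psi> (x, t)")
  case False
  then have "max 0 (\<psi> (x, t)) = 0" by simp
  then show ?thesis by (simp add: weight_def weight_t_def weight_x_def pos_sq_def)
next
  case True
  then have d: "norm (x - x0) < r / 2" using \<psi>_pos_imp_near[OF x \<open>0 \<le> t\<close>] by simp
  have o: "\<delta>0 / 2 \<le> H x \<bullet> \<nu>" using field_ok_outward[OF H _ d] x by simp
  have "x \<in> closure \<Omega>" using x closure_subset by blast
  then have HM: "norm (H x) \<le> M" by (rule field_ok_bounds(1)[OF H])
  define E where "E = exp (\<sigma> * (\<nu> \<bullet> (x - x0)))"
  have E: "0 < E" by (simp add: E_def)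
  have "\<bar>(x - x0) \<bullet> H x\<bar> \<le> norm (x - x0) * norm (H x)" by (rule Cauchy_Schwarz_ineq2)
  also have "\<dots> \<le> r / 2 * M" using d HM kr_pos by (intro mult_mono) auto
  finally have "2 * curv * ((x - x0) \<bullet> H x) \<le> 2 * curv * (r / 2 * M)"
    using kr_pos by (intro mult_left_mono) auto
  also have "\<dots> = \<delta>0 / 8" using kr_pos M_pos by (simp add: \<kappa>_def curv_def)
  finally have "\<delta>0 / 4 \<le> (\<nu> - (2 * curv) *\<^sub>R (x - x0)) \<bullet> H x"
    using o \<delta>0_pos unfolding inner_diff_left[of \<nu>] inner_scaleR_left inner_commute[of "H x" \<nu>] by linarith
  then have 1: "0 \<le> E * (2 * max 0 (\<psi> (x, t))) * ((\<nu> - (2 * curv) *\<^sub>R (x - x0)) \<bullet> H x - \<delta>0 / 4)"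
    using E by simp
  have 2: "E * (\<sigma> * pos_sq (\<psi> (x, t))) * (\<delta>0 / 2) \<le> E * (\<sigma> * pos_sq (\<psi> (x, t))) * (\<nu> \<bullet> H x)"
    using o E \<open>0 \<le> \<sigma>\<close> by (intro mult_left_mono) (auto simp: inner_commute pos_sq_nonneg)
  define d where "d = \<nu> - (2 * curv) *\<^sub>R (x - x0)"
  have wx: "weight_x \<sigma> (x, t) = E *\<^sub>R ((\<sigma> * pos_sq (\<psi> (x, t))) *\<^sub>R \<nu> + (2 * max 0 (\<psi> (x, t))) *\<^sub>R d)"
    by (simp only: weight_x_def E_def d_def fst_conv)
  have wt: "weight_t \<sigma> (x, t) = - (\<delta>0 / 4) * E * (2 * max 0 (\<psi> (x, t)))"
    by (simp only: weight_t_def E_def fst_conv)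
  have "weight_t \<sigma> (x, t) + weight_x \<sigma> (x, t) \<bullet> H x =
     E * (\<sigma> * pos_sq (\<psi> (x, t))) * (\<nu> \<bullet> H x) +
     E * (2 * max 0 (\<psi> (x, t))) * ((\<nu> - (2 * curv) *\<^sub>R (x - x0)) \<bullet> H x - \<delta>0 / 4)"
    unfolding wx wt d_def[symmetric] by (simp add: inner_add_left algebra_simps)
  moreover have "weight \<sigma> (x, t) = E * pos_sq (\<psi> (x, t))"
    by (simp only: weight_def E_def fst_conv)
  ultimately show ?thesis using 1 2 by (simp add: algebra_simps)
qed

text \<open>Vanishes where \<open>\<rho> > - \<epsilon>\<close> and equals 1 where \<open>\<rho> < - 2 * \<epsilon>\<close>. Multiplication by it gives compact
  support in \<open>\<Omega>\<close>, and its gradient, of size at most \<open>4 / \<epsilon>\<close>, lives in a strip of width \<open>2 * \<epsilon>\<close>.\<close>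

definition cutoff :: "real \<Rightarrow> real^'n \<Rightarrow> real" where
  "cutoff \<epsilon> x = smooth_step (- \<rho> x / \<epsilon>)"

definition cutoff_x :: "real \<Rightarrow> real^'n \<Rightarrow> real^'n" where
  "cutoff_x \<epsilon> x = (- smooth_step_slope (- \<rho> x / \<epsilon>) / \<epsilon>) *\<^sub>R G x"

lemma cutoff_bounds: "0 \<le> cutoff \<epsilon> x" "cutoff \<epsilon> x \<le> 1"
  by (auto simp: cutoff_def smooth_step_bounds)

lemma cutoff_deriv:
  assumes "x \<in> ball x0 R"
  shows "(cutoff \<epsilon> has_derivative (\<lambda>h. cutoff_x \<epsilon> x \<bullet> h)) (at x)"
proof -
  have "((\<lambda>x. - \<rho> x / \<epsilon>) has_derivative (\<lambda>h. - (G x \<bullet> h) / \<epsilon>)) (at x)"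
    using bounded_linear.has_derivative[OF bounded_linear_divide has_derivative_minus[OF rho_deriv[OF assms]], of \<epsilon>]
    by simp
  from has_derivative_compose[OF this smooth_step_deriv[of "- \<rho> x / \<epsilon>", unfolded has_field_derivative_def]]
  show ?thesis by (simp add: cutoff_def[abs_def] cutoff_x_def)
qed

lemma cutoff_cont: "continuous_on (ball x0 R) (cutoff \<epsilon>)" "continuous_on (ball x0 R) (cutoff_x \<epsilon>)"
  unfolding cutoff_def[abs_def] cutoff_x_def[abs_def] divide_inverse
  by (intro continuous_intros rho_cont G_cont)+

lemma norm_G_le: "x \<in> ball x0 R \<Longrightarrow> norm (G x) \<le> 2"
  using G_close[of x] norm_nu norm_triangle_ineq[of "G x - \<nu>" \<nu>] e_le by simp


end

section \<open>The weighted energy estimate\<close>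

text \<open>The pointwise inequality behind the energy estimate. The growth \<open>L\<close> of the weight dominates the
  divergence \<open>tr\<close> of the field, the zeroth-order coefficient \<open>p\<close>, and the part \<open>\<mu> * v\<^sup>2\<close> of the source
  term, which is split by Young's inequality; what remains of the source carries the small factor
  \<open>1 / \<mu>\<close>.\<close>

lemma energy_density_bound:
  fixes \<eta> w v A L s p tr g \<mu> :: real
  assumes "0 \<le> \<eta>" "0 \<le> w" "L * w \<le> A" "0 < \<mu>" "N + 2 * p0 + \<mu> \<le> L" "\<bar>p\<bar> \<le> p0" "\<bar>tr\<bar> \<le> N" "\<bar>s\<bar> \<le> F"
  shows "- (\<eta> * (v\<^sup>2 * A) + 2 * \<eta> * w * v * (s - p * v) + w * v\<^sup>2 * g + \<eta> * w * v\<^sup>2 * tr) \<le>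
    \<eta> * w * F\<^sup>2 / \<mu> + w * v\<^sup>2 * \<bar>g\<bar>"
proof -
  define m where "m = \<eta> * w"
  have m: "0 \<le> m" using assms by (simp add: m_def)
  have 1: "m * v\<^sup>2 * (N + 2 * p0 + \<mu>) \<le> \<eta> * (v\<^sup>2 * A)"
  proof -
    have "m * v\<^sup>2 * (N + 2 * p0 + \<mu>) \<le> m * v\<^sup>2 * L" using m assms by (intro mult_left_mono) auto
    also have "\<dots> = \<eta> * v\<^sup>2 * (L * w)" by (simp add: m_def)
    also have "\<dots> \<le> \<eta> * v\<^sup>2 * A" using assms by (intro mult_left_mono) auto
    finally show ?thesis by simp
  qed
  have "0 \<le> (\<mu> * v + s)\<^sup>2 / \<mu>" using \<open>0 < \<mu>\<close> by simp
  also have "\<dots> = \<mu> * v\<^sup>2 + 2 * v * s + s\<^sup>2 / \<mu>"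
    using \<open>0 < \<mu>\<close> by (simp add: power2_eq_square field_simps)
  finally have "0 \<le> \<mu> * v\<^sup>2 + 2 * v * s + s\<^sup>2 / \<mu>" .
  moreover have "s\<^sup>2 / \<mu> \<le> F\<^sup>2 / \<mu>"
    using assms by (intro divide_right_mono) (auto simp: abs_le_square_iff[symmetric])
  ultimately have "0 \<le> m * (\<mu> * v\<^sup>2 + 2 * v * s + F\<^sup>2 / \<mu>)" using m by (intro mult_nonneg_nonneg) auto
  then have 2: "- (2 * m * v * s) \<le> m * v\<^sup>2 * \<mu> + m * F\<^sup>2 / \<mu>" by (simp add: algebra_simps)
  have 3: "m * v\<^sup>2 * (2 * p) \<le> m * v\<^sup>2 * (2 * p0)" using m assms by (intro mult_left_mono) auto
  have 4: "m * v\<^sup>2 * (- tr) \<le> m * v\<^sup>2 * N" using m assms by (intro mult_left_mono) auto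
  have 5: "w * v\<^sup>2 * (- g) \<le> w * v\<^sup>2 * \<bar>g\<bar>" using assms by (intro mult_left_mono) auto
  have "2 * \<eta> * w * v * (s - p * v) = 2 * m * v * s - m * v\<^sup>2 * (2 * p)"
    by (simp add: m_def power2_eq_square algebra_simps)
  moreover have "m * v\<^sup>2 * (N + 2 * p0 + \<mu>) = m * v\<^sup>2 * N + m * v\<^sup>2 * (2 * p0) + m * v\<^sup>2 * \<mu>"
    by (simp add: algebra_simps)
  moreover have "\<eta> * w * v\<^sup>2 * tr = - (m * v\<^sup>2 * (- tr))" "w * v\<^sup>2 * g = - (w * v\<^sup>2 * (- g))"
    "\<eta> * w * F\<^sup>2 / \<mu> = m * F\<^sup>2 / \<mu>"
    by (simp_all add: m_def)
  ultimately show ?thesis using 1 2 3 4 5 by linarith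
qed

context weighted_chart
begin

definition chart_region :: "(real^'n) set" where "chart_region = \<Omega> \<inter> ball x0 R"

lemma open_chart_region: "open chart_region"
  using open_region by (simp add: chart_region_def open_Int)

lemma strip_subset_chart_region: "strip l \<subseteq> chart_region"
  using region R_pos by (force simp: strip_def chart_region_def)

text \<open>The initial energy of \<open>v\<close> is bounded by the source with a factor \<open>M0\<^sup>2 / \<mu>\<close> and by the boundary
  layer. The source is \<open>f \<bullet> V\<close> with \<open>f\<close> independent of time, and the weight decreases in time, so
  the weight at time 0 can be used in the source term and the time integral falls on \<open>V\<close> alone. The
  first term on the right then has the same form as the left-hand side of the final estimate, with a
  factor that \<open>\<mu>\<close> makes small.\<close>

lemma energy_estimate:
  fixes v p :: "_ \<Rightarrow> real" and f :: "real^'n \<Rightarrow> real^'n" and V :: "(real^'n) \<times> real \<Rightarrow> real^'n"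
  assumes H: "field_ok H"
    and p: "\<And>x. x \<in> \<Omega> \<Longrightarrow> \<bar>p x\<bar> \<le> p0"
    and v: "spacetime_C1 \<Omega> T v P Q"
    and f: "continuous_on (closure \<Omega>) f" and V: "continuous_on (closure \<Omega> \<times> {0..T}) V"
    and eq: "\<And>x t. x \<in> \<Omega> \<Longrightarrow> t \<in> {0<..<T} \<Longrightarrow> Q (x, t) + H x \<bullet> P (x, t) + p x * v (x, t) = f x \<bullet> V (x, t)"
    and Vb: "\<And>x. x \<in> \<Omega> \<Longrightarrow> (\<integral>\<^sup>+t\<in>{0<..<T}. ennreal ((norm (V (x, t)))\<^sup>2) \<partial>lborel) \<le> ennreal (M0\<^sup>2)"
    and \<mu>: "0 < \<mu>" and \<sigma>: "0 \<le> \<sigma>" "real CARD('n) * M + 2 * p0 + \<mu> \<le> \<sigma> * \<delta>0 / 2" and \<epsilon>: "0 < \<epsilon>"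
  shows "ennreal (\<integral>x. indicator chart_region x * (cutoff \<epsilon> x * weight \<sigma> (x, 0) * (v (x, 0))\<^sup>2) \<partial>lborel) \<le>
    ennreal (M0\<^sup>2 / \<mu>) * (\<integral>\<^sup>+x. ennreal (indicator chart_region x * (cutoff \<epsilon> x * weight \<sigma> (x, 0) * (norm (f x))\<^sup>2)) \<partial>lborel) +
    (\<integral>\<^sup>+t\<in>{0<..<T}. (\<integral>\<^sup>+x. ennreal (4 * M / \<epsilon> * (weight \<sigma> (x, t) * (v (x, t))\<^sup>2)) * indicator (strip (2 * \<epsilon>)) x \<partial>lborel) \<partial>lborel)"
proof -
  have cl: "x \<in> closure \<Omega>" if "x \<in> chart_region" for x using that closure_subset by (auto simp: chart_region_def)
  have sub: "chart_region \<times> {0..T} \<subseteq> closure \<Omega> \<times> {0..T}" "chart_region \<subseteq> ball x0 R" "chart_region \<subseteq> closure \<Omega>"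
    using cl by (auto simp: chart_region_def)
  have C1: "C1_closure \<Omega> H" using H by (simp add: field_ok_def)
  define \<Phi> where "\<Phi> = (\<lambda>z. cutoff \<epsilon> (fst z) * weight \<sigma> z * (v z)\<^sup>2)"
  (* Space gradient and time derivative of Phi by the product rule. *)
  define P\<Phi> where "P\<Phi> = (\<lambda>z. (weight \<sigma> z * (v z)\<^sup>2) *\<^sub>R cutoff_x \<epsilon> (fst z) +
     (cutoff \<epsilon> (fst z) * (v z)\<^sup>2) *\<^sub>R weight_x \<sigma> z + (2 * cutoff \<epsilon> (fst z) * weight \<sigma> z * v z) *\<^sub>R P z)"
  define Q\<Phi> where "Q\<Phi> = (\<lambda>z. cutoff \<epsilon> (fst z) * (v z)\<^sup>2 * weight_t \<sigma> z + 2 * cutoff \<epsilon> (fst z) * weight \<sigma> z * v z * Q z)"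
  define J where "J = jac_closure \<Omega> H"
  define Div where "Div = (\<lambda>(x, t). Q\<Phi> (x, t) + P\<Phi> (x, t) \<bullet> H x + \<Phi> (x, t) * trace (J x))"
  have cc: "continuous_on (chart_region \<times> {0..T}) (\<lambda>z. cutoff \<epsilon> (fst z))" "continuous_on (chart_region \<times> {0..T}) (\<lambda>z. cutoff_x \<epsilon> (fst z))"
    by (rule continuous_on_compose2[OF cutoff_cont(1)], use sub in \<open>auto intro!: continuous_intros\<close>)
       (rule continuous_on_compose2[OF cutoff_cont(2)], use sub in \<open>auto intro!: continuous_intros\<close>)
  note cv = continuous_on_subset[OF spacetime_C1_cont(1)[OF v] sub(1)]
    continuous_on_subset[OF spacetime_C1_cont(2)[OF v] sub(1)]
    continuous_on_subset[OF spacetime_C1_cont(3)[OF v] sub(1)]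
  have cont: "continuous_on (chart_region \<times> {0..T}) \<Phi>" "continuous_on (chart_region \<times> {0..T}) P\<Phi>" "continuous_on (chart_region \<times> {0..T}) Q\<Phi>"
    unfolding \<Phi>_def P\<Phi>_def Q\<Phi>_def by (intro continuous_intros cc cv weight_cont)+
  define S where "S = {x \<in> cball x0 (r/2). \<rho> x \<le> - \<epsilon>}"
  have cbR: "cball x0 (r/2) \<subseteq> ball x0 R" using R_pos by (auto simp: r_def)
  have S: "compact S" "S \<subseteq> chart_region"
  proof -
    have "closedin (top_of_set (cball x0 (r/2))) (cball x0 (r/2) \<inter> \<rho> -` {..-\<epsilon>})"
      by (rule continuous_closedin_preimage[OF continuous_on_subset[OF rho_cont cbR]]) simp
    then have "closed (cball x0 (r/2) \<inter> \<rho> -` {..-\<epsilon>})" by (rule closedin_closed_trans) simp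
    moreover have "S = cball x0 (r/2) \<inter> \<rho> -` {..-\<epsilon>}" by (auto simp: S_def)
    ultimately have "closed S" by simp
    moreover have "bounded S" by (rule bounded_subset[OF bounded_cball[of x0 "r/2"]]) (auto simp: S_def)
    ultimately show "compact S" by (simp add: compact_eq_bounded_closed)
    show "S \<subseteq> chart_region"
    proof
      fix x assume "x \<in> S"
      then have "x \<in> ball x0 R" "\<rho> x < 0" using cbR \<epsilon> by (auto simp: S_def)
      then show "x \<in> chart_region" using region by (auto simp: chart_region_def)
    qed
  qed
  have zero: "\<Phi> (x, t) = 0" if x: "x \<in> chart_region - S" and t: "t \<in> {0..T}" for x t
  proof (cases "norm (x - x0) < r / 2")
    case True
    then have "\<not> \<rho> x \<le> - \<epsilon>" using x by (auto simp: S_def dist_norm norm_minus_commute)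
    then have "- \<rho> x / \<epsilon> \<le> 1" using \<epsilon> by (simp add: field_simps)
    then show ?thesis by (simp add: \<Phi>_def cutoff_def smooth_step_zero)
  next
    case False
    then show ?thesis using weight_far(1)[of x t \<sigma>] x t by (simp add: \<Phi>_def chart_region_def)
  qed
  have der: "(\<Phi> has_derivative (\<lambda>(h, k). P\<Phi> (x, t) \<bullet> h + Q\<Phi> (x, t) * k)) (at (x, t))"
    if x: "x \<in> chart_region" and t: "t \<in> {0<..<T}" for x t
  proof -
    have c: "((\<lambda>z. cutoff \<epsilon> (fst z)) has_derivative (\<lambda>z. cutoff_x \<epsilon> x \<bullet> fst z)) (at (x, t))"
    proof -
      have f: "(fst has_derivative fst) (at (x, t))"
        by (rule bounded_linear_imp_has_derivative[OF bounded_linear_fst])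
      have "x \<in> ball x0 R" using x sub(2) by blast
      then have "(cutoff \<epsilon> has_derivative (\<lambda>h. cutoff_x \<epsilon> x \<bullet> h)) (at (fst (x, t)))"
        using cutoff_deriv by simp
      from has_derivative_compose[OF f this] show ?thesis .
    qed
    have vd: "(v has_derivative (\<lambda>(h, k). P (x, t) \<bullet> h + Q (x, t) * k)) (at (x, t))"
      using v x t unfolding spacetime_C1_def by (simp add: chart_region_def)
    show ?thesis
      unfolding \<Phi>_def
      by (rule has_derivative_eq_rhs[OF has_derivative_mult[OF has_derivative_mult[OF c weight_deriv] has_derivative_power[OF vd]]])
         (auto simp: fun_eq_iff P\<Phi>_def Q\<Phi>_def inner_add_left power2_eq_square algebra_simps)
  qed
  have Tf: "\<Phi> (x, T) = 0" if "x \<in> chart_region" for x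
    using weight_final[of x] that by (simp add: \<Phi>_def chart_region_def)
  have Hd: "(H has_derivative (\<lambda>h. J x *v h)) (at x)" if "x \<in> chart_region" for x
    unfolding J_def using that by (intro C1_closure_jac_closure(2)[OF C1 open_region]) (simp add: chart_region_def)
  have Hc: "continuous_on chart_region H" "continuous_on chart_region J"
    unfolding J_def using continuous_on_subset[OF C1_closure_jac_closure(1)[OF C1 open_region] sub(3)] C1
      continuous_on_subset[OF _ sub(3)] by (auto simp: C1_closure_def)
  note TI = transport_identity[OF open_chart_region S T_pos zero cont der Tf Hd Hc, folded Div_def]
  (* Outside the strip the gradient of the cutoff vanishes, or the weight does: far from x0 the strip
     is truncated, but there the weight is zero. *)
  have pw: "- Div (x, t) \<le> cutoff \<epsilon> x * weight \<sigma> (x, 0) * (norm (f x))\<^sup>2 / \<mu> * (norm (V (x, t)))\<^sup>2 +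
      4 * M / \<epsilon> * (weight \<sigma> (x, t) * (v (x, t))\<^sup>2) * indicator (strip (2 * \<epsilon>)) x"
    if x: "x \<in> chart_region" and t: "t \<in> {0<..<T}" for x t
  proof -
    have xO: "x \<in> \<Omega>" "x \<in> ball x0 R" using x by (auto simp: chart_region_def)
    define g where "g = cutoff_x \<epsilon> x \<bullet> H x"
    have wA: "\<sigma> * \<delta>0 / 2 * weight \<sigma> (x, t) \<le> weight_t \<sigma> (x, t) + weight_x \<sigma> (x, t) \<bullet> H x"
      using weight_transport_ge[OF H _ _ \<sigma>(1), of x t] x t by (simp add: chart_region_def)
    have tr: "\<bar>trace (J x)\<bar> \<le> real CARD('n) * M"
      unfolding J_def by (rule order_trans[OF abs_trace_le mult_left_mono[OF field_ok_bounds(2)[OF H cl[OF x]]]]) simp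
    have "- Div (x, t) = - (cutoff \<epsilon> x * ((v (x, t))\<^sup>2 * (weight_t \<sigma> (x, t) + weight_x \<sigma> (x, t) \<bullet> H x)) +
        2 * cutoff \<epsilon> x * weight \<sigma> (x, t) * v (x, t) * (f x \<bullet> V (x, t) - p x * v (x, t)) +
        weight \<sigma> (x, t) * (v (x, t))\<^sup>2 * g + cutoff \<epsilon> x * weight \<sigma> (x, t) * (v (x, t))\<^sup>2 * trace (J x))"
      unfolding eq[OF xO(1) t, symmetric] Div_def prod.case \<Phi>_def P\<Phi>_def Q\<Phi>_def g_def
      by (simp add: inner_add_left inner_commute[of "H x"] algebra_simps)
    also have "\<dots> \<le> cutoff \<epsilon> x * weight \<sigma> (x, t) * (norm (f x) * norm (V (x, t)))\<^sup>2 / \<mu> +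
        weight \<sigma> (x, t) * (v (x, t))\<^sup>2 * \<bar>g\<bar>"
      by (rule energy_density_bound[OF cutoff_bounds(1) weight_nonneg wA \<mu> \<sigma>(2) p[OF xO(1)] tr Cauchy_Schwarz_ineq2])
    also have "cutoff \<epsilon> x * weight \<sigma> (x, t) * (norm (f x) * norm (V (x, t)))\<^sup>2 / \<mu> \<le>
        cutoff \<epsilon> x * weight \<sigma> (x, 0) * (norm (f x) * norm (V (x, t)))\<^sup>2 / \<mu>"
      using weight_le_initial[of t \<sigma> x] t \<mu> cutoff_bounds
      by (intro divide_right_mono mult_right_mono mult_left_mono) auto
    also have "weight \<sigma> (x, t) * (v (x, t))\<^sup>2 * \<bar>g\<bar> \<le>
        4 * M / \<epsilon> * (weight \<sigma> (x, t) * (v (x, t))\<^sup>2) * indicator (strip (2 * \<epsilon>)) x"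
    proof (cases "x \<in> strip (2 * \<epsilon>)")
      case True
      have "\<bar>g\<bar> \<le> norm (cutoff_x \<epsilon> x) * norm (H x)" unfolding g_def by (rule Cauchy_Schwarz_ineq2)
      also have "norm (cutoff_x \<epsilon> x) = smooth_step_slope (- \<rho> x / \<epsilon>) / \<epsilon> * norm (G x)"
        using \<epsilon> smooth_step_slope_bounds(1)[of "- \<rho> x / \<epsilon>"] by (simp add: cutoff_x_def)
      also have "smooth_step_slope (- \<rho> x / \<epsilon>) / \<epsilon> * norm (G x) * norm (H x) \<le> 2 / \<epsilon> * 2 * M"
        using \<epsilon> smooth_step_slope_bounds norm_G_le[OF xO(2)] field_ok_bounds(1)[OF H cl[OF x]]
        by (intro mult_mono divide_right_mono) auto
      finally have "\<bar>g\<bar> \<le> 4 * M / \<epsilon>" by simp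
      then have "weight \<sigma> (x, t) * (v (x, t))\<^sup>2 * \<bar>g\<bar> \<le> weight \<sigma> (x, t) * (v (x, t))\<^sup>2 * (4 * M / \<epsilon>)"
        using weight_nonneg by (intro mult_left_mono) auto
      then show ?thesis using True by (simp add: mult.commute)
    next
      case False
      have "weight \<sigma> (x, t) = 0 \<or> g = 0"
      proof (cases "norm (x - x0) < r / 2")
        case near: True
        have "\<rho> x < 0" using xO region by blast
        moreover have "dist x0 x < R / 2" using near R_pos by (simp add: r_def dist_norm norm_minus_commute)
        ultimately have "\<rho> x \<le> - (2 * \<epsilon>)" using False by (auto simp: strip_def)
        then have "2 \<le> - \<rho> x / \<epsilon>" using \<epsilon> by (simp add: field_simps)
        then show ?thesis by (simp add: g_def cutoff_x_def smooth_step_slope_zero)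
      next
        case False
        then show ?thesis using weight_far(1)[of x t \<sigma>] x t by (simp add: chart_region_def)
      qed
      then show ?thesis using False by auto
    qed
    finally show ?thesis by (simp add: power_mult_distrib algebra_simps)
  qed
  define I :: "(real^'n) \<times> real \<Rightarrow> real" where "I = indicator (chart_region \<times> {0<..<T})"
  define c where "c x = cutoff \<epsilon> x * weight \<sigma> (x, 0) * (norm (f x))\<^sup>2 / \<mu>" for x
  define R1 where "R1 z = ennreal (I z * (c (fst z) * (norm (V z))\<^sup>2))" for z
  define R2 where "R2 z = ennreal (indicator (strip (2*\<epsilon>) \<times> {0<..<T}) z * (4 * M / \<epsilon> * (weight \<sigma> z * (v z)\<^sup>2)))" for z
  have c0: "0 \<le> c x" for x using cutoff_bounds weight_nonneg \<mu> by (simp add: c_def)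
  have cfc: "continuous_on chart_region c"
  proof -
    have "continuous_on chart_region (\<lambda>x. weight \<sigma> (x, 0))"
      by (rule continuous_on_compose2[OF weight_cont(1)[of UNIV]]) (auto intro!: continuous_intros)
    then show ?thesis
      unfolding c_def[abs_def] using \<mu>
      by (intro continuous_intros continuous_on_subset[OF cutoff_cont(1) sub(2)] continuous_on_subset[OF f sub(3)]) auto
  qed
  have o1: "open (chart_region \<times> {0<..<T})" "open (strip (2*\<epsilon>) \<times> {0<..<T})"
    using open_chart_region open_strip by (auto intro!: open_Times)
  have s1: "chart_region \<times> {0<..<T} \<subseteq> closure \<Omega> \<times> {0..T}" "strip (2*\<epsilon>) \<times> {0<..<T} \<subseteq> closure \<Omega> \<times> {0..T}"
    using cl strip_subset_chart_region by auto
  have R1m: "R1 \<in> borel_measurable borel"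
  proof -
    have "continuous_on (chart_region \<times> {0<..<T}) (\<lambda>z. c (fst z) * (norm (V z))\<^sup>2)"
      by (intro continuous_intros continuous_on_subset[OF V s1(1)] continuous_on_compose2[OF cfc]) auto
    then have "(\<lambda>z. indicator (chart_region \<times> {0<..<T}) z *\<^sub>R (c (fst z) * (norm (V z))\<^sup>2)) \<in> borel_measurable borel"
      using o1 by (intro borel_measurable_continuous_on_indicator) auto
    then show ?thesis unfolding R1_def I_def by simp
  qed
  have R2m: "R2 \<in> borel_measurable borel"
  proof -
    have "continuous_on (strip (2*\<epsilon>) \<times> {0<..<T}) (\<lambda>z. 4 * M / \<epsilon> * (weight \<sigma> z * (v z)\<^sup>2))"
      by (intro continuous_intros weight_cont continuous_on_subset[OF spacetime_C1_cont(1)[OF v] s1(2)])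
    then have "(\<lambda>z. indicator (strip (2*\<epsilon>) \<times> {0<..<T}) z *\<^sub>R (4 * M / \<epsilon> * (weight \<sigma> z * (v z)\<^sup>2))) \<in> borel_measurable borel"
      using o1 by (intro borel_measurable_continuous_on_indicator) auto
    then show ?thesis unfolding R2_def by simp
  qed
  have "(\<integral>x. indicator chart_region x * (cutoff \<epsilon> x * weight \<sigma> (x, 0) * (v (x, 0))\<^sup>2) \<partial>lborel) = (\<integral>z. - (I z * Div z) \<partial>lborel)"
    using TI(2) by (simp add: I_def \<Phi>_def)
  also have "ennreal \<dots> \<le> (\<integral>\<^sup>+z. ennreal (- (I z * Div z)) \<partial>lborel)"
  proof -
    have int: "integrable lborel (\<lambda>z. - (I z * Div z))" using TI(1) by (simp add: I_def)
    then have i2: "integrable lborel (\<lambda>z. max 0 (- (I z * Div z)))" by simp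
    have "(\<integral>z. - (I z * Div z) \<partial>lborel) \<le> (\<integral>z. max 0 (- (I z * Div z)) \<partial>lborel)"
      using int i2 by (intro integral_mono) auto
    then have "ennreal (\<integral>z. - (I z * Div z) \<partial>lborel) \<le> ennreal (\<integral>z. max 0 (- (I z * Div z)) \<partial>lborel)"
      by (rule ennreal_leI)
    also have "\<dots> = (\<integral>\<^sup>+z. ennreal (max 0 (- (I z * Div z))) \<partial>lborel)"
      by (rule nn_integral_eq_integral[symmetric, OF i2]) simp
    also have "\<dots> = (\<integral>\<^sup>+z. ennreal (- (I z * Div z)) \<partial>lborel)"
      by (intro nn_integral_cong) (auto simp: max_def ennreal_neg)
    finally show ?thesis .
  qed
  also have "\<dots> \<le> (\<integral>\<^sup>+z. R1 z + R2 z \<partial>lborel)"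
  proof (rule nn_integral_mono)
    fix z :: "(real^'n) \<times> real"
    obtain x t where z: "z = (x, t)" by (cases z)
    show "ennreal (- (I z * Div z)) \<le> R1 z + R2 z"
    proof (cases "x \<in> chart_region \<and> t \<in> {0<..<T}")
      case True
      then have "- Div (x, t) \<le> c x * (norm (V (x, t)))\<^sup>2 +
          indicator (strip (2*\<epsilon>) \<times> {0<..<T}) (x, t) * (4 * M / \<epsilon> * (weight \<sigma> (x, t) * (v (x, t))\<^sup>2))"
        using pw[of x t] by (simp add: c_def indicator_times mult.commute)
      then have "ennreal (- Div (x, t)) \<le> ennreal (c x * (norm (V (x, t)))\<^sup>2 +
          indicator (strip (2*\<epsilon>) \<times> {0<..<T}) (x, t) * (4 * M / \<epsilon> * (weight \<sigma> (x, t) * (v (x, t))\<^sup>2)))"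
        by (rule ennreal_leI)
      also have "\<dots> = R1 z + R2 z"
        unfolding R1_def R2_def z using True c0 weight_nonneg M_pos \<epsilon>
        by (subst ennreal_plus) (auto simp: I_def)
      finally show ?thesis using True by (simp add: z I_def)
    next
      case False
      then show ?thesis by (auto simp: z I_def)
    qed
  qed
  also have "\<dots> = (\<integral>\<^sup>+z. R1 z \<partial>lborel) + (\<integral>\<^sup>+z. R2 z \<partial>lborel)"
    using R1m R2m by (intro nn_integral_add) auto
  also have "(\<integral>\<^sup>+z. R1 z \<partial>lborel) = (\<integral>\<^sup>+x. (\<integral>\<^sup>+t. R1 (x, t) \<partial>lborel) \<partial>lborel)"
    using lborel.nn_integral_fst[of R1 lborel] R1m by (simp add: lborel_prod)
  also have "\<dots> \<le> (\<integral>\<^sup>+x. ennreal (M0\<^sup>2 / \<mu>) * ennreal (indicator chart_region x * (cutoff \<epsilon> x * weight \<sigma> (x, 0) * (norm (f x))\<^sup>2)) \<partial>lborel)"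
  proof (rule nn_integral_mono)
    fix x :: "real^'n"
    show "(\<integral>\<^sup>+t. R1 (x, t) \<partial>lborel) \<le> ennreal (M0\<^sup>2 / \<mu>) * ennreal (indicator chart_region x * (cutoff \<epsilon> x * weight \<sigma> (x, 0) * (norm (f x))\<^sup>2))"
    proof (cases "x \<in> chart_region")
      case True
      then have xO: "x \<in> \<Omega>" by (simp add: chart_region_def)
      have cV: "continuous_on {0<..<T} (\<lambda>t. (norm (V (x, t)))\<^sup>2)"
        by (intro continuous_intros continuous_on_compose2[OF V]) (use cl[OF True] in auto)
      have "(\<lambda>t. indicator {0<..<T} t *\<^sub>R (norm (V (x, t)))\<^sup>2) \<in> borel_measurable borel"
        by (intro borel_measurable_continuous_on_indicator cV) auto
      then have m: "(\<lambda>t. ennreal ((norm (V (x, t)))\<^sup>2) * indicator {0<..<T} t) \<in> borel_measurable lborel"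
        by (subst measurable_cong[where g = "\<lambda>t. ennreal (indicator {0<..<T} t *\<^sub>R (norm (V (x, t)))\<^sup>2)"])
           (auto simp: indicator_def)
      have "(\<integral>\<^sup>+t. R1 (x, t) \<partial>lborel) = (\<integral>\<^sup>+t. ennreal (c x) * (ennreal ((norm (V (x, t)))\<^sup>2) * indicator {0<..<T} t) \<partial>lborel)"
        using True c0[of x] by (intro nn_integral_cong) (auto simp: R1_def I_def indicator_def ennreal_mult)
      also have "\<dots> = ennreal (c x) * (\<integral>\<^sup>+t\<in>{0<..<T}. ennreal ((norm (V (x, t)))\<^sup>2) \<partial>lborel)"
        by (rule nn_integral_cmult[OF m])
      also have "\<dots> \<le> ennreal (c x) * ennreal (M0\<^sup>2)"
        by (intro mult_left_mono Vb xO) simp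
      also have "\<dots> = ennreal (M0\<^sup>2 / \<mu> * (cutoff \<epsilon> x * weight \<sigma> (x, 0) * (norm (f x))\<^sup>2))"
        using c0[of x] by (simp add: ennreal_mult[symmetric] c_def mult.commute)
      also have "\<dots> = ennreal (M0\<^sup>2 / \<mu>) * ennreal (cutoff \<epsilon> x * weight \<sigma> (x, 0) * (norm (f x))\<^sup>2)"
        using \<mu> cutoff_bounds weight_nonneg by (intro ennreal_mult) auto
      finally show ?thesis using True by simp
    next
      case False
      then show ?thesis by (simp add: R1_def I_def indicator_times)
    qed
  qed
  also have "\<dots> = ennreal (M0\<^sup>2 / \<mu>) * (\<integral>\<^sup>+x. ennreal (indicator chart_region x * (cutoff \<epsilon> x * weight \<sigma> (x, 0) * (norm (f x))\<^sup>2)) \<partial>lborel)"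
  proof (rule nn_integral_cmult)
    have "(\<lambda>x. indicator chart_region x *\<^sub>R c x) \<in> borel_measurable borel"
      using open_chart_region by (intro borel_measurable_continuous_on_indicator cfc) auto
    then have "(\<lambda>x. \<mu> * (indicator chart_region x *\<^sub>R c x)) \<in> borel_measurable borel" by measurable
    then show "(\<lambda>x. ennreal (indicator chart_region x * (cutoff \<epsilon> x * weight \<sigma> (x, 0) * (norm (f x))\<^sup>2))) \<in> borel_measurable lborel"
      using \<mu> by (simp add: c_def mult.left_commute)
  qed
  also have "(\<integral>\<^sup>+z. R2 z \<partial>lborel) = (\<integral>\<^sup>+t. (\<integral>\<^sup>+x. R2 (x, t) \<partial>lborel) \<partial>lborel)"
    using lborel_pair.nn_integral_snd[of R2] R2m by (simp add: lborel_prod)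
  also have "\<dots> = (\<integral>\<^sup>+t\<in>{0<..<T}. (\<integral>\<^sup>+x. ennreal (4 * M / \<epsilon> * (weight \<sigma> (x, t) * (v (x, t))\<^sup>2)) * indicator (strip (2 * \<epsilon>)) x \<partial>lborel) \<partial>lborel)"
  proof (rule nn_integral_cong)
    fix t :: real
    show "(\<integral>\<^sup>+x. R2 (x, t) \<partial>lborel) = (\<integral>\<^sup>+x. ennreal (4 * M / \<epsilon> * (weight \<sigma> (x, t) * (v (x, t))\<^sup>2)) * indicator (strip (2 * \<epsilon>)) x \<partial>lborel) * indicator {0<..<T} t"
    proof (cases "t \<in> {0<..<T}")
      case True
      then have "R2 (x, t) = ennreal (4 * M / \<epsilon> * (weight \<sigma> (x, t) * (v (x, t))\<^sup>2)) * indicator (strip (2 * \<epsilon>)) x" for x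
        by (simp add: R2_def indicator_def)
      then show ?thesis using True by simp
    next
      case False
      then show ?thesis by (simp add: R2_def indicator_times)
    qed
  qed
  finally show ?thesis by simp
qed

end

section \<open>The measure on the lateral boundary\<close>

abbreviation lateral_measure :: "(real^'n) set \<Rightarrow> ((real^'n) \<times> real) measure" where
  "lateral_measure \<Omega> \<equiv> surface_measure \<Omega> \<Otimes>\<^sub>M lborel"

lemma space_surface_measure: "space (surface_measure \<Omega>) = frontier \<Omega>"
  by (simp add: surface_measure_def space_restrict_space)

lemma nn_integral_surface_measure:
  fixes \<Omega> :: "(real^'n) set"
  assumes "\<Gamma> \<subseteq> frontier \<Omega>"
  shows "(\<integral>\<^sup>+y. f y * indicator \<Gamma> y \<partial>hausdorff_measure (CARD('n) - 1)) = (\<integral>\<^sup>+y. f y * indicator \<Gamma> y \<partial>surface_measure \<Omega>)"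
proof -
  have "(\<integral>\<^sup>+y. f y * indicator \<Gamma> y \<partial>surface_measure \<Omega>) =
      (\<integral>\<^sup>+y. f y * indicator \<Gamma> y * indicator (frontier \<Omega>) y \<partial>hausdorff_measure (CARD('n) - 1))"
    unfolding surface_measure_def by (rule nn_integral_restrict_space) simp
  also have "\<dots> = (\<integral>\<^sup>+y. f y * indicator \<Gamma> y \<partial>hausdorff_measure (CARD('n) - 1))"
    using assms by (intro nn_integral_cong) (auto simp: indicator_def)
  finally show ?thesis by simp
qed

lemma finite_measure_surface_measure:
  fixes \<Omega> :: "(real^'n) set"
  assumes "smooth_boundary \<Omega>" "open \<Omega>" "bounded \<Omega>"
  shows "finite_measure (surface_measure \<Omega>)"
proof
  have "emeasure (surface_measure \<Omega>) (frontier \<Omega>) = hausdorff_outer (CARD('n) - 1) (frontier \<Omega>)"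
    unfolding surface_measure_def by (subst emeasure_restrict_space) (simp_all add: emeasure_hausdorff_measure)
  then show "emeasure (surface_measure \<Omega>) (space (surface_measure \<Omega>)) \<noteq> \<infinity>"
    using hausdorff_outer_frontier_finite[OF assms] by (simp add: space_surface_measure)
qed

lemma measurable_lateral_measure:
  assumes "g \<in> borel_measurable borel"
  shows "g \<in> borel_measurable (lateral_measure \<Omega>)"
proof -
  have s: "(\<lambda>x. x) \<in> surface_measure \<Omega> \<rightarrow>\<^sub>M borel"
    unfolding surface_measure_def by (rule measurable_restrict_space1) (simp add: measurable_ident_sets)
  have "(\<lambda>z. (fst z, snd z)) \<in> lateral_measure \<Omega> \<rightarrow>\<^sub>M borel \<Otimes>\<^sub>M borel"
    by (intro measurable_Pair measurable_compose[OF measurable_fst s]) simp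
  then have "(\<lambda>z. z) \<in> lateral_measure \<Omega> \<rightarrow>\<^sub>M borel" by (simp add: borel_prod)
  from measurable_compose[OF this assms] show ?thesis by simp
qed

locale lateral_boundary =
  fixes \<Omega> \<Gamma> :: "(real^'n) set" and T :: real
  assumes smooth: "smooth_boundary \<Omega>" and opn: "open \<Omega>" and bdd: "bounded \<Omega>"
    and \<Gamma>_borel: "\<Gamma> \<in> sets borel" and \<Gamma>_sub: "\<Gamma> \<subseteq> frontier \<Omega>" and T: "0 < T"
begin

lemma lateral_subset: "\<Gamma> \<times> {0<..<T} \<subseteq> closure \<Omega> \<times> {0..T}"
  using \<Gamma>_sub by (auto simp: frontier_def)

lemma lateral_borel: "\<Gamma> \<times> {0<..<T} \<in> sets borel"
  using \<Gamma>_borel by (intro borel_Times) auto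

lemma lateral_measurable:
  fixes g :: "(real^'n) \<times> real \<Rightarrow> real"
  assumes "continuous_on (closure \<Omega> \<times> {0..T}) g"
  shows "(\<lambda>z. indicator (\<Gamma> \<times> {0<..<T}) z * g z) \<in> borel_measurable (lateral_measure \<Omega>)"
  using borel_measurable_continuous_on_indicator[OF lateral_borel continuous_on_subset[OF assms lateral_subset]]
  by (intro measurable_lateral_measure) simp

lemma lateral_measurable_ennreal:
  fixes g :: "(real^'n) \<times> real \<Rightarrow> real"
  assumes "continuous_on (closure \<Omega> \<times> {0..T}) g"
  shows "(\<lambda>z. ennreal (g z) * indicator (\<Gamma> \<times> {0<..<T}) z) \<in> borel_measurable (lateral_measure \<Omega>)"
proof -
  have "(\<lambda>z. ennreal (indicator (\<Gamma> \<times> {0<..<T}) z * g z)) \<in> borel_measurable (lateral_measure \<Omega>)"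
    using lateral_measurable[OF assms] by measurable
  moreover have "(\<lambda>z. ennreal (indicator (\<Gamma> \<times> {0<..<T}) z * g z)) = (\<lambda>z. ennreal (g z) * indicator (\<Gamma> \<times> {0<..<T}) z)"
    by (auto simp: indicator_def fun_eq_iff)
  ultimately show ?thesis by simp
qed

text \<open>The iterated integral has time outside, whereas the product measure integrates the surface variable
  last; the exchange uses that the surface measure is finite.\<close>

lemma nn_integral_lateral:
  fixes g :: "(real^'n) \<times> real \<Rightarrow> real"
  assumes "continuous_on (closure \<Omega> \<times> {0..T}) g"
  shows "(\<integral>\<^sup>+t\<in>{0<..<T}. (\<integral>\<^sup>+y. ennreal (g (y, t)) * indicator \<Gamma> y \<partial>hausdorff_measure (CARD('n) - 1)) \<partial>lborel) =
    (\<integral>\<^sup>+z. ennreal (g z) * indicator (\<Gamma> \<times> {0<..<T}) z \<partial>lateral_measure \<Omega>)"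
proof -
  interpret S: finite_measure "surface_measure \<Omega>"
    by (rule finite_measure_surface_measure[OF smooth opn bdd])
  interpret pair_sigma_finite "surface_measure \<Omega>" "lborel :: real measure" ..
  have "(\<integral>\<^sup>+z. ennreal (g z) * indicator (\<Gamma> \<times> {0<..<T}) z \<partial>lateral_measure \<Omega>) =
      (\<integral>\<^sup>+t. (\<integral>\<^sup>+y. ennreal (g (y, t)) * indicator (\<Gamma> \<times> {0<..<T}) (y, t) \<partial>surface_measure \<Omega>) \<partial>lborel)"
    by (rule nn_integral_snd[symmetric]) (rule lateral_measurable_ennreal[OF assms])
  also have "\<dots> = (\<integral>\<^sup>+t\<in>{0<..<T}. (\<integral>\<^sup>+y. ennreal (g (y, t)) * indicator \<Gamma> y \<partial>surface_measure \<Omega>) \<partial>lborel)"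
    by (intro nn_integral_cong) (auto simp: indicator_def)
  finally show ?thesis by (simp only: nn_integral_surface_measure[OF \<Gamma>_sub])
qed

lemma lateral_sets: "\<Gamma> \<in> sets (surface_measure \<Omega>)" "\<Gamma> \<times> {0<..<T} \<in> sets (lateral_measure \<Omega>)"
proof -
  show 1: "\<Gamma> \<in> sets (surface_measure \<Omega>)"
    unfolding surface_measure_def sets_restrict_space using \<Gamma>_sub \<Gamma>_borel by (auto simp: image_iff intro!: bexI[of _ \<Gamma>])
  show "\<Gamma> \<times> {0<..<T} \<in> sets (lateral_measure \<Omega>)"
    by (intro pair_measureI 1) auto
qed

lemma emeasure_lateral_finite: "emeasure (lateral_measure \<Omega>) (\<Gamma> \<times> {0<..<T}) < top"
proof -
  have "emeasure (lateral_measure \<Omega>) (\<Gamma> \<times> {0<..<T}) = emeasure (surface_measure \<Omega>) \<Gamma> * emeasure lborel {0<..<T}"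
    by (intro lborel.emeasure_pair_measure_Times lateral_sets) auto
  also have "\<dots> < top"
    using finite_measure.emeasure_finite[OF finite_measure_surface_measure[OF smooth opn bdd], of \<Gamma>] T
    by (simp add: ennreal_mult_less_top less_top)
  finally show ?thesis .
qed

text \<open>Finiteness matters here: a Bochner integral is 0 by convention for functions that are not integrable,
  and then the norm on the right would say nothing about the integral on the left.\<close>

lemma nn_integral_lateral_L2_norm:
  fixes v :: "(real^'n) \<times> real \<Rightarrow> real"
  assumes v: "continuous_on (closure \<Omega> \<times> {0..T}) v"
  shows "(\<integral>\<^sup>+z. ennreal ((v z)\<^sup>2) * indicator (\<Gamma> \<times> {0<..<T}) z \<partial>lateral_measure \<Omega>) =
    ennreal ((L2_norm (lateral_measure \<Omega>) (\<Gamma> \<times> {0<..<T}) v)\<^sup>2)" (is "?I = _")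
proof -
  have c: "continuous_on (closure \<Omega> \<times> {0..T}) (\<lambda>z. (v z)\<^sup>2)" by (intro continuous_intros v)
  have comp: "compact (closure \<Omega> \<times> {0..T})" using bdd by (intro compact_Times) auto
  obtain b where b: "\<And>z. z \<in> closure \<Omega> \<times> {0..T} \<Longrightarrow> norm ((v z)\<^sup>2) \<le> b"
    using compact_imp_bounded[OF compact_continuous_image[OF c comp]] unfolding bounded_iff by blast
  have "?I \<le> (\<integral>\<^sup>+z. ennreal b * indicator (\<Gamma> \<times> {0<..<T}) z \<partial>lateral_measure \<Omega>)"
  proof (rule nn_integral_mono)
    fix z
    show "ennreal ((v z)\<^sup>2) * indicator (\<Gamma> \<times> {0<..<T}) z \<le> ennreal b * indicator (\<Gamma> \<times> {0<..<T}) z"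
      using b[of z] lateral_subset by (cases "z \<in> \<Gamma> \<times> {0<..<T}") (auto intro!: ennreal_leI)
  qed
  also have "\<dots> = ennreal b * emeasure (lateral_measure \<Omega>) (\<Gamma> \<times> {0<..<T})"
    using lateral_sets(2) by (rule nn_integral_cmult_indicator)
  also have "\<dots> < top" using emeasure_lateral_finite by (simp add: ennreal_mult_less_top)
  finally have fin: "?I < top" .
  have "L2_norm (lateral_measure \<Omega>) (\<Gamma> \<times> {0<..<T}) v =
      sqrt (\<integral>z. indicator (\<Gamma> \<times> {0<..<T}) z * (v z)\<^sup>2 \<partial>lateral_measure \<Omega>)"
    by (simp add: L2_norm_def set_lebesgue_integral_def)
  also have "(\<integral>z. indicator (\<Gamma> \<times> {0<..<T}) z * (v z)\<^sup>2 \<partial>lateral_measure \<Omega>) =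
      enn2real (\<integral>\<^sup>+z. ennreal (indicator (\<Gamma> \<times> {0<..<T}) z * (v z)\<^sup>2) \<partial>lateral_measure \<Omega>)"
    by (rule integral_eq_nn_integral[OF lateral_measurable[OF c]]) auto
  also have "(\<integral>\<^sup>+z. ennreal (indicator (\<Gamma> \<times> {0<..<T}) z * (v z)\<^sup>2) \<partial>lateral_measure \<Omega>) = ?I"
    by (intro nn_integral_cong) (auto simp: indicator_def)
  finally have "(L2_norm (lateral_measure \<Omega>) (\<Gamma> \<times> {0<..<T}) v)\<^sup>2 = enn2real ?I" by simp
  then show ?thesis using fin by (simp add: ennreal_enn2real_if)
qed

end

section \<open>Stability near the boundary point\<close>

lemma integrable_indicator_open_bounded:
  fixes g :: "'a::euclidean_space \<Rightarrow> real"
  assumes "open U" "bounded U" "continuous_on U g" "\<And>x. x \<in> U \<Longrightarrow> \<bar>g x\<bar> \<le> B"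
  shows "integrable lborel (\<lambda>x. indicator U x * g x)"
proof (rule integrableI_bounded_set[where A = U and B = B])
  show "(\<lambda>x. indicator U x * g x) \<in> borel_measurable lborel"
    using borel_measurable_continuous_on_indicator[of U g] assms by simp
  show "emeasure lborel U < \<infinity>" by (rule emeasure_bounded_finite[OF assms(2)])
  show "AE x in lborel. x \<in> U \<longrightarrow> norm (indicator U x * g x) \<le> B"
    using assms(4) by simp
qed (use assms in auto)

context weighted_chart
begin

definition weight_bound :: "real \<Rightarrow> real" where
  "weight_bound \<sigma> = exp (\<sigma> * R) * (\<epsilon>0 + R)\<^sup>2"

lemma weight_bound_pos: "0 < weight_bound \<sigma>"
  using kr_pos R_pos by (simp add: weight_bound_def)

text \<open>As the width of the strip tends to 0, the mean value of the weighted square over the strip is controlled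
  by the integral over the boundary: each point of the strip lies within \<open>4 * \<epsilon>\<close> of its projection, and
  uniform continuity up to the boundary costs an arbitrarily small \<open>\<omega>\<close>. The factor \<open>4 * M / \<epsilon>\<close>
  is compensated by the thickness of the strip.\<close>

lemma boundary_layer:
  fixes v :: "(real^'n) \<times> real \<Rightarrow> real"
  assumes v: "continuous_on (closure \<Omega> \<times> {0..T}) v" and "0 \<le> \<sigma>" "0 < \<omega>"
    and \<Gamma>: "frontier \<Omega> \<inter> ball x0 R \<subseteq> \<Gamma>"
  shows "\<forall>\<^sub>F \<epsilon> in at_right 0.
    (\<integral>\<^sup>+t\<in>{0<..<T}. (\<integral>\<^sup>+x. ennreal (4 * M / \<epsilon> * (weight \<sigma> (x, t) * (v (x, t))\<^sup>2)) * indicator (strip (2 * \<epsilon>)) x \<partial>lborel) \<partial>lborel) \<le>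
    (\<integral>\<^sup>+t\<in>{0<..<T}.
      (\<integral>\<^sup>+y. ennreal (16 * M * tube_const CARD('n) * (weight_bound \<sigma> * (v (y, t))\<^sup>2 + \<omega>)) * indicator \<Gamma> y \<partial>hausdorff_measure (CARD('n) - 1)) \<partial>lborel)"
proof -
  let ?H = "hausdorff_measure (CARD('n) - 1) :: (real^'n) measure"
  define F where "F z = weight \<sigma> z * (v z)\<^sup>2" for z
  have Fc: "continuous_on (closure \<Omega> \<times> {0..T}) F"
    unfolding F_def by (intro continuous_intros weight_cont v)
  have comp: "compact (closure \<Omega> \<times> {0..T})" using bounded_region by (intro compact_Times) auto
  obtain \<delta> where \<delta>: "0 < \<delta>" "\<And>z z'. z \<in> closure \<Omega> \<times> {0..T} \<Longrightarrow> z' \<in> closure \<Omega> \<times> {0..T} \<Longrightarrow> dist z' z < \<delta> \<Longrightarrow> dist (F z') (F z) < \<omega>"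
    using compact_uniformly_continuous[OF Fc comp] \<open>0 < \<omega>\<close> unfolding uniformly_continuous_on_def by metis
  define \<epsilon>1 where "\<epsilon>1 = min (\<delta> / 4) (R / 8)"
  have "0 < \<epsilon>1" using \<delta> R_pos by (simp add: \<epsilon>1_def)
  have main: "(\<integral>\<^sup>+t\<in>{0<..<T}. (\<integral>\<^sup>+x. ennreal (4 * M / \<epsilon> * F (x, t)) * indicator (strip (2 * \<epsilon>)) x \<partial>lborel) \<partial>lborel) \<le>
    (\<integral>\<^sup>+t\<in>{0<..<T}.
      (\<integral>\<^sup>+y. ennreal (16 * M * tube_const CARD('n) * (weight_bound \<sigma> * (v (y, t))\<^sup>2 + \<omega>)) * indicator \<Gamma> y \<partial>?H) \<partial>lborel)"
    if \<epsilon>: "0 < \<epsilon>" "\<epsilon> < \<epsilon>1" for \<epsilon>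
  proof -
    have \<epsilon>R: "0 < 2 * \<epsilon>" "2 * \<epsilon> \<le> R / 4" "4 * \<epsilon> < \<delta>" using \<epsilon> by (auto simp: \<epsilon>1_def)
    define a where "a = 4 * M / \<epsilon>"
    have a: "0 < a" using \<epsilon> M_pos by (simp add: a_def)
    have fixed: "(\<integral>\<^sup>+x. ennreal (a * F (x, t)) * indicator (strip (2 * \<epsilon>)) x \<partial>lborel) \<le>
        (\<integral>\<^sup>+y. ennreal (16 * M * tube_const CARD('n) * (weight_bound \<sigma> * (v (y, t))\<^sup>2 + \<omega>)) * indicator \<Gamma> y \<partial>?H)"
      if t: "t \<in> {0<..<T}" for t
    proof -
      have [measurable]: "frontier \<Omega> \<inter> ball x0 R \<in> sets borel" by simp
      define f where "f y = ennreal (indicator (closure \<Omega>) y * (F (y, t) + \<omega>))" for y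
      have "continuous_on (closure \<Omega>) (\<lambda>y. F (y, t) + \<omega>)"
        by (intro continuous_intros continuous_on_compose2[OF Fc]) (use t in auto)
      then have fm[measurable]: "f \<in> borel_measurable borel"
        using borel_measurable_continuous_on_indicator[of "closure \<Omega>" "\<lambda>y. F (y, t) + \<omega>"]
        unfolding f_def by simp
      have F0: "0 \<le> F z" for z by (simp add: F_def weight_nonneg)
      have "(\<integral>\<^sup>+x. ennreal (a * F (x, t)) * indicator (strip (2 * \<epsilon>)) x \<partial>lborel) \<le>
          ennreal (tube_const CARD('n) * (2 * (2 * \<epsilon>))) *
          (\<integral>\<^sup>+y. (ennreal a * f y) * indicator (frontier \<Omega> \<inter> ball x0 R) y \<partial>?H)"
      proof (rule nn_integral_strip_le[OF \<epsilon>R(1,2)])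
        fix x y assume x: "x \<in> strip (2 * \<epsilon>)" and y: "y \<in> frontier \<Omega> \<inter> ball x0 R" and d: "dist x y \<le> 2 * (2 * \<epsilon>)"
        have yc: "y \<in> closure \<Omega>" using y by (simp add: frontier_def)
        have xc: "x \<in> closure \<Omega>" using x strip_subset_chart_region closure_subset by (fastforce simp: chart_region_def)
        have "dist (x, t) (y, t) < \<delta>" using d \<epsilon>R by (simp add: dist_Pair_Pair)
        then have "dist (F (x, t)) (F (y, t)) < \<omega>" using \<delta>(2)[of "(y, t)" "(x, t)"] xc yc t by auto
        then have "F (x, t) \<le> F (y, t) + \<omega>" by (simp add: dist_real_def)
        then have "a * F (x, t) \<le> a * (F (y, t) + \<omega>)" using a by (intro mult_left_mono) auto
        then have "ennreal (a * F (x, t)) \<le> ennreal (a * (F (y, t) + \<omega>))" by (rule ennreal_leI)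
        also have "\<dots> = ennreal a * f y"
          using yc a F0[of "(y, t)"] \<open>0 < \<omega>\<close> by (simp add: f_def ennreal_mult)
        finally show "ennreal (a * F (x, t)) \<le> ennreal a * f y" .
      qed measurable
      also have "(\<integral>\<^sup>+y. (ennreal a * f y) * indicator (frontier \<Omega> \<inter> ball x0 R) y \<partial>?H) =
          ennreal a * (\<integral>\<^sup>+y. f y * indicator (frontier \<Omega> \<inter> ball x0 R) y \<partial>?H)"
        unfolding mult.assoc by (rule nn_integral_cmult) (simp cong: measurable_cong_sets)
      also have "ennreal (tube_const CARD('n) * (2 * (2 * \<epsilon>))) * (ennreal a * (\<integral>\<^sup>+y. f y * indicator (frontier \<Omega> \<inter> ball x0 R) y \<partial>?H)) =
          ennreal (16 * M * tube_const CARD('n)) * (\<integral>\<^sup>+y. f y * indicator (frontier \<Omega> \<inter> ball x0 R) y \<partial>?H)"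
      proof -
        have "ennreal (tube_const CARD('n) * (2 * (2 * \<epsilon>))) * ennreal a = ennreal (tube_const CARD('n) * (2 * (2 * \<epsilon>)) * a)"
          using tube_const_pos[of "CARD('n)"] \<epsilon> a by (intro ennreal_mult[symmetric]) auto
        also have "tube_const CARD('n) * (2 * (2 * \<epsilon>)) * a = 16 * M * tube_const CARD('n)"
          using \<epsilon> by (simp add: a_def)
        finally show ?thesis by (simp add: mult.assoc[symmetric])
      qed
      also have "\<dots> = (\<integral>\<^sup>+y. ennreal (16 * M * tube_const CARD('n)) * (f y * indicator (frontier \<Omega> \<inter> ball x0 R) y) \<partial>?H)"
        by (rule nn_integral_cmult[symmetric]) (simp cong: measurable_cong_sets)
      also have "\<dots> \<le> (\<integral>\<^sup>+y. ennreal (16 * M * tube_const CARD('n) * (weight_bound \<sigma> * (v (y, t))\<^sup>2 + \<omega>)) * indicator \<Gamma> y \<partial>?H)"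
      proof (intro nn_integral_mono)
        fix y
        have c: "0 \<le> 16 * M * tube_const CARD('n)" using M_pos tube_const_pos[of "CARD('n)"] by simp
        show "ennreal (16 * M * tube_const CARD('n)) * (f y * indicator (frontier \<Omega> \<inter> ball x0 R) y) \<le>
          ennreal (16 * M * tube_const CARD('n) * (weight_bound \<sigma> * (v (y, t))\<^sup>2 + \<omega>)) * indicator \<Gamma> y"
        proof (cases "y \<in> frontier \<Omega> \<inter> ball x0 R")
          case True
          then have "weight \<sigma> (y, t) \<le> weight_bound \<sigma>"
            unfolding weight_bound_def using t \<open>0 \<le> \<sigma>\<close> by (intro weight_le) auto
          then have "F (y, t) \<le> weight_bound \<sigma> * (v (y, t))\<^sup>2"
            unfolding F_def by (intro mult_right_mono) auto
          then have le: "16 * M * tube_const CARD('n) * (F (y, t) + \<omega>) \<le> 16 * M * tube_const CARD('n) * (weight_bound \<sigma> * (v (y, t))\<^sup>2 + \<omega>)"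
            using c by (intro mult_left_mono) auto
          have y: "y \<in> closure \<Omega>" "y \<in> \<Gamma>" using True \<Gamma> by (auto simp: frontier_def)
          have "ennreal (16 * M * tube_const CARD('n)) * f y = ennreal (16 * M * tube_const CARD('n) * (F (y, t) + \<omega>))"
            using y F0[of "(y, t)"] \<open>0 < \<omega>\<close> c by (simp add: f_def ennreal_mult'')
          then show ?thesis using True y ennreal_leI[OF le] by simp
        qed simp
      qed
      finally show ?thesis .
    qed
    show ?thesis
      unfolding a_def[symmetric] by (rule nn_integral_mono) (use fixed in \<open>auto simp: indicator_def\<close>)
  qed
  show ?thesis
    unfolding eventually_at_right_field
    using main \<open>0 < \<epsilon>1\<close> by (intro exI[of _ \<epsilon>1]) (auto simp: F_def)
qed


lemma chart_region_bounded: "bounded chart_region" and chart_region_closure: "chart_region \<subseteq> closure \<Omega>"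
  using bounded_region closure_subset by (auto simp: chart_region_def intro: bounded_Int)

lemma weight_initial_cont: "continuous_on A (\<lambda>x. weight \<sigma> (x, 0))"
  by (rule continuous_on_compose2[OF weight_cont(1)[of UNIV]]) (auto intro!: continuous_intros)

lemma integrable_chart_region_weighted:
  assumes "continuous_on (closure \<Omega>) g" "0 \<le> \<sigma>"
  shows "integrable lborel (\<lambda>x. indicator chart_region x * (cutoff \<epsilon> x * weight \<sigma> (x, 0) * (g x :: real)))"
proof -
  have "compact (closure \<Omega>)" using bounded_region by simp
  then obtain b where b: "\<And>x. x \<in> closure \<Omega> \<Longrightarrow> norm (g x) \<le> b"
    using compact_imp_bounded[OF compact_continuous_image[OF assms(1)]] unfolding bounded_iff by blast
  show ?thesis
  proof (rule integrable_indicator_open_bounded[OF open_chart_region chart_region_bounded])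
    show "continuous_on chart_region (\<lambda>x. cutoff \<epsilon> x * weight \<sigma> (x, 0) * g x)"
      by (intro continuous_intros weight_initial_cont continuous_on_subset[OF assms(1) chart_region_closure]
          continuous_on_subset[OF cutoff_cont(1)]) (auto simp: chart_region_def)
    fix x assume x: "x \<in> chart_region"
    have "weight \<sigma> (x, 0) \<le> weight_bound \<sigma>"
      unfolding weight_bound_def using x assms by (intro weight_le) (auto simp: chart_region_def)
    then have "cutoff \<epsilon> x * weight \<sigma> (x, 0) * \<bar>g x\<bar> \<le> 1 * weight_bound \<sigma> * b"
      using cutoff_bounds weight_nonneg b[of x] x chart_region_closure weight_bound_pos[of \<sigma>]
      by (intro mult_mono) (auto intro: mult_nonneg_nonneg)
    then show "\<bar>cutoff \<epsilon> x * weight \<sigma> (x, 0) * g x\<bar> \<le> 1 * weight_bound \<sigma> * b"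
      using cutoff_bounds(1)[of \<epsilon> x] weight_nonneg[of \<sigma> "(x, 0)"] by (simp add: abs_mult)
  qed
qed

definition cone_size :: real where
  "cone_size = min r (min (\<epsilon>0 / 4) (\<epsilon>0 / (4 * \<kappa>)))"

text \<open>The subdomain of the theorem: a cone with vertex \<open>x0\<close> pointing into \<open>\<Omega>\<close>, so short that
  \<open>\<psi> (x, 0) \<ge> \<epsilon>0 / 2\<close> on it. It depends only on the chart, \<open>\<delta>0\<close> and \<open>M\<close>; it is connected because it is
  convex, and its closure meets the boundary of \<open>\<Omega>\<close> only in \<open>x0\<close>.\<close>

definition cone :: "(real^'n) set" where
  "cone = {x. norm (x - x0) < cone_size \<and> \<nu> \<bullet> (x - x0) < - norm (x - x0) / 2}"

lemma cone_size_bounds: "0 < cone_size" "cone_size \<le> r" "cone_size \<le> \<epsilon>0 / 4" "cone_size \<le> \<epsilon>0 / (4 * \<kappa>)" "cone_size < R"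
  using kr_pos R_pos by (auto simp: cone_size_def r_def min_less_iff_disj)

lemma rho_cone_le:
  assumes "norm (x - x0) < R" "\<nu> \<bullet> (x - x0) \<le> - norm (x - x0) / 2"
  shows "\<rho> x \<le> - (3 / 8) * norm (x - x0)"
proof -
  have x: "x \<in> ball x0 R" using assms by (simp add: dist_norm norm_minus_commute)
  have "\<bar>\<rho> x - \<rho> x0 - \<nu> \<bullet> (x - x0)\<bar> \<le> e * norm (x - x0)"
    using rho_almost_affine[OF x] R_pos by simp
  moreover have "e * norm (x - x0) \<le> 1/8 * norm (x - x0)" using e_le by (intro mult_right_mono) auto
  ultimately show ?thesis using assms(2) rho_center by linarith
qed

lemma cone_subset_chart_region: "cone \<subseteq> chart_region"
proof
  fix x assume x: "x \<in> cone"
  then have n: "norm (x - x0) < R" using cone_size_bounds by (auto simp: cone_def)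
  have "x \<noteq> x0" using x by (auto simp: cone_def)
  then have "0 < norm (x - x0)" by simp
  moreover have "\<rho> x \<le> - (3 / 8) * norm (x - x0)" using rho_cone_le[OF n] x by (simp add: cone_def)
  ultimately have "\<rho> x < 0" by linarith
  then show "x \<in> chart_region" using n region by (auto simp: chart_region_def dist_norm norm_minus_commute)
qed

lemma open_cone: "open cone"
  unfolding cone_def by (intro open_Collect_conj open_Collect_less continuous_intros) auto

lemma convex_cone: "convex cone"
proof (rule convexI)
  fix x y and u w :: real
  assume x: "x \<in> cone" and y: "y \<in> cone" and u: "0 \<le> u" "0 \<le> w" "u + w = 1"
  have eq: "u *\<^sub>R x + w *\<^sub>R y - x0 = u *\<^sub>R (x - x0) + w *\<^sub>R (y - x0)"
    using u(3) by (simp add: algebra_simps) (metis scaleR_add_left scaleR_one)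
  have n: "norm (u *\<^sub>R x + w *\<^sub>R y - x0) \<le> u * norm (x - x0) + w * norm (y - x0)"
    unfolding eq using norm_triangle_ineq[of "u *\<^sub>R (x - x0)" "w *\<^sub>R (y - x0)"] u by simp
  have "u * norm (x - x0) + w * norm (y - x0) < cone_size"
    using convex_bound_lt[of "norm (x - x0)" cone_size "norm (y - x0)" u w] x y u by (simp add: cone_def)
  moreover have "u * (\<nu> \<bullet> (x - x0) + norm (x - x0) / 2) + w * (\<nu> \<bullet> (y - x0) + norm (y - x0) / 2) < 0"
    using convex_bound_lt[of "\<nu> \<bullet> (x - x0) + norm (x - x0) / 2" 0 "\<nu> \<bullet> (y - x0) + norm (y - x0) / 2" u w] x y u
    by (simp add: cone_def)
  moreover have "\<nu> \<bullet> (u *\<^sub>R x + w *\<^sub>R y - x0) = u * (\<nu> \<bullet> (x - x0)) + w * (\<nu> \<bullet> (y - x0))"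
    unfolding eq by (simp add: inner_add_right)
  ultimately show "u *\<^sub>R x + w *\<^sub>R y \<in> cone"
    using n unfolding cone_def by (simp add: algebra_simps)
qed

lemma center_in_closure_cone: "x0 \<in> closure cone"
  unfolding closure_approachable
proof (intro allI impI)
  fix d :: real assume "0 < d"
  define s where "s = min d cone_size / 2"
  have s: "0 < s" "s < d" "s < cone_size" using \<open>0 < d\<close> cone_size_bounds by (auto simp: s_def)
  have "x0 - s *\<^sub>R \<nu> \<in> cone"
    using s norm_nu by (simp add: cone_def dot_square_norm)
  moreover have "dist (x0 - s *\<^sub>R \<nu>) x0 < d" using s norm_nu by (simp add: dist_norm)
  ultimately show "\<exists>y\<in>cone. dist y x0 < d" by blast
qed

lemma domain_cone: "domain cone"
  using open_cone convex_connected[OF convex_cone] center_in_closure_cone by (auto simp: domain_def)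

lemma frontier_cone_Int: "frontier cone \<inter> frontier \<Omega> = {x0}"
proof
  have "x0 \<notin> cone" by (simp add: cone_def)
  then show "{x0} \<subseteq> frontier cone \<inter> frontier \<Omega>"
    using center_in_closure_cone open_cone center_in_frontier by (simp add: frontier_def interior_open)
  show "frontier cone \<inter> frontier \<Omega> \<subseteq> {x0}"
  proof
    fix y assume y: "y \<in> frontier cone \<inter> frontier \<Omega>"
    have "closed {x. norm (x - x0) \<le> cone_size \<and> \<nu> \<bullet> (x - x0) \<le> - norm (x - x0) / 2}"
      by (intro closed_Collect_conj closed_Collect_le continuous_intros) auto
    then have "closure cone \<subseteq> {x. norm (x - x0) \<le> cone_size \<and> \<nu> \<bullet> (x - x0) \<le> - norm (x - x0) / 2}"
      by (rule closure_minimal[rotated]) (auto simp: cone_def)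
    then have c: "norm (y - x0) < R" "\<nu> \<bullet> (y - x0) \<le> - norm (y - x0) / 2"
      using y cone_size_bounds by (auto simp: frontier_def)
    then have "\<rho> y = 0" using mem_frontier_iff[of y] y by (simp add: dist_norm norm_minus_commute)
    then show "y \<in> {x0}" using rho_cone_le[OF c] by simp
  qed
qed

lemma weight_ge_on_cone:
  assumes "x \<in> cone" "0 \<le> \<sigma>"
  shows "exp (- (\<sigma> * R)) * (\<epsilon>0 / 2)\<^sup>2 \<le> weight \<sigma> (x, 0)"
proof -
  define d where "d = norm (x - x0)"
  have d: "0 \<le> d" "d < cone_size" using assms by (auto simp: d_def cone_def)
  have ge: "- d \<le> \<nu> \<bullet> (x - x0)"
    using Cauchy_Schwarz_ineq2[of \<nu> "x - x0"] norm_nu by (simp add: d_def)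
  have "curv * (d * d) \<le> curv * (r * (\<epsilon>0 / (4 * \<kappa>)))"
    using d cone_size_bounds kr_pos by (intro mult_left_mono mult_mono) auto
  also have "\<dots> = \<epsilon>0 / 4" using kr_pos by (simp add: curv_def)
  finally have "\<epsilon>0 / 2 \<le> \<epsilon>0 + \<nu> \<bullet> (x - x0) - curv * (d * d)" using ge d cone_size_bounds by linarith
  moreover have "(x - x0) \<bullet> (x - x0) = d * d" by (simp add: d_def dot_square_norm power2_eq_square)
  ultimately have "\<epsilon>0 / 2 \<le> \<psi> (x, 0)" by (simp add: \<psi>_def)
  then have "(\<epsilon>0 / 2)\<^sup>2 \<le> pos_sq (\<psi> (x, 0))"
    unfolding pos_sq_def using kr_pos by (intro power_mono) auto
  moreover have "exp (- (\<sigma> * R)) \<le> exp (\<sigma> * (\<nu> \<bullet> (x - x0)))"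
  proof -
    have "- R \<le> \<nu> \<bullet> (x - x0)" using ge d cone_size_bounds by linarith
    from mult_left_mono[OF this assms(2)] show ?thesis by simp
  qed
  ultimately show ?thesis unfolding weight_def by (intro mult_mono) auto
qed

lemma cutoff_on_cone:
  assumes "x \<in> cone" "0 < \<epsilon>" "8 * \<epsilon> \<le> norm (x - x0)"
  shows "cutoff \<epsilon> x = 1"
proof -
  have "\<rho> x \<le> - (3 / 8) * norm (x - x0)"
    using assms cone_size_bounds by (intro rho_cone_le) (auto simp: cone_def)
  then have "\<rho> x \<le> - (2 * \<epsilon>)" using assms by linarith
  then show ?thesis using assms unfolding cutoff_def by (intro smooth_step_one) (simp add: field_simps)
qed

text \<open>On the cone the weight is bounded below, and the cutoff is 1 except in the ball of radius \<open>8 * \<epsilon>\<close>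
  about the vertex, where \<open>f\<close> is bounded. The error disappears as \<open>\<epsilon>\<close> tends to 0.\<close>

lemma integral_cone_le:
  fixes f :: "real^'n \<Rightarrow> real"
  assumes f: "continuous_on (closure \<Omega>) f" "\<And>x. x \<in> closure \<Omega> \<Longrightarrow> 0 \<le> f x" "\<And>x. x \<in> closure \<Omega> \<Longrightarrow> f x \<le> B"
    and "0 \<le> \<sigma>" "0 < \<epsilon>"
  shows "exp (- (\<sigma> * R)) * (\<epsilon>0 / 2)\<^sup>2 * (\<integral>x. indicator cone x * f x \<partial>lborel) \<le>
    (\<integral>x. indicator chart_region x * (cutoff \<epsilon> x * weight \<sigma> (x, 0) * f x) \<partial>lborel) +
    exp (- (\<sigma> * R)) * (\<epsilon>0 / 2)\<^sup>2 * (B * measure lborel (ball x0 (8 * \<epsilon>)))"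
proof -
  define m where "m = exp (- (\<sigma> * R)) * (\<epsilon>0 / 2)\<^sup>2"
  have m: "0 \<le> m" by (simp add: m_def)
  have i1: "integrable lborel (\<lambda>x. indicator cone x * f x)"
  proof (rule integrable_indicator_open_bounded[OF open_cone])
    show "bounded cone" using bounded_subset[OF chart_region_bounded cone_subset_chart_region] .
    show "continuous_on cone f" using continuous_on_subset[OF f(1)] cone_subset_chart_region chart_region_closure by blast
    show "\<bar>f x\<bar> \<le> B" if "x \<in> cone" for x using that f cone_subset_chart_region chart_region_closure by (auto simp: subset_iff)
  qed
  have i2: "integrable lborel (\<lambda>x. indicator chart_region x * (cutoff \<epsilon> x * weight \<sigma> (x, 0) * f x))"
    by (rule integrable_chart_region_weighted[OF f(1) assms(4)])
  have i3: "integrable lborel (\<lambda>x. indicator (ball x0 (8 * \<epsilon>)) x * B)"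
    by (rule integrable_indicator_open_bounded[where B = "\<bar>B\<bar>"]) auto
  have "m * (\<integral>x. indicator cone x * f x \<partial>lborel) = (\<integral>x. m * (indicator cone x * f x) \<partial>lborel)" by simp
  also have "\<dots> \<le> (\<integral>x. indicator chart_region x * (cutoff \<epsilon> x * weight \<sigma> (x, 0) * f x) + m * (indicator (ball x0 (8 * \<epsilon>)) x * B) \<partial>lborel)"
  proof (rule integral_mono)
    show "integrable lborel (\<lambda>x. m * (indicator cone x * f x))" using i1 by simp
    show "integrable lborel (\<lambda>x. indicator chart_region x * (cutoff \<epsilon> x * weight \<sigma> (x, 0) * f x) + m * (indicator (ball x0 (8 * \<epsilon>)) x * B))"
      by (intro Bochner_Integration.integrable_add i2 integrable_mult_right i3)
    fix x
    show "m * (indicator cone x * f x) \<le> indicator chart_region x * (cutoff \<epsilon> x * weight \<sigma> (x, 0) * f x) + m * (indicator (ball x0 (8 * \<epsilon>)) x * B)"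
    proof (cases "x \<in> chart_region")
      case True
      then have fx: "0 \<le> f x" "f x \<le> B" using f chart_region_closure by auto
      have g: "0 \<le> cutoff \<epsilon> x * weight \<sigma> (x, 0) * f x"
        using cutoff_bounds weight_nonneg fx by simp
      have B: "0 \<le> m * B" using m fx by simp
      show ?thesis
      proof (cases "x \<in> cone")
        case inD: True
        show ?thesis
        proof (cases "8 * \<epsilon> \<le> norm (x - x0)")
          case True
          have "m * f x \<le> weight \<sigma> (x, 0) * f x"
            using weight_ge_on_cone[OF inD assms(4)] fx by (intro mult_right_mono) (simp_all add: m_def)
          then show ?thesis
            using cutoff_on_cone[OF inD assms(5) True] inD \<open>x \<in> chart_region\<close> B by (simp add: indicator_def)
        next
          case False
          then have "x \<in> ball x0 (8 * \<epsilon>)" by (simp add: dist_norm norm_minus_commute)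
          moreover have "m * f x \<le> m * B" using m fx by (intro mult_left_mono)
          ultimately show ?thesis using g inD \<open>x \<in> chart_region\<close> by simp
        qed
      next
        case False
        then show ?thesis using g B True by (simp add: indicator_def)
      qed
    next
      case False
      then have "x \<notin> cone" using cone_subset_chart_region by blast
      moreover have "0 \<le> B" using f(2,3)[of x0] center_in_frontier by (force simp: frontier_def)
      ultimately show ?thesis using m False by simp
    qed
  qed
  also have "\<dots> = (\<integral>x. indicator chart_region x * (cutoff \<epsilon> x * weight \<sigma> (x, 0) * f x) \<partial>lborel) + m * (\<integral>x. indicator (ball x0 (8 * \<epsilon>)) x * B \<partial>lborel)"
    using i2 i3 by simp
  also have "(\<integral>x. indicator (ball x0 (8 * \<epsilon>)) x * B \<partial>lborel) = B * measure lborel (ball x0 (8 * \<epsilon>))"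
    by simp
  finally show ?thesis by (simp add: m_def)
qed


text \<open>The energy estimates for all \<open>k\<close> are added. By the determinant condition the left-hand side dominates
  \<open>c\<close> times the weighted square of \<open>f\<close>; the choice of \<open>\<mu>\<close> makes the source terms add up to \<open>c / 2\<close> times
  the same quantity, which is absorbed; and \<open>\<sigma>\<close> is the value that the energy estimate then requires. The
  absorption takes place for fixed cutoff width \<open>\<epsilon>\<close>, before the limits \<open>\<epsilon> \<rightarrow> 0\<close> and \<open>\<omega> \<rightarrow> 0\<close>.\<close>

lemma stability_on_cone:
  fixes v :: "'n \<Rightarrow> (real^'n) \<times> real \<Rightarrow> real" and A :: "'n \<Rightarrow> real^'n \<Rightarrow> real^'n"
    and f :: "real^'n \<Rightarrow> real^'n" and p :: "real^'n \<Rightarrow> real"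
  assumes lat: "lateral_boundary \<Omega> \<Gamma> T" and \<Gamma>: "frontier \<Omega> \<inter> ball x0 R \<subseteq> \<Gamma>"
    and H: "field_ok H" and p: "\<And>x. x \<in> \<Omega> \<Longrightarrow> \<bar>p x\<bar> \<le> p0" "0 \<le> p0"
    and f: "continuous_on (closure \<Omega>) f"
    and v: "\<And>k. spacetime_C1 \<Omega> T (v k) (P k) (Q k)"
    and V: "\<And>k. continuous_on (closure \<Omega> \<times> {0..T}) (V k)"
    and eq: "\<And>k x t. x \<in> \<Omega> \<Longrightarrow> t \<in> {0<..<T} \<Longrightarrow>
      Q k (x, t) + H x \<bullet> P k (x, t) + p x * v k (x, t) = f x \<bullet> V k (x, t)"
    and Vb: "\<And>k x. x \<in> \<Omega> \<Longrightarrow> (\<integral>\<^sup>+t\<in>{0<..<T}. ennreal ((norm (V k (x, t)))\<^sup>2) \<partial>lborel) \<le> ennreal (M0\<^sup>2)"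
    and init: "\<And>k x. x \<in> \<Omega> \<Longrightarrow> v k (x, 0) = f x \<bullet> A k x"
    and c: "0 < c" "\<And>x g. x \<in> \<Omega> \<Longrightarrow> c * (norm g)\<^sup>2 \<le> (\<Sum>k\<in>UNIV. (g \<bullet> A k x)\<^sup>2)"
    and "0 < M0"
  defines "\<mu> \<equiv> 2 * real CARD('n) * M0\<^sup>2 / c"
  defines "\<sigma> \<equiv> 2 / \<delta>0 * (real CARD('n) * M + 2 * p0 + \<mu>)"
  shows "c / 2 * (exp (- (\<sigma> * R)) * (\<epsilon>0 / 2)\<^sup>2) * (\<integral>x. indicator cone x * (norm (f x))\<^sup>2 \<partial>lborel) \<le>
    16 * M * tube_const CARD('n) * weight_bound \<sigma> * (\<Sum>k\<in>UNIV. (L2_norm (lateral_measure \<Omega>) (\<Gamma> \<times> {0<..<T}) (v k))\<^sup>2)"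
proof -
  interpret L: lateral_boundary \<Omega> \<Gamma> T by (rule lat)
  have \<mu>: "0 < \<mu>" using c \<open>0 < M0\<close> by (simp add: \<mu>_def)
  have \<sigma>: "0 \<le> \<sigma>" "real CARD('n) * M + 2 * p0 + \<mu> \<le> \<sigma> * \<delta>0 / 2"
    using \<mu> M_pos p(2) \<delta>0_pos by (simp_all add: \<sigma>_def)
  define m where "m = exp (- (\<sigma> * R)) * (\<epsilon>0 / 2)\<^sup>2"
  define K where "K = 16 * M * tube_const CARD('n)"
  have K: "0 < K" using M_pos tube_const_pos[of "CARD('n)"] by (simp add: K_def)
  define b where "b k = (L2_norm (lateral_measure \<Omega>) (\<Gamma> \<times> {0<..<T}) (v k))\<^sup>2" for k
  define h where "h = enn2real (emeasure (lateral_measure \<Omega>) (\<Gamma> \<times> {0<..<T}))"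
  have h: "emeasure (lateral_measure \<Omega>) (\<Gamma> \<times> {0<..<T}) = ennreal h" "0 \<le> h"
    using L.emeasure_lateral_finite by (simp_all add: h_def)
  define ff where "ff x = (norm (f x))\<^sup>2" for x
  have ffc: "continuous_on (closure \<Omega>) ff" unfolding ff_def by (intro continuous_intros f)
  have "compact (closure \<Omega>)" using bounded_region by simp
  then obtain B where B: "\<And>x. x \<in> closure \<Omega> \<Longrightarrow> norm (ff x) \<le> B"
    using compact_imp_bounded[OF compact_continuous_image[OF ffc]] unfolding bounded_iff by blast
  define a where "a \<epsilon> = (\<integral>x. indicator chart_region x * (cutoff \<epsilon> x * weight \<sigma> (x, 0) * ff x) \<partial>lborel)" for \<epsilon>
  define X where "X \<epsilon> k = (\<integral>x. indicator chart_region x * (cutoff \<epsilon> x * weight \<sigma> (x, 0) * (v k (x, 0))\<^sup>2) \<partial>lborel)" for \<epsilon> k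
  have vc: "continuous_on (closure \<Omega>) (\<lambda>x. (v k (x, 0))\<^sup>2)" for k
    by (intro continuous_intros continuous_on_compose2[OF spacetime_C1_cont(1)[OF v]]) (use T_pos in auto)
  have ia: "integrable lborel (\<lambda>x. indicator chart_region x * (cutoff \<epsilon> x * weight \<sigma> (x, 0) * ff x))" for \<epsilon>
    by (rule integrable_chart_region_weighted[OF ffc \<sigma>(1)])
  have iX: "integrable lborel (\<lambda>x. indicator chart_region x * (cutoff \<epsilon> x * weight \<sigma> (x, 0) * (v k (x, 0))\<^sup>2))" for \<epsilon> k
    by (rule integrable_chart_region_weighted[OF vc \<sigma>(1)])
  have a0: "0 \<le> a \<epsilon>" for \<epsilon>
    unfolding a_def using cutoff_bounds weight_nonneg by (intro integral_nonneg_AE AE_I2) (auto simp: ff_def)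
  have bnd: "\<forall>\<^sub>F \<epsilon> in at_right 0. X \<epsilon> k \<le> M0\<^sup>2 / \<mu> * a \<epsilon> + K * (weight_bound \<sigma> * b k + \<omega> * h)" if "0 < \<omega>" for k \<omega>
  proof -
    have gc: "continuous_on (closure \<Omega> \<times> {0..T}) (\<lambda>z. K * (weight_bound \<sigma> * (v k z)\<^sup>2 + \<omega>))"
      by (intro continuous_intros spacetime_C1_cont(1)[OF v])
    have g2: "continuous_on (closure \<Omega> \<times> {0..T}) (\<lambda>z. (v k z)\<^sup>2)"
      by (intro continuous_intros spacetime_C1_cont(1)[OF v])
    note m1 = L.lateral_measurable_ennreal[OF g2] and m2 = L.lateral_measurable_ennreal[OF continuous_on_const[of _ 1]]
    have "(\<integral>\<^sup>+t\<in>{0<..<T}. (\<integral>\<^sup>+y. ennreal (K * (weight_bound \<sigma> * (v k (y, t))\<^sup>2 + \<omega>)) * indicator \<Gamma> y \<partial>hausdorff_measure (CARD('n) - 1)) \<partial>lborel) =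
        (\<integral>\<^sup>+z. ennreal (K * (weight_bound \<sigma> * (v k z)\<^sup>2 + \<omega>)) * indicator (\<Gamma> \<times> {0<..<T}) z \<partial>lateral_measure \<Omega>)"
      by (rule L.nn_integral_lateral[OF gc])
    also have "\<dots> = (\<integral>\<^sup>+z. ennreal (K * weight_bound \<sigma>) * (ennreal ((v k z)\<^sup>2) * indicator (\<Gamma> \<times> {0<..<T}) z) +
        ennreal (K * \<omega>) * (ennreal 1 * indicator (\<Gamma> \<times> {0<..<T}) z) \<partial>lateral_measure \<Omega>)"
    proof (rule nn_integral_cong)
      fix z
      have "ennreal (K * (weight_bound \<sigma> * (v k z)\<^sup>2 + \<omega>)) = ennreal (K * weight_bound \<sigma>) * ennreal ((v k z)\<^sup>2) + ennreal (K * \<omega>)"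
        using K weight_bound_pos[of \<sigma>] \<open>0 < \<omega>\<close> by (simp add: ennreal_mult[symmetric] ennreal_plus[symmetric] distrib_left mult.assoc del: ennreal_plus)
      then show "ennreal (K * (weight_bound \<sigma> * (v k z)\<^sup>2 + \<omega>)) * indicator (\<Gamma> \<times> {0<..<T}) z =
        ennreal (K * weight_bound \<sigma>) * (ennreal ((v k z)\<^sup>2) * indicator (\<Gamma> \<times> {0<..<T}) z) +
        ennreal (K * \<omega>) * (ennreal 1 * indicator (\<Gamma> \<times> {0<..<T}) z)"
        by (cases "z \<in> \<Gamma> \<times> {0<..<T}") simp_all
    qed
    also have "\<dots> = ennreal (K * weight_bound \<sigma>) * (\<integral>\<^sup>+z. ennreal ((v k z)\<^sup>2) * indicator (\<Gamma> \<times> {0<..<T}) z \<partial>lateral_measure \<Omega>) +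
        ennreal (K * \<omega>) * (\<integral>\<^sup>+z. ennreal 1 * indicator (\<Gamma> \<times> {0<..<T}) z \<partial>lateral_measure \<Omega>)"
      unfolding nn_integral_cmult[OF m1, symmetric] nn_integral_cmult[OF m2, symmetric]
      by (intro nn_integral_add borel_measurable_times_ennreal borel_measurable_const m1 m2)
    also have "(\<integral>\<^sup>+z. ennreal ((v k z)\<^sup>2) * indicator (\<Gamma> \<times> {0<..<T}) z \<partial>lateral_measure \<Omega>) = ennreal (b k)"
      unfolding b_def by (rule L.nn_integral_lateral_L2_norm[OF spacetime_C1_cont(1)[OF v]])
    also have "(\<integral>\<^sup>+z. ennreal 1 * indicator (\<Gamma> \<times> {0<..<T}) z \<partial>lateral_measure \<Omega>) = ennreal h"
      using L.lateral_sets by (simp add: h(1))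
    also have "ennreal (K * weight_bound \<sigma>) * ennreal (b k) + ennreal (K * \<omega>) * ennreal h =
        ennreal (K * (weight_bound \<sigma> * b k + \<omega> * h))"
      using K weight_bound_pos[of \<sigma>] \<open>0 < \<omega>\<close> h(2)
      by (simp add: b_def ennreal_mult[symmetric] ennreal_plus[symmetric] distrib_left mult.assoc del: ennreal_plus)
    finally have rhs: "(\<integral>\<^sup>+t\<in>{0<..<T}. (\<integral>\<^sup>+y. ennreal (K * (weight_bound \<sigma> * (v k (y, t))\<^sup>2 + \<omega>)) * indicator \<Gamma> y \<partial>hausdorff_measure (CARD('n) - 1)) \<partial>lborel) =
        ennreal (K * (weight_bound \<sigma> * b k + \<omega> * h))" .
    from boundary_layer[OF spacetime_C1_cont(1)[OF v] \<sigma>(1) that \<Gamma>, of k, folded K_def, unfolded rhs]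
      eventually_at_right_less[of "0::real"]
    show ?thesis
    proof eventually_elim
      case (elim \<epsilon>)
      have "ennreal (X \<epsilon> k) \<le> ennreal (M0\<^sup>2 / \<mu>) * (\<integral>\<^sup>+x. ennreal (indicator chart_region x * (cutoff \<epsilon> x * weight \<sigma> (x, 0) * ff x)) \<partial>lborel) +
        (\<integral>\<^sup>+t\<in>{0<..<T}. (\<integral>\<^sup>+x. ennreal (4 * M / \<epsilon> * (weight \<sigma> (x, t) * (v k (x, t))\<^sup>2)) * indicator (strip (2 * \<epsilon>)) x \<partial>lborel) \<partial>lborel)"
        unfolding X_def ff_def
        by (rule energy_estimate[OF H p(1) v f V eq Vb \<mu> \<sigma> elim(2)])
      also have "(\<integral>\<^sup>+x. ennreal (indicator chart_region x * (cutoff \<epsilon> x * weight \<sigma> (x, 0) * ff x)) \<partial>lborel) = ennreal (a \<epsilon>)"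
        unfolding a_def using cutoff_bounds weight_nonneg
        by (intro nn_integral_eq_integral ia) (auto simp: ff_def)
      also have "ennreal (M0\<^sup>2 / \<mu>) * ennreal (a \<epsilon>) + (\<integral>\<^sup>+t\<in>{0<..<T}. (\<integral>\<^sup>+x. ennreal (4 * M / \<epsilon> * (weight \<sigma> (x, t) * (v k (x, t))\<^sup>2)) * indicator (strip (2 * \<epsilon>)) x \<partial>lborel) \<partial>lborel) \<le>
         ennreal (M0\<^sup>2 / \<mu>) * ennreal (a \<epsilon>) + ennreal (K * (weight_bound \<sigma> * b k + \<omega> * h))"
        by (intro add_left_mono elim(1))
      also have "\<dots> = ennreal (M0\<^sup>2 / \<mu> * a \<epsilon> + K * (weight_bound \<sigma> * b k + \<omega> * h))"
        using K weight_bound_pos[of \<sigma>] \<open>0 < \<omega>\<close> h(2) \<mu> a0[of \<epsilon>]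
        by (simp add: b_def ennreal_mult[symmetric] ennreal_plus[symmetric] del: ennreal_plus)
      finally show ?case
        using K weight_bound_pos[of \<sigma>] \<open>0 < \<omega>\<close> h(2) \<mu> a0[of \<epsilon>]
        by (subst (asm) ennreal_le_iff) (auto simp: b_def)
    qed
  qed
  have cX: "c * a \<epsilon> \<le> (\<Sum>k\<in>UNIV. X \<epsilon> k)" for \<epsilon>
  proof -
    have "c * a \<epsilon> = (\<integral>x. c * (indicator chart_region x * (cutoff \<epsilon> x * weight \<sigma> (x, 0) * ff x)) \<partial>lborel)"
      by (simp add: a_def)
    also have "\<dots> \<le> (\<integral>x. (\<Sum>k\<in>UNIV. indicator chart_region x * (cutoff \<epsilon> x * weight \<sigma> (x, 0) * (v k (x, 0))\<^sup>2)) \<partial>lborel)"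
    proof (rule integral_mono)
      show "integrable lborel (\<lambda>x. c * (indicator chart_region x * (cutoff \<epsilon> x * weight \<sigma> (x, 0) * ff x)))"
        using ia by simp
      show "integrable lborel (\<lambda>x. \<Sum>k\<in>UNIV. indicator chart_region x * (cutoff \<epsilon> x * weight \<sigma> (x, 0) * (v k (x, 0))\<^sup>2))"
        by (intro Bochner_Integration.integrable_sum iX)
      fix x
      show "c * (indicator chart_region x * (cutoff \<epsilon> x * weight \<sigma> (x, 0) * ff x)) \<le>
        (\<Sum>k\<in>UNIV. indicator chart_region x * (cutoff \<epsilon> x * weight \<sigma> (x, 0) * (v k (x, 0))\<^sup>2))"
      proof (cases "x \<in> chart_region")
        case True
        then have xO: "x \<in> \<Omega>" by (simp add: chart_region_def)
        have "(cutoff \<epsilon> x * weight \<sigma> (x, 0)) * (c * ff x) \<le> (cutoff \<epsilon> x * weight \<sigma> (x, 0)) * (\<Sum>k\<in>UNIV. (v k (x, 0))\<^sup>2)"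
          using c(2)[OF xO, of "f x"] cutoff_bounds weight_nonneg
          by (intro mult_left_mono) (auto simp: ff_def init[OF xO])
        then show ?thesis using True by (simp add: sum_distrib_left mult_ac)
      qed simp
    qed
    also have "\<dots> = (\<Sum>k\<in>UNIV. X \<epsilon> k)"
      unfolding X_def by (rule Bochner_Integration.integral_sum) (rule iX)
    finally show ?thesis .
  qed
  define n where "n = real CARD('n)"
  have n\<mu>: "n * (M0\<^sup>2 / \<mu>) = c / 2" using c \<open>0 < M0\<close> by (simp add: \<mu>_def n_def)
  define Y where "Y = (\<integral>x. indicator cone x * ff x \<partial>lborel)"
  have est: "\<forall>\<^sub>F \<epsilon> in at_right 0. c / 2 * (m * Y) \<le>
      K * (weight_bound \<sigma> * (\<Sum>k\<in>UNIV. b k) + n * \<omega> * h) + c / 2 * (m * (B * (unit_ball_vol (real CARD('n)) * (8 * \<epsilon>) ^ CARD('n))))"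
    if "0 < \<omega>" for \<omega>
  proof -
    have "\<forall>\<^sub>F \<epsilon> in at_right 0. \<forall>k\<in>UNIV. X \<epsilon> k \<le> M0\<^sup>2 / \<mu> * a \<epsilon> + K * (weight_bound \<sigma> * b k + \<omega> * h)"
      using bnd[OF that] by (intro eventually_ball_finite) auto
    then show ?thesis using eventually_at_right_less[of "0::real"]
    proof eventually_elim
      case (elim \<epsilon>)
      have "c * a \<epsilon> \<le> (\<Sum>k\<in>UNIV. X \<epsilon> k)" by (rule cX)
      also have "\<dots> \<le> (\<Sum>k\<in>UNIV. M0\<^sup>2 / \<mu> * a \<epsilon> + K * (weight_bound \<sigma> * b k + \<omega> * h))"
        using elim(1) by (intro sum_mono) auto
      also have "\<dots> = n * (M0\<^sup>2 / \<mu>) * a \<epsilon> + K * (weight_bound \<sigma> * (\<Sum>k\<in>UNIV. b k) + n * \<omega> * h)"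
        by (simp add: sum.distrib sum_distrib_left sum_distrib_right n_def algebra_simps)
      finally have 1: "c / 2 * a \<epsilon> \<le> K * (weight_bound \<sigma> * (\<Sum>k\<in>UNIV. b k) + n * \<omega> * h)"
        unfolding n\<mu> by simp
      have "m * Y \<le> a \<epsilon> + m * (B * measure lborel (ball x0 (8 * \<epsilon>)))"
        unfolding m_def Y_def a_def
        by (rule integral_cone_le[OF ffc]) (use B \<sigma> elim in \<open>auto simp: ff_def\<close>)
      then have "c / 2 * (m * Y) \<le> c / 2 * (a \<epsilon> + m * (B * measure lborel (ball x0 (8 * \<epsilon>))))"
        using c by (intro mult_left_mono) auto
      also have "measure lborel (ball x0 (8 * \<epsilon>)) = unit_ball_vol (real CARD('n)) * (8 * \<epsilon>) ^ CARD('n)"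
        using elim(2) content_ball[of "8 * \<epsilon>" x0] by simp
      finally show ?case using 1 by (simp add: distrib_left)
    qed
  qed
  have est2: "c / 2 * (m * Y) \<le> K * (weight_bound \<sigma> * (\<Sum>k\<in>UNIV. b k) + n * \<omega> * h)" if "0 < \<omega>" for \<omega>
  proof (rule tendsto_lowerbound[OF _ est[OF that]])
    have "((\<lambda>\<epsilon>. K * (weight_bound \<sigma> * (\<Sum>k\<in>UNIV. b k) + n * \<omega> * h) + c / 2 * (m * (B * (unit_ball_vol (real CARD('n)) * (8 * \<epsilon>) ^ CARD('n))))) \<longlongrightarrow>
      K * (weight_bound \<sigma> * (\<Sum>k\<in>UNIV. b k) + n * \<omega> * h) + c / 2 * (m * (B * (unit_ball_vol (real CARD('n)) * (8 * 0) ^ CARD('n))))) (at_right 0)"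
      by (intro tendsto_intros)
    then show "((\<lambda>\<epsilon>. K * (weight_bound \<sigma> * (\<Sum>k\<in>UNIV. b k) + n * \<omega> * h) + c / 2 * (m * (B * (unit_ball_vol (real CARD('n)) * (8 * \<epsilon>) ^ CARD('n))))) \<longlongrightarrow>
      K * (weight_bound \<sigma> * (\<Sum>k\<in>UNIV. b k) + n * \<omega> * h)) (at_right 0)"
      by (simp add: power_0_left)
  qed simp
  have "c / 2 * (m * Y) \<le> K * (weight_bound \<sigma> * (\<Sum>k\<in>UNIV. b k) + n * 0 * h)"
  proof (rule tendsto_lowerbound)
    show "((\<lambda>\<omega>. K * (weight_bound \<sigma> * (\<Sum>k\<in>UNIV. b k) + n * \<omega> * h)) \<longlongrightarrow>
      K * (weight_bound \<sigma> * (\<Sum>k\<in>UNIV. b k) + n * 0 * h)) (at_right 0)"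
      by (intro tendsto_intros)
    show "\<forall>\<^sub>F \<omega> in at_right 0. c / 2 * (m * Y) \<le> K * (weight_bound \<sigma> * (\<Sum>k\<in>UNIV. b k) + n * \<omega> * h)"
      using eventually_at_right_less[of "0::real"] by (rule eventually_mono) (rule est2)
  qed simp
  then show ?thesis by (simp add: m_def Y_def ff_def K_def b_def mult.assoc)
qed

end

lemma spacetime_C1_diff:
  assumes "spacetime_C1 \<Omega> T v1 P1 Q1" "spacetime_C1 \<Omega> T v2 P2 Q2"
  shows "spacetime_C1 \<Omega> T (\<lambda>z. v1 z - v2 z) (\<lambda>z. P1 z - P2 z) (\<lambda>z. Q1 z - Q2 z)"
  unfolding spacetime_C1_def
proof (intro conjI ballI)
  fix x t assume "x \<in> \<Omega>" "t \<in> {0<..<T}"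
  then have "(v1 has_derivative (\<lambda>(h, k). P1 (x, t) \<bullet> h + Q1 (x, t) * k)) (at (x, t))"
    "(v2 has_derivative (\<lambda>(h, k). P2 (x, t) \<bullet> h + Q2 (x, t) * k)) (at (x, t))"
    using assms unfolding spacetime_C1_def by blast+
  from has_derivative_diff[OF this]
  show "((\<lambda>z. v1 z - v2 z) has_derivative (\<lambda>(h, k). (P1 (x, t) - P2 (x, t)) \<bullet> h + (Q1 (x, t) - Q2 (x, t)) * k)) (at (x, t))"
    by (rule has_derivative_eq_rhs) (auto simp: fun_eq_iff inner_diff_left algebra_simps)
qed (use assms in \<open>auto simp: spacetime_C1_def intro!: continuous_intros\<close>)

theorem theorem1:
  fixes \<Omega> \<Gamma> :: "(real^'n) set" and x0 :: "real^'n" and T \<delta>0 M :: real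
    and p :: "real^'n \<Rightarrow> real" and a :: "'n \<Rightarrow> real^'n \<Rightarrow> real"
  assumes "domain \<Omega>" "bounded \<Omega>" "smooth_boundary \<Omega>"
    and "subboundary \<Omega> \<Gamma>" "x0 \<in> \<Gamma>"
    and "T > 0" "\<delta>0 > 0" "M > 0"
    and "continuous_on (closure \<Omega>) p"
    and "\<And>k. C1_closure \<Omega> (a k)"
    and "\<And>x. x \<in> closure \<Omega> \<Longrightarrow> \<bar>det (\<chi> i k. grad_closure \<Omega> (a k) x $ i)\<bar> \<noteq> 0"
  shows "\<exists>D. domain D \<and> D \<subseteq> \<Omega> \<and> x0 \<in> frontier D \<inter> frontier \<Omega> \<and> frontier D \<inter> frontier \<Omega> \<subseteq> \<Gamma> \<and>
    (\<forall>M0>0. \<exists>C>0. \<exists>\<theta>\<in>{0<..<1}.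
      \<forall>H1\<in>admissible \<Omega> x0 \<delta>0 M. \<forall>H2\<in>admissible \<Omega> x0 \<delta>0 M. \<forall>u1 u2.
        (\<forall>k. solution \<Omega> T p H1 (a k) (u1 k) \<and> solution \<Omega> T p H2 (a k) (u2 k) \<and>
             C1_closure (\<Omega> \<times> {0<..<T}) (dt T (u1 k)) \<and> C1_closure (\<Omega> \<times> {0<..<T}) (dt T (u2 k)) \<and>
             L2_Linf_norm_sq T \<Omega> (dt T (grad_x (u1 k))) \<le> ennreal (M0\<^sup>2) \<and>
             L2_Linf_norm_sq T \<Omega> (dt T (grad_x (u2 k))) \<le> ennreal (M0\<^sup>2)) \<longrightarrow>
        L2_norm lborel D (\<lambda>x. H1 x - H2 x) \<le>
          C * ((\<Sum>k\<in>UNIV. L2_norm (surface_measure \<Omega> \<Otimes>\<^sub>M lborel) (\<Gamma> \<times> {0<..<T})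
                   (\<lambda>z. dt T (u1 k) z - dt T (u2 k) z) powr \<theta>) +
               (\<Sum>k\<in>UNIV. L2_norm (surface_measure \<Omega> \<Otimes>\<^sub>M lborel) (\<Gamma> \<times> {0<..<T})
                   (\<lambda>z. dt T (u1 k) z - dt T (u2 k) z))))"
proof -
  have dom: "open \<Omega>" "\<Omega> \<noteq> {}" using assms(1) by (auto simp: domain_def)
  obtain U where U: "open U" "\<Gamma> = frontier \<Omega> \<inter> U"
    using assms(4) by (auto simp: subboundary_def openin_open)
  have x0: "x0 \<in> frontier \<Omega>" "x0 \<in> U" using assms(5) U by auto
  obtain r0 where r0: "0 < r0" "ball x0 r0 \<subseteq> U" using U(1) x0(2) openE by blast
  define \<nu> where "\<nu> = outward_normal \<Omega> x0"
  define e where "e = min (1/8) (\<delta>0 / (64 * M))"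
  have e: "0 < e" "e \<le> 1/8" "e \<le> \<delta>0 / (64 * M)" using assms(7,8) by (auto simp: e_def)
  obtain R1 \<rho> G where R1: "boundary_chart \<Omega> x0 \<nu> e R1 \<rho> G"
    using exists_boundary_chart[OF assms(3) dom(1) x0(1) e(1,2)] unfolding \<nu>_def by blast
  (* The radius, and with it the cone, is fixed before M0: absorption of large M0 is left to the
     exponent of the weight. *)
  define R where "R = min (min R1 r0) (min (64 * M * T) (2 * \<delta>0 / (7 * M)))"
  have R: "0 < R" "R \<le> R1" "R \<le> r0" "R \<le> 64 * M * T" "R \<le> 2 * \<delta>0 / (7 * M)"
    using boundary_chart.R_pos[OF R1] r0(1) assms(6-8) by (auto simp: R_def)
  interpret boundary_chart \<Omega> x0 \<nu> e R \<rho> G by (rule boundary_chart_shrink[OF R1 R(1,2)])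
  interpret weighted_chart \<Omega> x0 \<nu> e R \<rho> G T \<delta>0 M
    by unfold_locales (use assms(2,6-8) e R in auto)
  have \<Gamma>R: "frontier \<Omega> \<inter> ball x0 R \<subseteq> \<Gamma>" using U(2) r0(2) R(3) by auto
  have lat: "lateral_boundary \<Omega> \<Gamma> T"
    by unfold_locales (use assms(2,3,6) dom U in auto)
  have comp: "compact (closure \<Omega>)" "closure \<Omega> \<noteq> {}" using assms(2) dom by auto
  obtain p1 where p1: "\<And>x. x \<in> closure \<Omega> \<Longrightarrow> norm (p x) \<le> p1"
    using compact_imp_bounded[OF compact_continuous_image[OF assms(9) comp(1)]] unfolding bounded_iff by blast
  define p0 where "p0 = max 0 p1"
  have cl: "x \<in> closure \<Omega>" if "x \<in> \<Omega>" for x using that closure_subset by blast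
  have p0: "\<bar>p x\<bar> \<le> p0" if "x \<in> \<Omega>" for x using p1[OF cl[OF that]] by (simp add: p0_def)
  obtain c where c: "0 < c" "\<And>x g. x \<in> closure \<Omega> \<Longrightarrow> c * (norm g)\<^sup>2 \<le> (\<Sum>k\<in>UNIV. (g \<bullet> grad_closure \<Omega> (a k) x)\<^sup>2)"
    using exists_det_lower_bound[OF comp, of "\<lambda>x k. grad_closure \<Omega> (a k) x"]
      C1_closure_grad_closure(1)[OF assms(10) dom(1)] assms(11) by auto
  have "\<exists>C>0. \<exists>\<theta>\<in>{0<..<1}.
      \<forall>H1\<in>admissible \<Omega> x0 \<delta>0 M. \<forall>H2\<in>admissible \<Omega> x0 \<delta>0 M. \<forall>u1 u2.
        (\<forall>k. solution \<Omega> T p H1 (a k) (u1 k) \<and> solution \<Omega> T p H2 (a k) (u2 k) \<and>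
             C1_closure (\<Omega> \<times> {0<..<T}) (dt T (u1 k)) \<and> C1_closure (\<Omega> \<times> {0<..<T}) (dt T (u2 k)) \<and>
             L2_Linf_norm_sq T \<Omega> (dt T (grad_x (u1 k))) \<le> ennreal (M0\<^sup>2) \<and>
             L2_Linf_norm_sq T \<Omega> (dt T (grad_x (u2 k))) \<le> ennreal (M0\<^sup>2)) \<longrightarrow>
        L2_norm lborel cone (\<lambda>x. H1 x - H2 x) \<le>
          C * ((\<Sum>k\<in>UNIV. L2_norm (surface_measure \<Omega> \<Otimes>\<^sub>M lborel) (\<Gamma> \<times> {0<..<T})
                   (\<lambda>z. dt T (u1 k) z - dt T (u2 k) z) powr \<theta>) +
               (\<Sum>k\<in>UNIV. L2_norm (surface_measure \<Omega> \<Otimes>\<^sub>M lborel) (\<Gamma> \<times> {0<..<T})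
                   (\<lambda>z. dt T (u1 k) z - dt T (u2 k) z)))" if M0: "0 < M0" for M0
  proof -
    define \<mu> where "\<mu> = 2 * real CARD('n) * M0\<^sup>2 / c"
    define \<sigma> where "\<sigma> = 2 / \<delta>0 * (real CARD('n) * M + 2 * p0 + \<mu>)"
    define K1 where "K1 = c / 2 * (exp (- (\<sigma> * R)) * (\<epsilon>0 / 2)\<^sup>2)"
    define K2 where "K2 = 16 * M * tube_const CARD('n) * weight_bound \<sigma>"
    define C where "C = sqrt (K2 / K1)"
    have K: "0 < K1" "0 < K2"
      using c(1) kr_pos(3) assms(8) tube_const_pos[of "CARD('n)"] weight_bound_pos[of \<sigma>] by (simp_all add: K1_def K2_def)
    then have C: "0 < C" by (simp add: C_def)
    have main: "L2_norm lborel cone (\<lambda>x. H1 x - H2 x) \<le>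
          C * (\<Sum>k\<in>UNIV. L2_norm (lateral_measure \<Omega>) (\<Gamma> \<times> {0<..<T}) (\<lambda>z. dt T (u1 k) z - dt T (u2 k) z))"
      if H1: "H1 \<in> admissible \<Omega> x0 \<delta>0 M" and H2: "H2 \<in> admissible \<Omega> x0 \<delta>0 M"
        and u: "\<And>k. solution \<Omega> T p H1 (a k) (u1 k)" "\<And>k. solution \<Omega> T p H2 (a k) (u2 k)"
        and d: "\<And>k. C1_closure (\<Omega> \<times> {0<..<T}) (dt T (u1 k))" "\<And>k. C1_closure (\<Omega> \<times> {0<..<T}) (dt T (u2 k))"
        and b: "\<And>k. L2_Linf_norm_sq T \<Omega> (dt T (grad_x (u2 k))) \<le> ennreal (M0\<^sup>2)"
      for H1 H2 u1 u2
    proof -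
      obtain P1 Q1 where v1: "\<And>k. spacetime_C1 \<Omega> T (dt T (u1 k)) (P1 k) (Q1 k)"
        using C1_closure_spacetime[OF d(1) assms(6)] by metis
      obtain P2 Q2 where v2: "\<And>k. spacetime_C1 \<Omega> T (dt T (u2 k)) (P2 k) (Q2 k)"
        using C1_closure_spacetime[OF d(2) assms(6)] by metis
      define f where "f x = H2 x - H1 x" for x
      define L where "L k = L2_norm (lateral_measure \<Omega>) (\<Gamma> \<times> {0<..<T}) (\<lambda>z. dt T (u1 k) z - dt T (u2 k) z)" for k
      have L0: "0 \<le> L k" for k
        unfolding L_def L2_norm_def set_lebesgue_integral_def by (simp add: integral_nonneg_AE)
      have ok: "field_ok H1"
        unfolding field_ok_def using H1 by (simp add: admissible_def \<nu>_def)
      have "K1 * (\<integral>x. indicator cone x * (norm (f x))\<^sup>2 \<partial>lborel) \<le> K2 * (\<Sum>k\<in>UNIV. (L k)\<^sup>2)"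
        unfolding K1_def K2_def \<sigma>_def \<mu>_def L_def
      proof (rule stability_on_cone[OF lat \<Gamma>R ok p0, where A = "\<lambda>k. grad_closure \<Omega> (a k)" and V = P2])
        show "0 \<le> p0" by (simp add: p0_def)
        show "continuous_on (closure \<Omega>) f"
          using H1 H2 unfolding f_def by (intro continuous_intros) (auto simp: admissible_def C1_closure_def)
        show "spacetime_C1 \<Omega> T (\<lambda>z. dt T (u1 k) z - dt T (u2 k) z) (\<lambda>z. P1 k z - P2 k z) (\<lambda>z. Q1 k z - Q2 k z)" for k
          by (rule spacetime_C1_diff[OF v1 v2])
        show "continuous_on (closure \<Omega> \<times> {0..T}) (P2 k)" for k by (rule spacetime_C1_cont(2)[OF v2])
        show "Q1 k (x, t) - Q2 k (x, t) + H1 x \<bullet> (P1 k (x, t) - P2 k (x, t)) + p x * (dt T (u1 k) (x, t) - dt T (u2 k) (x, t)) =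
          f x \<bullet> P2 k (x, t)" if "x \<in> \<Omega>" "t \<in> {0<..<T}" for k x t
          using solution_time_derivative_equation(2)[OF u(1) dom(1) assms(6) v1 that, of k]
            solution_time_derivative_equation(2)[OF u(2) dom(1) assms(6) v2 that, of k]
          by (simp add: f_def inner_diff_left inner_diff_right right_diff_distrib)
        show "(\<integral>\<^sup>+t\<in>{0<..<T}. ennreal ((norm (P2 k (x, t)))\<^sup>2) \<partial>lborel) \<le> ennreal (M0\<^sup>2)" if "x \<in> \<Omega>" for k x
          by (rule nn_integral_time_bound[OF u(2) dom(1) assms(6) v2 b that])
        show "dt T (u1 k) (x, 0) - dt T (u2 k) (x, 0) = f x \<bullet> grad_closure \<Omega> (a k) x" if "x \<in> \<Omega>" for k x
          using solution_initial_time_derivative[OF u(1) dom(1) assms(6) v1 assms(10) that, of k]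
            solution_initial_time_derivative[OF u(2) dom(1) assms(6) v2 assms(10) that, of k]
          by (simp add: f_def inner_diff_left)
        show "c * (norm g)\<^sup>2 \<le> (\<Sum>k\<in>UNIV. (g \<bullet> grad_closure \<Omega> (a k) x)\<^sup>2)" if "x \<in> \<Omega>" for x g
          by (rule c(2)[OF cl[OF that]])
      qed (assumption | rule c(1) M0)+
      then have "(\<integral>x. indicator cone x * (norm (f x))\<^sup>2 \<partial>lborel) \<le> K2 / K1 * (\<Sum>k\<in>UNIV. (L k)\<^sup>2)"
        using K by (simp add: field_simps)
      then have "sqrt (\<integral>x. indicator cone x * (norm (f x))\<^sup>2 \<partial>lborel) \<le> C * sqrt (\<Sum>k\<in>UNIV. (L k)\<^sup>2)"
        unfolding C_def real_sqrt_mult[symmetric] by (rule real_sqrt_le_mono)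
      also have "\<dots> \<le> C * (\<Sum>k\<in>UNIV. L k)"
        using C L2_set_le_sum[of UNIV L] L0 by (intro mult_left_mono) (auto simp: L2_set_def)
      finally show ?thesis
        by (simp add: L2_norm_def set_lebesgue_integral_def f_def L_def norm_minus_commute)
    qed
    show ?thesis
    (* The linear sum suffices for the bound; the sum of powers is nonnegative for any exponent. *)
    proof (intro exI[of _ C] conjI C bexI[of _ "1/2"] ballI allI impI)
      fix H1 H2 u1 u2
      assume H: "H1 \<in> admissible \<Omega> x0 \<delta>0 M" "H2 \<in> admissible \<Omega> x0 \<delta>0 M"
        and u: "\<forall>k. solution \<Omega> T p H1 (a k) (u1 k) \<and> solution \<Omega> T p H2 (a k) (u2 k) \<and>
             C1_closure (\<Omega> \<times> {0<..<T}) (dt T (u1 k)) \<and> C1_closure (\<Omega> \<times> {0<..<T}) (dt T (u2 k)) \<and>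
             L2_Linf_norm_sq T \<Omega> (dt T (grad_x (u1 k))) \<le> ennreal (M0\<^sup>2) \<and>
             L2_Linf_norm_sq T \<Omega> (dt T (grad_x (u2 k))) \<le> ennreal (M0\<^sup>2)"
      let ?L = "\<lambda>k. L2_norm (lateral_measure \<Omega>) (\<Gamma> \<times> {0<..<T}) (\<lambda>z. dt T (u1 k) z - dt T (u2 k) z)"
      have "L2_norm lborel cone (\<lambda>x. H1 x - H2 x) \<le> C * (\<Sum>k\<in>UNIV. ?L k)"
        by (rule main[OF H]) (use u in blast)+
      also have "\<dots> \<le> C * ((\<Sum>k\<in>UNIV. ?L k powr (1/2)) + (\<Sum>k\<in>UNIV. ?L k))"
        using C by (intro mult_left_mono) (auto intro: sum_nonneg)
      finally show "L2_norm lborel cone (\<lambda>x. H1 x - H2 x) \<le> C * ((\<Sum>k\<in>UNIV. ?L k powr (1/2)) + (\<Sum>k\<in>UNIV. ?L k))" .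
    qed auto
  qed
  moreover have "x0 \<in> frontier cone \<inter> frontier \<Omega>" "frontier cone \<inter> frontier \<Omega> \<subseteq> \<Gamma>"
    using frontier_cone_Int assms(5) by auto
  moreover have "cone \<subseteq> \<Omega>" using cone_subset_chart_region by (auto simp: chart_region_def)
  ultimately show ?thesis using domain_cone by blast
qed

end
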